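(* $M_{\Gamma}$ is a free $\mathcal{D}_n$-module of rank $n$ generated by $n$ functions from $M_{\Gamma}(1)$.
   Context: Let $n$ be a positive integer. Fix $a_1,a_2,b_1,b_2\in\mathbb{C}$ with $(a_i,b_i)\neq(0,0)$ and $(a_1:b_1)\neq(a_2:b_2)$ in $\mathbb{C}P^1$, and a nondegenerate linear map $\mathcal{P}:\mathbb{C}^n\to\mathbb{C}^n$; the induced map $\mathbb{C}P^{n-1}\to\mathbb{C}P^{n-1}$ is also denoted $\mathcal{P}$. Let $\Gamma$ be obtained from $\mathbb{C}P^1\times\mathbb{C}P^{n-1}$ by identifying $(a_1:b_1,t)\sim(a_2:b_2,\mathcal{P}(t))$ for all $t\in\mathbb{C}P^{n-1}$. Assume the eigenvalues $\lambda_1,\dots,\lambda_n$ of $\mathcal{P}$ are pairwise distinct, with eigenvectors $\mathbf{w}_1,\dots,\mathbf{w}_n$. Fix $A\in\mathbb{C}^*$ and a function $f(z_1,z_2,t_1,\dots,t_n)=\sum_{i=1}^n(\alpha_i z_1t_i+\beta_i z_2t_i)$, $\alpha_i,\beta_i\in\mathbb{C}$, such that $f(a_1,b_1,t)-A f(a_2,b_2,\mathcal{P}(t))=0$ for all $t\in\mathbb{C}^n$ and $f(a_1,b_1,\mathbf{w}_j)\neq0$ for $j=1,\dots,n$. Let $f_i(z_1,z_2,t)=\sum_{k=1}^n(\alpha_{ik}z_1t_k+\beta_{ik}z_2t_k)$, $i=1,\dots,n$, be functions such that for some $c_i\in\mathbb{C}$ one has $f_i(a_1,b_1,t)-Af_i(a_2,b_2,\mathcal{P}(t))-c_if(a_1,b_1,t)=0$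 for all $t\in\mathbb{C}^n$ (equivalently $\frac{f_i(a_1,b_1,t)}{f(a_1,b_1,t)}-\frac{f_i(a_2,b_2,\mathcal{P}(t))}{f(a_2,b_2,\mathcal{P}(t))}=c_i$), and such that $f,f_1,\dots,f_n$ are linearly independent. (The space of functions of this form satisfying such an identity for some constant has dimension $n+1$.) The parameters $\alpha_i,\beta_i,\alpha_{ik},\beta_{ik}$ are in general position in the following sense: for each $k=1,\dots,n$, regard $f,f_j$ ($1\le j\le n$, $j\neq k$) as $n$ linear forms in $t_1,\dots,t_n$ with coefficients linear forms in $z_1,z_2$; the determinant of their $n\times n$ coefficient matrix, a homogeneous polynomial of degree $n$ in $(z_1,z_2)$, has no multiple roots in $\mathbb{C}P^1$, i.e. it has $n$ distinct roots. Let $x_0\in\mathbb{C}^n$ be a fixed point, let $\mathcal{O}$ be the ring of analytic functions of $x=(x_1,\dots,x_n)$ in a neighbourhood of $x_0$, and let $\mathcal{D}_n=\mathcal{O}[\partial_{x_1},\dots,\partial_{x_n}]$ be the ring of differential operators. Fix $\Lambda\in\mathbb{C}$. For $k\ge1$ let $M_\Gamma(k)$ be the set of functions $$\psi(x,P)=\frac{h(x,P)}{f^k(P)}\exp\Big(\sum_{j=1}^n\frac{f_j(P)}{f(P)}x_j\Big),\qquad P=(z_1:z_2,t)\in\mathbb{C}P^1\times\mathbb{C}P^{n-1},$$ where $h(x,P)=\sum_{0\le j\le k,\ |\alpha|=k}h_{j\alpha}(x)z_1^jz_2^{k-j}t^\alpha$ with $h_{j\alpha}\in\mathcal{O}$ (here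 $\alpha=(\alpha_1,\dots,\alpha_n)$ is a multi-index and $t^\alpha=t_1^{\alpha_1}\cdots t_n^{\alpha_n}$), satisfying $\psi(x,a_1:b_1,t)-\Lambda\,\psi(x,a_2:b_2,\mathcal{P}(t))=0$ for all $t\in\mathbb{C}P^{n-1}$. Put $M_\Gamma=\bigcup_{k\ge1}M_\Gamma(k)$. Since $\partial_{x_j}M_\Gamma(k)\subset M_\Gamma(k+1)$, $M_\Gamma$ is a module over $\mathcal{D}_n$, with operators acting in the variables $x$.
   Formalization: The formal statement adds the assumption that Λ differs from exp(c_1 x_{0,1}+…+c_n x_{0,n}), where x_0 is the fixed base point; when equality holds the claim fails (already for n=1, c_1≠0, x_0=0, Λ=1, where functions of M_Γ(1) do not generate M_Γ(2)). *)

theory Defs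
  imports "HOL-Analysis.Analysis"
begin

text \<open>
  Throughout, \<open>n = CARD('n)\<close>. Points of projective spaces are given by homogeneous coordinates:
  a function on \<open>CP^1 \<times> CP^(n-1)\<close> is written as a function of \<open>z1\<close>, \<open>z2\<close> and \<open>t\<close>. The set of
  representatives \<open>cp1_point\<close> is used where points of \<open>CP^1\<close> must be compared or counted.
\<close>

definition cp1_point :: "complex \<Rightarrow> complex \<Rightarrow> (complex \<times> complex) set" where
  "cp1_point z1 z2 = {(c * z1, c * z2) | c. c \<noteq> 0}"

definition cp1_roots :: "(complex \<Rightarrow> complex \<Rightarrow> complex) \<Rightarrow> (complex \<times> complex) set set" where
  "cp1_roots F = {cp1_point z1 z2 | z1 z2. (z1, z2) \<noteq> (0, 0) \<and> F z1 z2 = 0}"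

definition form11 ::
    "complex^'n \<Rightarrow> complex^'n \<Rightarrow> complex \<Rightarrow> complex \<Rightarrow> complex^'n \<Rightarrow> complex" where
  "form11 \<alpha> \<beta> z1 z2 t = (\<Sum>i\<in>UNIV. \<alpha>$i * z1 * t$i + \<beta>$i * z2 * t$i)"

text \<open>
  The forms in the theorem are \<open>f = form11 \<alpha> \<beta>\<close> and \<open>f_j = form11 (\<alpha>'$j) (\<beta>'$j)\<close>. The following is
  the determinant of the coefficient matrix, with respect to \<open>t\<close>, of \<open>f\<close> and the \<open>f_j\<close> with
  \<open>j \<noteq> k\<close>; the row of \<open>f\<close> is put in the vacant position \<open>k\<close>.
\<close>

definition omit_det ::
    "complex^'n \<Rightarrow> complex^'n \<Rightarrow> complex^'n^'n \<Rightarrow> complex^'n^'n \<Rightarrow> 'n \<Rightarrow>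
     complex \<Rightarrow> complex \<Rightarrow> complex" where
  "omit_det \<alpha> \<beta> \<alpha>' \<beta>' k z1 z2 =
     det (\<chi> j m. if j = k then \<alpha>$m * z1 + \<beta>$m * z2 else \<alpha>'$j$m * z1 + \<beta>'$j$m * z2)"

text \<open>
  Germs at \<open>x0\<close> are handled through representatives, that is, through total functions that are
  compared only near \<open>x0\<close>. As in the library's one-variable \<open>analytic_on\<close>, analyticity at a point
  means complex differentiability (here: a complex linear total derivative) in a neighbourhood.
\<close>

definition analytic_germs :: "complex^'n \<Rightarrow> (complex^'n \<Rightarrow> complex) set" where
  "analytic_germs x0 =
     {g. \<exists>U. open U \<and> x0 \<in> U \<and>
       (\<forall>x\<in>U. \<exists>D. (g has_derivative D) (at x) \<and> (\<forall>c v. D (c *s v) = c * D v))}"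

definition partial_deriv :: "'n \<Rightarrow> (complex^'n \<Rightarrow> complex) \<Rightarrow> complex^'n \<Rightarrow> complex" where
  "partial_deriv j g x = deriv (\<lambda>s. g (x + axis j s)) 0"

text \<open>
  The ring \<open>D_n\<close> of differential operators: generated by the multiplications with elements of
  \<open>O = analytic_germs x0\<close> and the partial derivatives. An element is zero iff it annihilates \<open>O\<close>.
\<close>

inductive_set diff_ops ::
    "complex^'n \<Rightarrow> ((complex^'n \<Rightarrow> complex) \<Rightarrow> (complex^'n \<Rightarrow> complex)) set"
  for x0 :: "complex^'n" where
  mult: "a \<in> analytic_germs x0 \<Longrightarrow> (\<lambda>g x. a x * g x) \<in> diff_ops x0"
| partial: "partial_deriv j \<in> diff_ops x0"
| add: "L \<in> diff_ops x0 \<Longrightarrow> L' \<in> diff_ops x0 \<Longrightarrow> (\<lambda>g x. L g x + L' g x) \<in> diff_ops x0"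
| comp: "L \<in> diff_ops x0 \<Longrightarrow> L' \<in> diff_ops x0 \<Longrightarrow> (\<lambda>g. L (L' g)) \<in> diff_ops x0"

definition zero_op ::
    "complex^'n \<Rightarrow> ((complex^'n \<Rightarrow> complex) \<Rightarrow> (complex^'n \<Rightarrow> complex)) \<Rightarrow> bool" where
  "zero_op x0 L \<longleftrightarrow> (\<forall>g\<in>analytic_germs x0. \<forall>\<^sub>F x in nhds x0. L g x = 0)"

text \<open>A function \<open>\<psi>(x, P)\<close> with \<open>P = (z1 : z2, t)\<close>.\<close>

type_synonym 'n xfun = "complex^'n \<Rightarrow> complex \<Rightarrow> complex \<Rightarrow> complex^'n \<Rightarrow> complex"

definition act ::
    "((complex^'n \<Rightarrow> complex) \<Rightarrow> (complex^'n \<Rightarrow> complex)) \<Rightarrow> 'n xfun \<Rightarrow> 'n xfun" where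
  "act L \<psi> = (\<lambda>x z1 z2 t. L (\<lambda>y. \<psi> y z1 z2 t) x)"

text \<open>
  Equality of germs in \<open>x\<close> at \<open>x0\<close>, as functions of the points \<open>P\<close> off the polar divisor \<open>f = 0\<close>.
  The condition \<open>f z1 z2 t \<noteq> 0\<close> excludes \<open>z1 = z2 = 0\<close> and \<open>t = 0\<close>.
\<close>

definition germ_eq ::
    "complex^'n \<Rightarrow> (complex \<Rightarrow> complex \<Rightarrow> complex^'n \<Rightarrow> complex) \<Rightarrow>
     'n xfun \<Rightarrow> 'n xfun \<Rightarrow> bool" where
  "germ_eq x0 f \<psi> \<phi> \<longleftrightarrow>
     (\<forall>\<^sub>F x in nhds x0. \<forall>z1 z2 t. f z1 z2 t \<noteq> 0 \<longrightarrow> \<psi> x z1 z2 t = \<phi> x z1 z2 t)"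

definition numerator ::
    "nat \<Rightarrow> (nat \<Rightarrow> ('n \<Rightarrow> nat) \<Rightarrow> complex^'n \<Rightarrow> complex) \<Rightarrow> 'n xfun" where
  "numerator k h x z1 z2 t =
     (\<Sum>j\<le>k. \<Sum>\<alpha> | (\<Sum>i\<in>UNIV. \<alpha> i) = k.
        h j \<alpha> x * z1^j * z2^(k - j) * (\<Prod>i\<in>UNIV. t$i ^ \<alpha> i))"

definition BA_level ::
    "complex \<Rightarrow> complex \<Rightarrow> complex \<Rightarrow> complex \<Rightarrow> complex^'n^'n \<Rightarrow> complex \<Rightarrow>
     (complex \<Rightarrow> complex \<Rightarrow> complex^'n \<Rightarrow> complex) \<Rightarrow>
     ('n \<Rightarrow> complex \<Rightarrow> complex \<Rightarrow> complex^'n \<Rightarrow> complex) \<Rightarrow>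
     complex^'n \<Rightarrow> nat \<Rightarrow> 'n xfun set" where
  "BA_level a1 b1 a2 b2 T \<Lambda> f F x0 k =
     {\<psi>. (\<exists>h. (\<forall>j \<alpha>. h j \<alpha> \<in> analytic_germs x0) \<and>
            germ_eq x0 f \<psi>
              (\<lambda>x z1 z2 t. numerator k h x z1 z2 t / f z1 z2 t ^ k *
                 exp (\<Sum>j\<in>UNIV. F j z1 z2 t / f z1 z2 t * x$j))) \<and>
         (\<forall>\<^sub>F x in nhds x0. \<forall>t. f a1 b1 t \<noteq> 0 \<and> f a2 b2 (T *v t) \<noteq> 0 \<longrightarrow>
            \<psi> x a1 b1 t - \<Lambda> * \<psi> x a2 b2 (T *v t) = 0)}"

definition BA_module ::
    "complex \<Rightarrow> complex \<Rightarrow> complex \<Rightarrow> complex \<Rightarrow> complex^'n^'n \<Rightarrow> complex \<Rightarrow>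
     (complex \<Rightarrow> complex \<Rightarrow> complex^'n \<Rightarrow> complex) \<Rightarrow>
     ('n \<Rightarrow> complex \<Rightarrow> complex \<Rightarrow> complex^'n \<Rightarrow> complex) \<Rightarrow>
     complex^'n \<Rightarrow> 'n xfun set" where
  "BA_module a1 b1 a2 b2 T \<Lambda> f F x0 = (\<Union>k\<in>{1..}. BA_level a1 b1 a2 b2 T \<Lambda> f F x0 k)"

definition diff_module ::
    "complex^'n \<Rightarrow> 'n xfun set \<Rightarrow> bool" where
  "diff_module x0 M \<longleftrightarrow>
     (\<lambda>x z1 z2 t. 0) \<in> M \<and>
     (\<forall>\<psi>\<in>M. \<forall>\<phi>\<in>M. (\<lambda>x z1 z2 t. \<psi> x z1 z2 t + \<phi> x z1 z2 t) \<in> M) \<and>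
     (\<forall>L\<in>diff_ops x0. \<forall>\<psi>\<in>M. act L \<psi> \<in> M)"

text \<open>
  \<open>free_basis x0 f M \<psi>\<close>: the family \<open>\<psi>\<close>, which has \<open>CARD('i)\<close> members, is a basis of the
  \<open>D_n\<close>-module \<open>M\<close> of germs.
\<close>

definition free_basis ::
    "complex^'n \<Rightarrow> (complex \<Rightarrow> complex \<Rightarrow> complex^'n \<Rightarrow> complex) \<Rightarrow> 'n xfun set \<Rightarrow>
     ('i::finite \<Rightarrow> 'n xfun) \<Rightarrow> bool" where
  "free_basis x0 f M \<psi> \<longleftrightarrow>
     (\<forall>i. \<psi> i \<in> M) \<and>
     (\<forall>\<phi>\<in>M. \<exists>L. (\<forall>i. L i \<in> diff_ops x0) \<and>
        germ_eq x0 f \<phi> (\<lambda>x z1 z2 t. \<Sum>i\<in>UNIV. act (L i) (\<psi> i) x z1 z2 t)) \<and>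
     (\<forall>L. (\<forall>i. L i \<in> diff_ops x0) \<and>
        germ_eq x0 f (\<lambda>x z1 z2 t. \<Sum>i\<in>UNIV. act (L i) (\<psi> i) x z1 z2 t) (\<lambda>x z1 z2 t. 0) \<longrightarrow>
        (\<forall>i. zero_op x0 (L i)))"

end

theory Submission
  imports Defs
    "HOL-Complex_Analysis.Cauchy_Integral_Formula"
    "HOL-Computational_Algebra.Fundamental_Theorem_Algebra"
begin

text \<open>
  Let \<open>s1, s2\<close> be the coordinates of \<open>z\<close> with respect to the two points \<open>p1 = (a1, b1)\<close> and
  \<open>p2 = (a2, b2)\<close> over which the product is glued, and put \<open>\<rho>(x) = \<Lambda> exp (- \<Sum> c_j x_j)\<close>. Because
  \<open>F_j / f\<close> jumps by \<open>c_j\<close> across the gluing, a function with numerator \<open>h\<close> of bidegree \<open>(k, k)\<close>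
  belongs to the module iff \<open>h(p1, t) = \<rho>(x) A^k h(p2, T t)\<close> for every \<open>x\<close> near \<open>x0\<close>. For \<open>k = 1\<close> the
  solutions are the combinations of the \<open>n\<close> forms \<open>\<phi>_i = \<rho> A s1 (T t)_i + s2 t_i\<close>. The functions
  \<open>psi_i\<close> with these numerators are sums of two exponentials in \<open>x\<close>, so all their derivatives are
  explicit; \<open>basis_numerator\<close> is the numerator of such a derivative. They form the required basis, for
  reasons that are visible at each single \<open>x\<close> with \<open>\<rho>(x) \<noteq> 1\<close>.

  Independence (\<open>basis_numerators_independent\<close>). On the divisor \<open>f = 0\<close> only the terms of top order of a
  relation survive, and they read \<open>\<Sum>_i P_i(F_1, \<dots>, F_n) \<phi>_i = 0\<close> with homogeneous polynomials
  \<open>P_i\<close>. Fix a direction \<open>\<xi>\<close>. The points of the divisor at which \<open>(F_1, \<dots>, F_n)\<close> is proportional to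
  \<open>\<xi>\<close> are the degenerate points of a linear pencil of matrices in \<open>z\<close>, together with their kernels. By
  general position the pencil has \<open>n\<close> distinct degenerate points when \<open>\<xi>\<close> is a coordinate vector, and
  this persists for all \<open>\<xi>\<close> nearby. There is no base point (here the distinct eigenvalues of \<open>T\<close> enter),
  so \<open>\<Sum>_i P_i(\<xi>) \<phi>_i\<close> vanishes at the \<open>n\<close> points. A bilinear form with that property is a combination
  of \<open>f\<close> and the \<open>F_j\<close> with coefficient vector orthogonal to \<open>\<xi>\<close>; but for a suitable coordinate vector
  and \<open>\<rho> \<noteq> 1\<close> no nonzero combination of this kind is glued in the way the \<open>\<phi>_i\<close> are. Hence \<open>P_i\<close>
  vanishes on an open set, so it is zero; the rest of the relation is divisible by \<open>f\<close>, and induction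
  on the order finishes the argument.

  Generation (\<open>glued_numerator_expansion\<close>). The numerators of bidegree \<open>(k, k)\<close> that are glued at \<open>x\<close>
  span a space of dimension at most \<open>k\<close> times the number of monomials of degree \<open>k\<close> in \<open>n\<close> variables.
  This is at most \<open>n\<close> times the number of derivatives of order below \<open>k\<close>, so the independent numerators of
  the derivatives of the \<open>psi_i\<close> span everything. The coefficients are analytic in \<open>x\<close> by Gaussian
  elimination (\<open>analytic_coefficients\<close>), with evaluation at points \<open>P\<close> in the role of coordinates.

  To pass from numerators to operators one needs that partial derivatives of complex differentiable
  functions of several variables are again complex differentiable and commute; both follow from
  Cauchy's formula by differentiating under the integral sign. Hence every element of \<open>D_n\<close> is a sum of
  terms \<open>a \<partial>_w\<close> over words \<open>w\<close> (\<open>diff_ops_word_form\<close>), and it is zero as soon as for every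
  multi-index the coefficients of the words with that content add up to zero.
\<close>

section \<open>Complex differentiable functions of several variables\<close>

text \<open>Complex differentiability with a complex linear total derivative, at every point of a set; on an
  open set this is analyticity.\<close>

definition cdiff_on :: "(complex^'n) set \<Rightarrow> (complex^'n \<Rightarrow> complex) \<Rightarrow> bool" where
  "cdiff_on U g \<longleftrightarrow>
     (\<forall>x\<in>U. \<exists>D. (g has_derivative D) (at x) \<and> (\<forall>c v. D (c *s v) = c * D v))"

lemma analytic_germs_iff: "g \<in> analytic_germs x0 \<longleftrightarrow> (\<exists>U. open U \<and> x0 \<in> U \<and> cdiff_on U g)"
  by (simp add: analytic_germs_def cdiff_on_def)

lemma cdiff_on_subset: "cdiff_on U g \<Longrightarrow> V \<subseteq> U \<Longrightarrow> cdiff_on V g"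
  unfolding cdiff_on_def by blast

lemma cdiff_onE:
  assumes "cdiff_on U g" "x \<in> U"
  obtains D where "(g has_derivative D) (at x)" "\<And>c v. D (c *s v) = c * D v"
  using assms unfolding cdiff_on_def by blast

lemma cdiff_on_cong:
  assumes "open U" "\<And>x. x \<in> U \<Longrightarrow> g x = h x" "cdiff_on U g"
  shows "cdiff_on U h"
  unfolding cdiff_on_def
proof
  fix x assume x: "x \<in> U"
  then obtain D where D: "(g has_derivative D) (at x)" "\<And>c v. D (c *s v) = c * D v"
    using assms(3) cdiff_onE by blast
  have "(h has_derivative D) (at x)"
    using has_derivative_transform_within_open[OF D(1) assms(1) x] assms(2) by simp
  then show "\<exists>D. (h has_derivative D) (at x) \<and> (\<forall>c v. D (c *s v) = c * D v)"
    using D(2) by blast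
qed

lemma cdiff_on_continuous: "cdiff_on U g \<Longrightarrow> continuous_on U g"
  unfolding cdiff_on_def
  by (meson continuous_at_imp_continuous_on has_derivative_continuous)

lemma cdiff_on_const [simp]: "cdiff_on U (\<lambda>x. c)"
  unfolding cdiff_on_def by (auto intro!: exI[of _ "\<lambda>v. 0"])

lemma cdiff_on_add:
  assumes "cdiff_on U g" "cdiff_on U h"
  shows "cdiff_on U (\<lambda>x. g x + h x)"
  unfolding cdiff_on_def
proof
  fix x assume x: "x \<in> U"
  obtain D where D: "(g has_derivative D) (at x)" "\<And>c v. D (c *s v) = c * D v"
    using cdiff_onE[OF assms(1) x] by blast
  obtain D' where D': "(h has_derivative D') (at x)" "\<And>c v. D' (c *s v) = c * D' v"
    using cdiff_onE[OF assms(2) x] by blast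
  show "\<exists>D. ((\<lambda>x. g x + h x) has_derivative D) (at x) \<and> (\<forall>c v. D (c *s v) = c * D v)"
    using has_derivative_add[OF D(1) D'(1)] D(2) D'(2)
    by (intro exI[of _ "\<lambda>v. D v + D' v"]) (simp add: algebra_simps)
qed

lemma cdiff_on_mult:
  assumes "cdiff_on U g" "cdiff_on U h"
  shows "cdiff_on U (\<lambda>x. g x * h x)"
  unfolding cdiff_on_def
proof
  fix x assume x: "x \<in> U"
  obtain D where D: "(g has_derivative D) (at x)" "\<And>c v. D (c *s v) = c * D v"
    using cdiff_onE[OF assms(1) x] by blast
  obtain D' where D': "(h has_derivative D') (at x)" "\<And>c v. D' (c *s v) = c * D' v"
    using cdiff_onE[OF assms(2) x] by blast
  show "\<exists>D. ((\<lambda>x. g x * h x) has_derivative D) (at x) \<and> (\<forall>c v. D (c *s v) = c * D v)"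
    using has_derivative_mult[OF D(1) D'(1)] D(2) D'(2)
    by (intro exI[of _ "\<lambda>v. g x * D' v + D v * h x"]) (simp add: algebra_simps)
qed

lemma cdiff_on_compose:
  assumes "cdiff_on U g" and "\<And>x. x \<in> U \<Longrightarrow> (\<phi> has_field_derivative \<phi>' x) (at (g x))"
  shows "cdiff_on U (\<lambda>x. \<phi> (g x))"
  unfolding cdiff_on_def
proof
  fix x assume x: "x \<in> U"
  obtain D where D: "(g has_derivative D) (at x)" "\<And>c v. D (c *s v) = c * D v"
    using cdiff_onE[OF assms(1) x] by blast
  have "((\<lambda>x. \<phi> (g x)) has_derivative (\<lambda>v. \<phi>' x * D v)) (at x)"
    using has_derivative_compose[OF D(1)] assms(2)[OF x] unfolding has_field_derivative_def by blast
  then show "\<exists>D. ((\<lambda>x. \<phi> (g x)) has_derivative D) (at x) \<and> (\<forall>c v. D (c *s v) = c * D v)"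
    using D(2) by (intro exI[of _ "\<lambda>v. \<phi>' x * D v"]) (simp add: algebra_simps)
qed

lemma cdiff_on_exp: "cdiff_on U g \<Longrightarrow> cdiff_on U (\<lambda>x. exp (g x))"
  by (rule cdiff_on_compose[where \<phi>' = "\<lambda>x. exp (g x)"]) (auto intro: derivative_eq_intros)

lemma cdiff_on_inverse:
  "cdiff_on U g \<Longrightarrow> (\<And>x. x \<in> U \<Longrightarrow> g x \<noteq> 0) \<Longrightarrow> cdiff_on U (\<lambda>x. inverse (g x))"
  by (rule cdiff_on_compose[where \<phi>' = "\<lambda>x. - (inverse (g x) ^ 2)"])
     (auto intro!: derivative_eq_intros simp: power2_eq_square)

lemma cdiff_on_nth: "cdiff_on U (\<lambda>x. x $ i)"
  unfolding cdiff_on_def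
  by (auto intro!: exI[of _ "\<lambda>v. v $ i"] bounded_linear_imp_has_derivative bounded_linear_vec_nth)

lemma cdiff_on_sum: "(\<And>i. i \<in> S \<Longrightarrow> cdiff_on U (g i)) \<Longrightarrow> cdiff_on U (\<lambda>x. \<Sum>i\<in>S. g i x)"
  by (induction S rule: infinite_finite_induct) (auto intro!: cdiff_on_add)

lemma cdiff_on_linear: "cdiff_on U (\<lambda>x. \<Sum>i\<in>UNIV. c i * x $ i)"
  by (intro cdiff_on_sum cdiff_on_mult cdiff_on_nth cdiff_on_const)

lemma bounded_linear_axis: "bounded_linear (axis j :: complex \<Rightarrow> complex^'n)"
  unfolding linear_conv_bounded_linear[symmetric]
  by (rule linearI) (auto simp: vec_eq_iff axis_def)

lemma axis_eq_smult: "axis j s = s *s (axis j 1 :: complex^'n)"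
  by (auto simp: vec_eq_iff axis_def)

lemma norm_axis_complex [simp]: "norm (axis j (s::complex) :: complex^'n) = norm s"
proof -
  have "norm (axis j s :: complex^'n) = sqrt (\<Sum>i\<in>UNIV. if i = j then (norm s)\<^sup>2 else 0)"
    unfolding norm_vec_def L2_set_def by (intro arg_cong[of _ _ sqrt] sum.cong) (auto simp: axis_def)
  then show ?thesis by simp
qed

lemma axis_zero [simp]: "axis j 0 = (0 :: complex^'n)"
  by (simp add: axis_def vec_eq_iff)

lemma has_field_derivative_along_axis:
  fixes g :: "complex^'n \<Rightarrow> complex"
  assumes "(g has_derivative D) (at (x + axis j s))" "\<And>c v. D (c *s v) = c * D v"
  shows "((\<lambda>s. g (x + axis j s)) has_field_derivative D (axis j 1)) (at s)"
proof -
  have 1: "((\<lambda>s. x + axis j s) has_derivative axis j) (at s)"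
    using has_derivative_add_const[OF bounded_linear_imp_has_derivative[OF bounded_linear_axis], of j x]
    by (simp only: add.commute[of x])
  have "((\<lambda>s. g (x + axis j s)) has_derivative (\<lambda>v. D (axis j v))) (at s)"
    using has_derivative_compose[OF 1 assms(1)] .
  moreover have "D (axis j v) = D (axis j 1) * v" for v
    using assms(2)[of v "axis j 1"] by (simp only: axis_eq_smult[of j v] mult.commute)
  then have "(\<lambda>v. D (axis j v)) = (*) (D (axis j 1))" by (rule ext)
  ultimately show ?thesis unfolding has_field_derivative_def by (simp only:)
qed

lemma partial_deriv_eq:
  assumes "(g has_derivative D) (at x)" "\<And>c v. D (c *s v) = c * D v"
  shows "partial_deriv j g x = D (axis j 1)"
  unfolding partial_deriv_def
  by (rule DERIV_imp_deriv, rule has_field_derivative_along_axis)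
     (simp_all only: axis_zero add_0_right assms)

lemma cdiff_on_has_partial_deriv:
  assumes "cdiff_on U g" "x \<in> U"
  shows "((\<lambda>s. g (x + axis j s)) has_field_derivative partial_deriv j g x) (at 0)"
proof -
  obtain D where D: "(g has_derivative D) (at x)" "\<And>c v. D (c *s v) = c * D v"
    using assms cdiff_onE by blast
  show ?thesis
    unfolding partial_deriv_eq[OF D]
    by (rule has_field_derivative_along_axis) (simp_all only: axis_zero add_0_right D)
qed

lemma cdiff_on_has_derivative:
  assumes "cdiff_on U g" "x \<in> U"
  shows "(g has_derivative (\<lambda>v. \<Sum>i\<in>UNIV. v $ i * partial_deriv i g x)) (at x)"
proof -
  obtain D where D: "(g has_derivative D) (at x)" "\<And>c v. D (c *s v) = c * D v"
    using assms cdiff_onE by blast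
  have "D v = (\<Sum>i\<in>UNIV. v $ i * partial_deriv i g x)" for v
  proof -
    have "D v = D (\<Sum>i\<in>UNIV. v $ i *s axis i 1)" by (simp add: basis_expansion)
    also have "\<dots> = (\<Sum>i\<in>UNIV. D (v $ i *s axis i 1))"
      by (rule linear_sum) (use D(1) has_derivative_linear in blast)
    also have "\<dots> = (\<Sum>i\<in>UNIV. v $ i * partial_deriv i g x)"
      by (simp add: D(2) partial_deriv_eq[OF D])
    finally show ?thesis .
  qed
  then have "D = (\<lambda>v. \<Sum>i\<in>UNIV. v $ i * partial_deriv i g x)" by blast
  with D(1) show ?thesis by simp
qed

lemma partial_deriv_cong:
  assumes "open U" "x \<in> U" "\<And>y. y \<in> U \<Longrightarrow> g y = h y"
  shows "partial_deriv j g x = partial_deriv j h x"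
  unfolding partial_deriv_def
proof (rule deriv_cong_ev)
  have "((\<lambda>s. x + axis j s) \<longlongrightarrow> x + axis j 0) (nhds 0)"
    by (rule tendsto_add[OF tendsto_const bounded_linear.tendsto[OF bounded_linear_axis filterlim_ident]])
  then have "\<forall>\<^sub>F s in nhds 0. x + axis j s \<in> U"
    using assms(1,2) by (intro topological_tendstoD) auto
  then show "\<forall>\<^sub>F s in nhds 0. g (x + axis j s) = h (x + axis j s)"
    by eventually_elim (rule assms(3))
qed simp

definition circle_pt :: "real \<Rightarrow> real \<Rightarrow> complex" where
  "circle_pt r t = of_real r * exp (2 * of_real pi * \<i> * of_real t)"

lemma norm_circle_pt [simp]: "norm (circle_pt r t) = \<bar>r\<bar>"
proof -
  have "norm (exp (2 * of_real pi * \<i> * of_real t)) = 1"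
    using norm_exp_i_times[of "2 * pi * t"] by (simp add: mult_ac)
  then show ?thesis by (simp add: circle_pt_def norm_mult)
qed

lemma continuous_on_circle_pt: "continuous_on S (circle_pt r)"
  unfolding circle_pt_def by (intro continuous_intros)

text \<open>Cauchy's formula for the first derivative along the \<open>j\<close>-th axis. Over a circle it
  becomes an integral over a fixed interval of a function that involves \<open>g\<close> only,
  hence it can be differentiated in \<open>x\<close>.\<close>

lemma partial_deriv_integral:
  assumes g: "cdiff_on U g" and r: "0 < r" and sub: "\<And>s. norm s \<le> r \<Longrightarrow> x + axis j s \<in> U"
  shows "partial_deriv j g x = integral (cbox 0 1) (\<lambda>t. g (x + axis j (circle_pt r t)) / circle_pt r t)"
proof -
  let ?G = "\<lambda>s. g (x + axis j s)"
  have der: "\<exists>D. (?G has_field_derivative D) (at s)" if s: "norm s \<le> r" for s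
  proof -
    obtain D where "(g has_derivative D) (at (x + axis j s))" "\<And>c v. D (c *s v) = c * D v"
      using cdiff_onE[OF g sub[OF s]] by blast
    then show ?thesis using has_field_derivative_along_axis by blast
  qed
  have hol: "?G holomorphic_on ball 0 r"
    unfolding holomorphic_on_def field_differentiable_def
    using der by (meson DERIV_subset has_field_derivative_at_within less_imp_le mem_ball_0)
  have cont: "continuous_on (cball 0 r) ?G"
    by (intro continuous_at_imp_continuous_on ballI) (use der DERIV_isCont in fastforce)
  have "((\<lambda>u. ?G u / (u - 0) ^ Suc 1) has_contour_integral (2 * pi * \<i>) / (fact 1) * (deriv ^^ 1) ?G 0) (circlepath 0 r)"
    by (rule Cauchy_has_contour_integral_higher_derivative_circlepath[OF cont hol]) (use r in simp)
  then have 1: "((\<lambda>u. ?G u / u ^ 2) has_contour_integral (2 * pi * \<i>) * partial_deriv j g x) (circlepath 0 r)"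
    by (simp add: partial_deriv_def power2_eq_square)
  have path: "circlepath 0 r t = circle_pt r t" for t
    by (simp add: circlepath circle_pt_def mult_ac)
  have vd: "vector_derivative (circlepath 0 r) (at t) = 2 * pi * \<i> * circle_pt r t" for t
    by (simp add: vector_derivative_circlepath circle_pt_def mult_ac)
  have "((\<lambda>t. ?G (circle_pt r t) / (circle_pt r t)^2 * (2 * pi * \<i> * circle_pt r t))
          has_integral (2 * pi * \<i>) * partial_deriv j g x) {0..1}"
    using 1 unfolding has_contour_integral
    by (rule has_integral_eq[rotated])
       (simp only: path vd)
  then have "((\<lambda>t. 2 * pi * \<i> * (?G (circle_pt r t) / circle_pt r t))
          has_integral (2 * pi * \<i>) * partial_deriv j g x) {0..1}"
    by (rule has_integral_eq[rotated]) (use r in \<open>auto simp: power2_eq_square circle_pt_def\<close>)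
  then have "((\<lambda>t. (1/(2 * pi * \<i>)) * (2 * pi * \<i> * (?G (circle_pt r t) / circle_pt r t)))
          has_integral (1/(2 * pi * \<i>)) * ((2 * pi * \<i>) * partial_deriv j g x)) {0..1}"
    by (rule has_integral_mult_right)
  then have "((\<lambda>t. ?G (circle_pt r t) / circle_pt r t) has_integral partial_deriv j g x) {0..1}"
    by (simp add: field_simps)
  then show ?thesis by (simp add: integral_unique)
qed

lemma cdiff_on_partial_aux:
  assumes g: "cdiff_on U g" and U: "open U" and x: "x \<in> U"
  obtains r where "0 < r" "\<And>y s. y \<in> ball x r \<Longrightarrow> norm s \<le> r \<Longrightarrow> y + axis j s \<in> U"
proof -
  obtain e where e: "e > 0" "ball x e \<subseteq> U" using U x open_contains_ball by blast
  show thesis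
  proof (rule that[of "e/2"])
    fix y and s :: complex assume "y \<in> ball x (e/2)" "norm s \<le> e/2"
    then have "dist x (y + axis j s) < e"
      by (smt (verit) dist_norm dist_triangle field_sum_of_halves mem_ball norm_axis_complex add_diff_cancel_left' dist_commute)
    then show "y + axis j s \<in> U" using e by auto
  qed (use e in simp)
qed

lemma continuous_on_shift:
  assumes "continuous_on U h" "\<And>y s. y \<in> B \<Longrightarrow> norm s \<le> r \<Longrightarrow> y + axis j s \<in> U" "0 < r"
  shows "continuous_on (B \<times> cbox 0 1) (\<lambda>(y, t). h (y + axis j (circle_pt r t)) / circle_pt r t)"
proof -
  have nz: "circle_pt r t \<noteq> 0" for t using assms(3) by (simp add: circle_pt_def)
  have c: "continuous_on (B \<times> cbox 0 1) (\<lambda>p. circle_pt r (snd p))"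
    by (intro continuous_on_compose2[OF continuous_on_circle_pt[of UNIV]] continuous_intros) auto
  have "continuous_on (B \<times> cbox 0 1) (\<lambda>p. fst p + axis j (circle_pt r (snd p)))"
    by (intro continuous_intros bounded_linear.continuous_on[OF bounded_linear_axis] c)
  then have "continuous_on (B \<times> cbox 0 1) (\<lambda>p. h (fst p + axis j (circle_pt r (snd p))))"
    by (rule continuous_on_compose2[OF assms(1)]) (use assms(2,3) in auto)
  from continuous_on_divide[OF this c] nz show ?thesis by (simp add: case_prod_unfold)
qed

text \<open>Differentiation under the integral sign needs a continuous derivative; Cauchy's formula supplies
  this continuity from that of \<open>g\<close>.\<close>

lemma cdiff_on_partial_continuous:
  assumes g: "cdiff_on U g" and U: "open U"
  shows "continuous_on U (partial_deriv j g)"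
proof (rule continuous_at_imp_continuous_on, rule ballI)
  fix x assume x: "x \<in> U"
  obtain r where r: "0 < r" "\<And>y s. y \<in> ball x r \<Longrightarrow> norm s \<le> r \<Longrightarrow> y + axis j s \<in> U"
    using cdiff_on_partial_aux[OF g U x] by metis
  have 0: "continuous_on (ball x r \<times> cbox 0 1) (\<lambda>(y, t). g (y + axis j (circle_pt r t)) / circle_pt r t)"
    by (rule continuous_on_shift[OF cdiff_on_continuous[OF g] r(2) r(1)])
  have "continuous_on (ball x r) (\<lambda>y. integral (cbox 0 1) (\<lambda>t. g (y + axis j (circle_pt r t)) / circle_pt r t))"
    by (rule integral_continuous_on_param[OF 0])
  then have "continuous_on (ball x r) (partial_deriv j g)"
    by (rule continuous_on_eq) (use partial_deriv_integral[OF g r(1)] r(2) in auto)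
  then show "isCont (partial_deriv j g) x"
    using r(1) by (simp add: continuous_on_eq_continuous_at)
qed

text \<open>The Leibniz rule applied to Cauchy's formula. The coefficient of \<open>v $ i\<close> is
  Cauchy's formula for the derivative of the \<open>i\<close>-th partial derivative along the axis
  \<open>j\<close>, which is why partial derivatives commute.\<close>

lemma cdiff_on_partial_derivative_formula:
  fixes g :: "complex^'n \<Rightarrow> complex"
  assumes g: "cdiff_on U g" and U: "open U"
     and r: "0 < r" "\<And>y s. y \<in> ball x r \<Longrightarrow> norm s \<le> r \<Longrightarrow> y + axis j s \<in> U"
  shows "(partial_deriv j g has_derivative
           (\<lambda>v. \<Sum>i\<in>UNIV. v $ i * integral (cbox 0 1) (\<lambda>t. partial_deriv i g (x + axis j (circle_pt r t)) / circle_pt r t))) (at x)"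
proof -
  let ?B = "ball x r"
  define k where "k i y t = partial_deriv i g (y + axis j (circle_pt r t)) / circle_pt r t" for i y t
  define fx where "fx y t = (\<Sum>i\<in>UNIV. blinfun_mult_right (k i y t) o\<^sub>L Blinfun (\<lambda>v::complex^'n. v $ i))" for y t
  have app: "blinfun_apply (fx y t) v = (\<Sum>i\<in>UNIV. v $ i * k i y t)" for y t v
    unfolding fx_def
    by (simp add: blinfun.sum_left bounded_linear_Blinfun_apply bounded_linear_vec_nth mult.commute)
  have circle_pt_nz: "circle_pt r t \<noteq> 0" for t using r(1) by (simp add: circle_pt_def)
  have contk: "continuous_on (?B \<times> cbox 0 1) (\<lambda>(y, t). k i y t)" for i
    unfolding k_def by (rule continuous_on_shift[OF cdiff_on_partial_continuous[OF g U, of i] r(2) r(1)])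
  have contg: "continuous_on (?B \<times> cbox 0 1) (\<lambda>(y, t). g (y + axis j (circle_pt r t)) / circle_pt r t)"
    by (rule continuous_on_shift[OF cdiff_on_continuous[OF g] r(2) r(1)])
  have cont_fx: "continuous_on (?B \<times> cbox 0 1) (\<lambda>(y, t). fx y t)"
    unfolding fx_def case_prod_unfold
    using contk unfolding case_prod_unfold
    by (intro continuous_intros bounded_linear.continuous_on[OF bounded_linear_blinfun_mult_right]) auto
  have slice: "continuous_on (cbox 0 1) (\<lambda>t. h y t)"
    if "continuous_on (?B \<times> cbox (0::real) 1) (\<lambda>(y, t). h y t)" "y \<in> ?B" for h :: "complex^'n \<Rightarrow> real \<Rightarrow> 'z::topological_space" and y
  proof -
    have "continuous_on (cbox (0::real) 1) (\<lambda>t. (y, t))" by (intro continuous_intros)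
    moreover have "(\<lambda>t. (y, t)) ` cbox 0 1 \<subseteq> ?B \<times> cbox (0::real) 1" using that(2) by auto
    ultimately have "continuous_on (cbox 0 1) (\<lambda>t. case (y, t) of (y, t) \<Rightarrow> h y t)"
      by (rule continuous_on_compose2[OF that(1)])
    then show ?thesis by (simp only: prod.case)
  qed
  have "((\<lambda>y. integral (cbox 0 1) (\<lambda>t. g (y + axis j (circle_pt r t)) / circle_pt r t)) has_derivative
           integral (cbox 0 1) (fx x)) (at x within ?B)"
  proof (rule leibniz_rule[OF _ _ cont_fx])
    fix y t assume y: "y \<in> ?B" and t: "t \<in> cbox (0::real) 1"
    have "y + axis j (circle_pt r t) \<in> U" using r y by auto
    from cdiff_on_has_derivative[OF g this]
    have der: "((\<lambda>y. g (y + axis j (circle_pt r t))) has_derivative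
            (\<lambda>v. \<Sum>i\<in>UNIV. v $ i * partial_deriv i g (y + axis j (circle_pt r t)))) (at y)"
      by (rule has_derivative_compose[of "\<lambda>y. y + axis j (circle_pt r t)" "\<lambda>v. v" y UNIV g, rotated])
         (rule has_derivative_add_const has_derivative_ident)+
    have e: "blinfun_apply (fx y t) =
        (\<lambda>v. (\<Sum>i\<in>UNIV. v $ i * partial_deriv i g (y + axis j (circle_pt r t))) * inverse (circle_pt r t))"
      by (rule ext) (simp add: app k_def sum_distrib_right divide_inverse mult.assoc)
    from has_derivative_mult_left[OF der, of "inverse (circle_pt r t)"]
    have "((\<lambda>y. g (y + axis j (circle_pt r t)) / circle_pt r t) has_derivative blinfun_apply (fx y t)) (at y)"
      by (simp only: e divide_inverse)
    then show "((\<lambda>y. g (y + axis j (circle_pt r t)) / circle_pt r t) has_derivative blinfun_apply (fx y t)) (at y within ?B)"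
      by (rule has_derivative_at_withinI)
  next
    fix y assume "y \<in> ?B"
    then show "(\<lambda>t. g (y + axis j (circle_pt r t)) / circle_pt r t) integrable_on cbox 0 1"
      by (intro integrable_continuous slice[OF contg])
  qed (use r in auto)
  then have 1: "((\<lambda>y. integral (cbox 0 1) (\<lambda>t. g (y + axis j (circle_pt r t)) / circle_pt r t)) has_derivative
           integral (cbox 0 1) (fx x)) (at x)"
    using r(1) by (simp add: at_within_open[of x ?B])
  have xB: "x \<in> ?B" using r by simp
  have eq: "blinfun_apply (integral (cbox 0 1) (fx x)) v = (\<Sum>i\<in>UNIV. v $ i * integral (cbox 0 1) (k i x))" for v
  proof -
    have "blinfun_apply (integral (cbox 0 1) (fx x)) v = integral (cbox 0 1) (\<lambda>t. blinfun_apply (fx x t) v)"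
      by (rule blinfun_apply_integral) (intro integrable_continuous slice[OF cont_fx xB])
    also have "\<dots> = (\<Sum>i\<in>UNIV. integral (cbox 0 1) (\<lambda>t. v $ i * k i x t))"
      unfolding app
      by (intro integral_sum integrable_continuous continuous_intros slice[OF contk xB]) auto
    finally show ?thesis by simp
  qed
  have "((\<lambda>y. integral (cbox 0 1) (\<lambda>t. g (y + axis j (circle_pt r t)) / circle_pt r t)) has_derivative
           (\<lambda>v. \<Sum>i\<in>UNIV. v $ i * integral (cbox 0 1) (k i x))) (at x)"
    using 1 by (simp only: ext[of "blinfun_apply (integral (cbox 0 1) (fx x))", OF eq])
  then have "(partial_deriv j g has_derivative
           (\<lambda>v. \<Sum>i\<in>UNIV. v $ i * integral (cbox 0 1) (k i x))) (at x)"
    by (rule has_derivative_transform_within_open[OF _ open_ball xB])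
       (use partial_deriv_integral[OF g r(1)] r(2) in auto)
  then show ?thesis unfolding k_def[abs_def] .
qed

lemma cdiff_on_partial:
  assumes g: "cdiff_on U g" and U: "open U"
  shows "cdiff_on U (partial_deriv j g)"
  unfolding cdiff_on_def
proof
  fix x assume x: "x \<in> U"
  obtain r where r: "0 < r" "\<And>y s. y \<in> ball x r \<Longrightarrow> norm s \<le> r \<Longrightarrow> y + axis j s \<in> U"
    using cdiff_on_partial_aux[OF g U x] by metis
  show "\<exists>D. (partial_deriv j g has_derivative D) (at x) \<and> (\<forall>c v. D (c *s v) = c * D v)"
    by (rule exI, rule conjI, rule cdiff_on_partial_derivative_formula[OF g U r])
       (simp_all add: sum_distrib_left mult.assoc)
qed

lemma partial_deriv_commute:
  assumes g: "cdiff_on U g" and U: "open U" and x: "x \<in> U"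
  shows "partial_deriv i (partial_deriv j g) x = partial_deriv j (partial_deriv i g) x"
proof -
  obtain r where r: "0 < r" "\<And>y s. y \<in> ball x r \<Longrightarrow> norm s \<le> r \<Longrightarrow> y + axis j s \<in> U"
    using cdiff_on_partial_aux[OF g U x] by metis
  have "partial_deriv i (partial_deriv j g) x =
      (\<Sum>l\<in>UNIV. (axis i 1 :: complex^'a) $ l * integral (cbox 0 1) (\<lambda>t. partial_deriv l g (x + axis j (circle_pt r t)) / circle_pt r t))"
    by (rule partial_deriv_eq[OF cdiff_on_partial_derivative_formula[OF g U r]])
       (simp_all add: sum_distrib_left mult.assoc)
  also have "\<dots> = integral (cbox 0 1) (\<lambda>t. partial_deriv i g (x + axis j (circle_pt r t)) / circle_pt r t)"
    by (simp add: axis_def if_distrib[of "\<lambda>a. a * _"] cong: if_cong)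
  also have "\<dots> = partial_deriv j (partial_deriv i g) x"
    by (rule partial_deriv_integral[symmetric, OF cdiff_on_partial[OF g U] r(1)]) (use r in auto)
  finally show ?thesis .
qed

section \<open>Monomials and multi-indices\<close>

abbreviation mdeg :: "('n::finite \<Rightarrow> nat) \<Rightarrow> nat" where
  "mdeg \<gamma> \<equiv> \<Sum>j\<in>UNIV. \<gamma> j"

definition monomial :: "('n::finite \<Rightarrow> 'a::comm_monoid_mult) \<Rightarrow> ('n \<Rightarrow> nat) \<Rightarrow> 'a" where
  "monomial \<kappa> \<alpha> = (\<Prod>j\<in>UNIV. \<kappa> j ^ \<alpha> j)"

lemma monomial_scale:
  fixes r :: "'a::comm_semiring_1"
  shows "monomial (\<lambda>j. r * \<kappa> j) \<alpha> = r ^ mdeg \<alpha> * monomial \<kappa> \<alpha>"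
  by (simp add: monomial_def power_mult_distrib prod.distrib power_sum)

lemma monomial_rescale_coordinate:
  fixes \<xi> :: "'n::finite \<Rightarrow> 'a::comm_semiring_1"
  shows "monomial (\<lambda>l. if l = j then r * \<xi> l else \<xi> l) \<alpha> = r ^ \<alpha> j * monomial \<xi> \<alpha>"
proof -
  have "(\<Prod>l\<in>UNIV. (if l = j then r * \<xi> l else \<xi> l) ^ \<alpha> l)
      = (\<Prod>l\<in>UNIV. (if l = j then r ^ \<alpha> j else 1) * \<xi> l ^ \<alpha> l)"
    by (intro prod.cong) (auto simp: power_mult_distrib)
  then show ?thesis by (simp add: monomial_def prod.distrib)
qed

text \<open>Monomials are distinct characters of the torus, and the proof is that of Dedekind's independence
  theorem: rescaling one variable separates two exponents.\<close>

lemma monomials_independent: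
  fixes a :: "('n::finite \<Rightarrow> nat) \<Rightarrow> complex"
  assumes "finite S" "\<And>\<xi>. (\<Sum>\<alpha>\<in>S. a \<alpha> * monomial \<xi> \<alpha>) = 0" "\<alpha> \<in> S"
  shows "a \<alpha> = 0"
  using assms
proof (induction S arbitrary: a \<alpha> rule: finite_induct)
  case (insert \<beta> S)
  \<comment> \<open>Doubling the \<open>j\<close>-th variable and subtracting \<open>2 ^ \<beta> j\<close> times the relation removes \<open>\<beta>\<close>
    and keeps \<open>\<gamma>\<close>, since their \<open>j\<close>-th entries differ.\<close>
  have S: "a \<gamma> = 0" if g: "\<gamma> \<in> S" for \<gamma>
  proof -
    have "\<beta> \<noteq> \<gamma>" using g insert.hyps by blast
    then obtain j where j: "\<beta> j \<noteq> \<gamma> j" by blast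
    have "(\<Sum>\<delta>\<in>S. (a \<delta> * (2 ^ \<delta> j - 2 ^ \<beta> j)) * monomial \<xi> \<delta>) = 0" for \<xi>
    proof -
      let ?\<xi>' = "\<lambda>l. if l = j then 2 * \<xi> l else \<xi> l"
      have 1: "(\<Sum>\<delta>\<in>insert \<beta> S. a \<delta> * monomial ?\<xi>' \<delta>) = 0"
        and 2: "(\<Sum>\<delta>\<in>insert \<beta> S. a \<delta> * monomial \<xi> \<delta>) = 0" using insert.prems(1) by blast+
      have "(\<Sum>\<delta>\<in>insert \<beta> S. (a \<delta> * (2 ^ \<delta> j - 2 ^ \<beta> j)) * monomial \<xi> \<delta>) =
          (\<Sum>\<delta>\<in>insert \<beta> S. a \<delta> * monomial ?\<xi>' \<delta>)
          - 2 ^ \<beta> j * (\<Sum>\<delta>\<in>insert \<beta> S. a \<delta> * monomial \<xi> \<delta>)"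
        unfolding sum_distrib_left sum_subtractf[symmetric] monomial_rescale_coordinate
        by (intro sum.cong) (simp_all add: algebra_simps)
      with 1 2 insert.hyps show ?thesis by simp
    qed
    from insert.IH[OF this g] have "a \<gamma> * (2 ^ \<gamma> j - 2 ^ \<beta> j) = 0" .
    moreover have "(2::complex) ^ \<gamma> j \<noteq> 2 ^ \<beta> j"
    proof
      assume "(2::complex) ^ \<gamma> j = 2 ^ \<beta> j"
      then have "of_nat (2 ^ \<gamma> j) = (of_nat (2 ^ \<beta> j) :: complex)" by simp
      then have "(2::nat) ^ \<gamma> j = 2 ^ \<beta> j" by (rule of_nat_eq_iff[THEN iffD1])
      with j show False by simp
    qed
    ultimately show ?thesis by simp
  qed
  then have "a \<beta> * monomial (\<lambda>_. 1) \<beta> = 0"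
    using insert.prems(1)[of "\<lambda>_. 1"] insert.hyps by simp
  then have "a \<beta> = 0" by (simp add: monomial_def)
  with S insert.prems(2) show ?case by blast
qed simp

lemma polynomial_on_line:
  fixes x \<eta> :: "'n::finite \<Rightarrow> complex"
  shows "\<exists>p. \<forall>s. poly p s = (\<Sum>\<alpha>\<in>S. a \<alpha> * monomial (\<lambda>j. x j + s * \<eta> j) \<alpha>)"
  by (rule exI[of _ "\<Sum>\<alpha>\<in>S. smult (a \<alpha>) (\<Prod>j\<in>UNIV. [:x j, \<eta> j:] ^ \<alpha> j)"])
     (simp add: poly_sum poly_prod monomial_def)

text \<open>Restricted to a line through the given point, the polynomial has infinitely many zeros.\<close>

lemma polynomial_zero_if_zero_near:
  fixes a :: "('n::finite \<Rightarrow> nat) \<Rightarrow> complex"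
  assumes "finite S"
    and "\<And>\<eta>. \<forall>\<^sub>F s in at 0. (\<Sum>\<alpha>\<in>S. a \<alpha> * monomial (\<lambda>j. x j + s * \<eta> j) \<alpha>) = 0"
    and "\<alpha> \<in> S"
  shows "a \<alpha> = 0"
proof (rule monomials_independent[OF assms(1) _ assms(3)])
  fix \<xi> :: "'n \<Rightarrow> complex"
  obtain p where p: "\<And>s. poly p s = (\<Sum>\<alpha>\<in>S. a \<alpha> * monomial (\<lambda>j. x j + s * (\<xi> j - x j)) \<alpha>)"
    using polynomial_on_line[where a = a and S = S and x = x and \<eta> = "\<lambda>j. \<xi> j - x j"] by blast
  have ev: "\<forall>\<^sub>F s in at 0. poly p s = 0" unfolding p by (rule assms(2))
  have "p = 0"
  proof (rule ccontr)
    assume "p \<noteq> 0"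
    then have "finite {s. poly p s = 0}" by (rule poly_roots_finite)
    then have "\<forall>\<^sub>F s in at 0. s \<notin> {s. poly p s = 0}"
      using islimpt_finite islimpt_iff_eventually by blast
    with ev have "\<forall>\<^sub>F s in at (0::complex). False" by eventually_elim simp
    then show False by simp
  qed
  then have "poly p 1 = 0" by simp
  then show "(\<Sum>\<alpha>\<in>S. a \<alpha> * monomial \<xi> \<alpha>) = 0" by (simp add: p)
qed

lemma finite_multidegree_le: "finite {\<alpha> :: 'n::finite \<Rightarrow> nat. mdeg \<alpha> \<le> m}"
proof (rule finite_subset)
  show "{\<alpha> :: 'n \<Rightarrow> nat. mdeg \<alpha> \<le> m} \<subseteq> (\<Pi>\<^sub>E j\<in>UNIV. {..m})"
    by (auto simp: PiE_def extensional_def intro: order_trans[OF member_le_sum[of _ UNIV]])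
qed (intro finite_PiE; simp)

lemma finite_multidegree_eq: "finite {\<alpha> :: 'n::finite \<Rightarrow> nat. mdeg \<alpha> = m}"
  by (rule finite_subset[OF _ finite_multidegree_le[of m]]) auto

text \<open>The factor \<open>K\<close> is the sum of the entries of \<open>\<alpha>\<close>. A multi-index
  \<open>\<alpha>\<close> of order \<open>K\<close> together with a number \<open>r < \<alpha>
  i\<close> is recovered from \<open>i\<close> and the multi-index \<open>\<alpha>(i :=
  r)\<close>, whose order is below \<open>K\<close>.\<close>

lemma multidegree_count:
  "K * card {\<alpha> :: 'n::finite \<Rightarrow> nat. mdeg \<alpha> = K}
    \<le> CARD('n) * card {\<beta> :: 'n \<Rightarrow> nat. mdeg \<beta> < K}"
proof -
  let ?E = "{\<alpha> :: 'n \<Rightarrow> nat. mdeg \<alpha> = K}" and ?L = "{\<beta> :: 'n \<Rightarrow> nat. mdeg \<beta> < K}"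
  have fE: "finite ?E" by (rule finite_multidegree_eq)
  have fL: "finite ?L" by (rule finite_subset[OF _ finite_multidegree_le[of K]]) auto
  have one: "(\<Sum>\<alpha>\<in>?E. \<alpha> i) \<le> card ?L" for i
  proof -
    have split: "(\<Sum>j\<in>UNIV. (\<alpha>(i := r)) j) + \<alpha> i = mdeg \<alpha> + r" for \<alpha> :: "'n \<Rightarrow> nat" and r
      by (simp add: sum.remove[of UNIV i] )
    have "(\<Sum>\<alpha>\<in>?E. \<alpha> i) = card (SIGMA \<alpha>:?E. {..<\<alpha> i})"
      using fE by simp
    also have "\<dots> \<le> card ?L"
    proof (rule card_inj_on_le[OF _ _ fL])
      show "inj_on (\<lambda>(\<alpha>, r). \<alpha>(i := r)) (SIGMA \<alpha>:?E. {..<\<alpha> i})"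
      proof (rule inj_onI)
        fix p p' :: "('n \<Rightarrow> nat) \<times> nat"
        assume p: "p \<in> (SIGMA \<alpha>:?E. {..<\<alpha> i})" "p' \<in> (SIGMA \<alpha>:?E. {..<\<alpha> i})"
          "(\<lambda>(\<alpha>, r). \<alpha>(i := r)) p = (\<lambda>(\<alpha>, r). \<alpha>(i := r)) p'"
        obtain \<alpha> r \<alpha>' r' where pp: "p = (\<alpha>, r)" "p' = (\<alpha>', r')" by (cases p, cases p') blast
        have E: "mdeg \<alpha> = K" "mdeg \<alpha>' = K" and eq: "\<alpha>(i := r) = \<alpha>'(i := r')"
          using p pp by auto
        have r: "r = r'" using fun_cong[OF eq, of i] by simp
        have "\<alpha> i = \<alpha>' i" using split[of \<alpha> r] split[of \<alpha>' r'] E r unfolding eq by linarith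
        then have "\<alpha> j = \<alpha>' j" for j using fun_cong[OF eq, of j] by (cases "j = i") simp_all
        then have "\<alpha> = \<alpha>'" by (rule ext)
        then show "p = p'" using r pp by blast
      qed
      show "(\<lambda>(\<alpha>, r). \<alpha>(i := r)) ` (SIGMA \<alpha>:?E. {..<\<alpha> i}) \<subseteq> ?L"
      proof clarify
        fix \<alpha> :: "'n \<Rightarrow> nat" and r assume "r < \<alpha> i"
        with split[of \<alpha> r] show "(\<Sum>j\<in>UNIV. (\<alpha>(i := r)) j) < mdeg \<alpha>" by linarith
      qed
    qed
    finally show ?thesis .
  qed
  have "K * card ?E = (\<Sum>\<alpha>\<in>?E. \<Sum>i\<in>UNIV. \<alpha> i)" by simp
  also have "\<dots> = (\<Sum>i\<in>UNIV. \<Sum>\<alpha>\<in>?E. \<alpha> i)" by (rule sum.swap)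
  also have "\<dots> \<le> (\<Sum>i\<in>(UNIV::'n set). card ?L)" by (intro sum_mono one)
  finally show ?thesis by simp
qed

section \<open>Linear relations and matrix pencils\<close>

text \<open>More unknowns than equations: Gaussian elimination of one equation at a time.\<close>

lemma nontrivial_relation:
  fixes m :: "'i \<Rightarrow> 'j \<Rightarrow> 'a::field"
  assumes "finite J" "finite I" "card J < card I"
  shows "\<exists>a. (\<exists>i\<in>I. a i \<noteq> 0) \<and> (\<forall>j\<in>J. (\<Sum>i\<in>I. a i * m i j) = 0)"
  using assms
proof (induction J arbitrary: I m rule: finite_induct)
  case empty
  then have "I \<noteq> {}" by auto
  then show ?case by (intro exI[of _ "\<lambda>_. 1"]) auto
next
  case (insert j J)
  show ?case
  proof (cases "\<forall>i\<in>I. m i j = 0")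
    case True
    have "\<exists>a. (\<exists>i\<in>I. a i \<noteq> 0) \<and> (\<forall>l\<in>J. (\<Sum>i\<in>I. a i * m i l) = 0)"
      by (rule insert.IH) (use insert in auto)
    then obtain a where a: "\<exists>i\<in>I. a i \<noteq> 0" "\<forall>l\<in>J. (\<Sum>i\<in>I. a i * m i l) = 0" by blast
    with True show ?thesis by (intro exI[of _ a]) auto
  next
    case False
    then obtain i0 where i0: "i0 \<in> I" "m i0 j \<noteq> 0" by blast
    have "card J < card (I - {i0})" using insert i0 by simp
    then obtain a where a: "\<exists>i\<in>I - {i0}. a i \<noteq> 0"
      "\<forall>l\<in>J. (\<Sum>i\<in>I - {i0}. a i * (m i l - m i j / m i0 j * m i0 l)) = 0"
      using insert.IH[of "I - {i0}" "\<lambda>i l. m i l - m i j / m i0 j * m i0 l"] insert.prems by auto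
    \<comment> \<open>The unknown \<open>i0\<close> is solved from equation \<open>j\<close>.\<close>
    define b where "b = a(i0 := - (\<Sum>i\<in>I - {i0}. a i * m i j / m i0 j))"
    have b: "(\<Sum>i\<in>I. b i * m i l) = (\<Sum>i\<in>I - {i0}. a i * (m i l - m i j / m i0 j * m i0 l))" for l
    proof -
      have "(\<Sum>i\<in>I. b i * m i l) = b i0 * m i0 l + (\<Sum>i\<in>I - {i0}. b i * m i l)"
        using insert.prems i0 by (simp add: sum.remove)
      also have "(\<Sum>i\<in>I - {i0}. b i * m i l) = (\<Sum>i\<in>I - {i0}. a i * m i l)"
        by (intro sum.cong) (auto simp: b_def)
      finally show ?thesis
        by (simp add: b_def algebra_simps sum_subtractf sum_distrib_left sum_distrib_right)
    qed
    have "(\<Sum>i\<in>I. b i * m i j) = 0" unfolding b using i0 by simp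
    moreover have "\<exists>i\<in>I. b i \<noteq> 0" using a(1) by (auto simp: b_def)
    ultimately show ?thesis using a(2) b by (intro exI[of _ b]) auto
  qed
qed

text \<open>The exchange principle for families of functions: \<open>H\<close> and the \<open>B i\<close>
  together are more functions than the \<open>C j\<close> that span them, hence dependent, and
  independence of the \<open>B i\<close> gives \<open>H\<close> a nonzero coefficient.\<close>

lemma spanning_by_count:
  fixes B :: "'i \<Rightarrow> 'p \<Rightarrow> 'a::field" and C :: "'j \<Rightarrow> 'p \<Rightarrow> 'a"
  assumes I: "finite I" and J: "finite J" "card J \<le> card I"
    and indep: "\<And>a. (\<And>p. (\<Sum>i\<in>I. a i * B i p) = 0) \<Longrightarrow> \<forall>i\<in>I. a i = 0"
    and B: "\<And>i. i \<in> I \<Longrightarrow> \<exists>m. \<forall>p. B i p = (\<Sum>j\<in>J. m j * C j p)"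
    and H: "\<exists>m. \<forall>p. H p = (\<Sum>j\<in>J. m j * C j p)"
  shows "\<exists>a. \<forall>p. H p = (\<Sum>i\<in>I. a i * B i p)"
proof -
  obtain mB where mB: "\<And>i p. i \<in> I \<Longrightarrow> B i p = (\<Sum>j\<in>J. mB i j * C j p)" using B by metis
  obtain mH where mH: "\<And>p. H p = (\<Sum>j\<in>J. mH j * C j p)" using H by blast
  define m where "m = (\<lambda>x j. case x of None \<Rightarrow> mH j | Some i \<Rightarrow> mB i j)"
  let ?I = "insert None (Some ` I)"
  have "card J < card ?I" using I J by (simp add: card_image)
  then obtain b where b: "\<exists>x\<in>?I. b x \<noteq> 0" "\<And>j. j \<in> J \<Longrightarrow> (\<Sum>x\<in>?I. b x * m x j) = 0"
    using nontrivial_relation[of J ?I m] I J by auto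
  have sumI: "(\<Sum>x\<in>?I. g x) = g None + (\<Sum>i\<in>I. g (Some i))" for g :: "'i option \<Rightarrow> 'a"
    using I by (simp add: sum.reindex)
  have rel: "b None * H p + (\<Sum>i\<in>I. b (Some i) * B i p) = 0" for p
  proof -
    have "b None * H p + (\<Sum>i\<in>I. b (Some i) * B i p)
        = b None * (\<Sum>j\<in>J. mH j * C j p) + (\<Sum>i\<in>I. b (Some i) * (\<Sum>j\<in>J. mB i j * C j p))"
      using mB mH by simp
    also have "\<dots> = (\<Sum>j\<in>J. b None * mH j * C j p) + (\<Sum>i\<in>I. \<Sum>j\<in>J. b (Some i) * mB i j * C j p)"
      by (simp add: sum_distrib_left mult.assoc)
    also have "\<dots> = (\<Sum>j\<in>J. b None * mH j * C j p) + (\<Sum>j\<in>J. \<Sum>i\<in>I. b (Some i) * mB i j * C j p)"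
      by (subst (2) sum.swap) simp
    also have "\<dots> = (\<Sum>j\<in>J. (\<Sum>x\<in>?I. b x * m x j) * C j p)"
      unfolding sumI by (simp add: m_def sum.distrib sum_distrib_right ring_distribs)
    also have "\<dots> = 0" using b(2) by simp
    finally show ?thesis .
  qed
  have "b None \<noteq> 0"
  proof
    assume 0: "b None = 0"
    then have "\<forall>i\<in>I. b (Some i) = 0" using indep[of "\<lambda>i. b (Some i)"] rel by simp
    with 0 b(1) show False by auto
  qed
  then have "H p = (\<Sum>i\<in>I. - b (Some i) / b None * B i p)" for p
    using rel[of p]
    by (simp add: sum_negf sum_divide_distrib[symmetric] field_simps eq_neg_iff_add_eq_0)
  then show ?thesis by (intro exI[of _ "\<lambda>i. - b (Some i) / b None"]) simp
qed

text \<open>The value at \<open>\<mu>\<close> is the leading coefficient times the product of the distances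
  to the roots, so it cannot be small if all roots are far away.\<close>

lemma root_near:
  fixes p :: "complex poly"
  assumes "norm (poly p \<mu>) < norm (lead_coeff p) * \<delta> ^ degree p" "\<delta> > 0"
  shows "\<exists>r. poly p r = 0 \<and> norm (\<mu> - r) < \<delta>"
proof (rule ccontr)
  assume "\<not> ?thesis"
  then have far: "\<And>r. poly p r = 0 \<Longrightarrow> \<delta> \<le> norm (\<mu> - r)" by force
  have "p \<noteq> 0" using assms by auto
  then obtain R where R: "size R = degree p" "p = smult (lead_coeff p) (\<Prod>x\<in>#R. [:-x, 1:])"
    using alg_closed_imp_factorization by blast
  have pv: "poly p y = lead_coeff p * (\<Prod>x\<in>#R. y - x)" for y
    by (subst R(2)) (simp add: poly_prod_mset image_mset.compositionality o_def)
  have far': "\<delta> \<le> norm (\<mu> - x)" if "x \<in># R" for x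
    by (rule far) (use that in \<open>auto simp: pv prod_mset_zero_iff\<close>)
  then have "\<delta> ^ size R \<le> norm (\<Prod>x\<in>#R. \<mu> - x)"
    using assms(2)
  proof (induction R)
    case (add x R)
    have "\<delta> * \<delta> ^ size R \<le> norm (\<mu> - x) * norm (\<Prod>x\<in>#R. \<mu> - x)"
      using add by (intro mult_mono) auto
    then show ?case by (simp add: norm_mult)
  qed simp
  then have "norm (lead_coeff p) * \<delta> ^ degree p \<le> norm (poly p \<mu>)"
    unfolding pv norm_mult R(1) by (intro mult_left_mono) auto
  with assms(1) show False by simp
qed

lemma prod_linear_coeff:
  fixes b c :: "'i \<Rightarrow> 'a::comm_ring_1"
  assumes "finite S"
  shows "degree (\<Prod>i\<in>S. [:b i, c i:]) \<le> card S \<and> coeff (\<Prod>i\<in>S. [:b i, c i:]) (card S) = (\<Prod>i\<in>S. c i)"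
  using assms
proof (induction S rule: finite_induct)
  case (insert i S)
  then have "coeff (\<Prod>i\<in>S. [:b i, c i:]) (Suc (card S)) = 0" by (simp add: coeff_eq_0)
  moreover have "degree ([:b i, c i:] * (\<Prod>i\<in>S. [:b i, c i:])) \<le> 1 + card S"
    by (rule order_trans[OF degree_mult_le]) (use insert in \<open>auto intro: add_mono\<close>)
  ultimately show ?case using insert by simp
qed simp

text \<open>The coefficient in degree \<open>n\<close> is \<open>det C\<close>, so a pencil with invertible
  \<open>C\<close> has \<open>n\<close> roots, counted with multiplicity.\<close>

lemma det_pencil_polynomial:
  fixes B C :: "complex^'n^'n"
  obtains p where "\<And>l. poly p l = det (\<chi> i j. B $ i $ j + l * C $ i $ j)"
    "degree p \<le> CARD('n)" "coeff p CARD('n) = det C"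
proof
  define q where "q \<pi> = (\<Prod>i\<in>UNIV. [:B $ i $ \<pi> i, C $ i $ \<pi> i:])" for \<pi> :: "'n \<Rightarrow> 'n"
  define p where "p = (\<Sum>\<pi> | \<pi> permutes (UNIV :: 'n set). smult (of_int (sign \<pi>)) (q \<pi>))"
  have q: "degree (q \<pi>) \<le> CARD('n)" "coeff (q \<pi>) CARD('n) = (\<Prod>i\<in>UNIV. C $ i $ \<pi> i)" for \<pi>
    unfolding q_def using prod_linear_coeff[of "UNIV :: 'n set" "\<lambda>i. B $ i $ \<pi> i" "\<lambda>i. C $ i $ \<pi> i"] by auto
  show "poly p l = det (\<chi> i j. B $ i $ j + l * C $ i $ j)" for l
    by (simp add: p_def q_def det_def poly_sum poly_prod)
  show "degree p \<le> CARD('n)"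
    unfolding p_def by (intro degree_sum_le order_trans[OF degree_smult_le q(1)]) (simp add: finite_permutations)
  show "coeff p CARD('n) = det C"
    by (simp add: p_def coeff_sum q(2) det_def)
qed

lemma tendsto_det:
  fixes A :: "'x \<Rightarrow> complex^'n^'n"
  assumes "\<And>i j. ((\<lambda>s. A s $ i $ j) \<longlongrightarrow> A0 $ i $ j) F"
  shows "((\<lambda>s. det (A s)) \<longlongrightarrow> det A0) F"
  unfolding det_def by (intro tendsto_intros assms)

text \<open>A pencil with the maximal number of distinct roots keeps it under small perturbations: near each
  root the perturbed determinant is small, so it has a root nearby, and the roots found for
  different original roots are different.\<close>

lemma pencil_roots_persist:
  fixes B C :: "'x \<Rightarrow> complex^'n^'n"
  assumes B: "\<And>i j. ((\<lambda>s. B s $ i $ j) \<longlongrightarrow> B0 $ i $ j) F"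
    and C: "\<And>i j. ((\<lambda>s. C s $ i $ j) \<longlongrightarrow> C0 $ i $ j) F"
    and nz: "det C0 \<noteq> 0"
    and R: "card R = CARD('n)" "\<And>l. l \<in> R \<Longrightarrow> det (\<chi> i j. B0 $ i $ j + l * C0 $ i $ j) = 0"
  shows "\<forall>\<^sub>F s in F. det (C s) \<noteq> 0 \<and>
    (\<exists>R'. card R' = CARD('n) \<and> (\<forall>l\<in>R'. det (\<chi> i j. B s $ i $ j + l * C s $ i $ j) = 0))"
proof -
  have fR: "finite R" using R(1) by (metis card.infinite zero_less_card_finite less_irrefl)
  obtain \<delta> where \<delta>: "\<delta> > 0" "\<And>l l'. l \<in> R \<Longrightarrow> l' \<in> R \<Longrightarrow> l \<noteq> l' \<Longrightarrow> 2 * \<delta> \<le> dist l l'"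
  proof -
    obtain e where "e > 0" "\<And>l l'. l \<in> R \<Longrightarrow> l' \<in> R \<Longrightarrow> l \<noteq> l' \<Longrightarrow> e \<le> dist l l'"
    proof -
      let ?D = "insert 1 ((\<lambda>(l, l'). dist l l') ` {p \<in> R \<times> R. fst p \<noteq> snd p})"
      have fD: "finite ?D" using fR by simp
      show thesis
      proof (rule that[of "Min ?D"])
        show "Min ?D > 0" using fD by (subst Min_gr_iff) auto
        fix l l' assume "l \<in> R" "l' \<in> R" "l \<noteq> l'"
        then show "Min ?D \<le> dist l l'" by (intro Min_le fD) (auto intro!: rev_image_eqI[of "(l, l')"])
      qed
    qed
    then show thesis by (intro that[of "e / 2"]) auto
  qed
  have tC: "((\<lambda>s. det (C s)) \<longlongrightarrow> det C0) F" by (rule tendsto_det[OF C])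
  have ev1: "\<forall>\<^sub>F s in F. det (C s) \<noteq> 0" by (rule tendsto_imp_eventually_ne[OF tC nz])
  have ev2: "\<forall>\<^sub>F s in F. \<forall>l\<in>R. norm (det (\<chi> i j. B s $ i $ j + l * C s $ i $ j)) < norm (det (C s)) * \<delta> ^ CARD('n)"
  proof (rule eventually_ball_finite[OF fR], rule ballI)
    fix l assume l: "l \<in> R"
    have "((\<lambda>s. norm (det (C s)) * \<delta> ^ CARD('n) - norm (det (\<chi> i j. B s $ i $ j + l * C s $ i $ j)))
        \<longlongrightarrow> norm (det C0) * \<delta> ^ CARD('n) - norm (det (\<chi> i j. B0 $ i $ j + l * C0 $ i $ j))) F"
      by (intro tendsto_diff tendsto_mult tendsto_norm tendsto_const tC tendsto_det)
         (simp, intro tendsto_intros B C)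
    moreover have "norm (det C0) * \<delta> ^ CARD('n) - norm (det (\<chi> i j. B0 $ i $ j + l * C0 $ i $ j)) > 0"
      using nz \<delta>(1) R(2)[OF l] by simp
    ultimately show "\<forall>\<^sub>F s in F. norm (det (\<chi> i j. B s $ i $ j + l * C s $ i $ j)) < norm (det (C s)) * \<delta> ^ CARD('n)"
      using order_tendstoD(1) by fastforce
  qed
  from ev1 ev2 show ?thesis
  proof eventually_elim
    case (elim s)
    obtain p where p: "\<And>l. poly p l = det (\<chi> i j. B s $ i $ j + l * C s $ i $ j)"
      "degree p \<le> CARD('n)" "coeff p CARD('n) = det (C s)"
      using det_pencil_polynomial by blast
    have deg: "degree p = CARD('n)" using p(2,3) elim(1) by (metis le_antisym le_degree)
    have "\<forall>l\<in>R. \<exists>r. poly p r = 0 \<and> norm (l - r) < \<delta>"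
      using root_near[of p _ \<delta>] elim(2) \<delta>(1) p deg by auto
    then obtain r where r: "\<And>l. l \<in> R \<Longrightarrow> poly p (r l) = 0 \<and> norm (l - r l) < \<delta>" by metis
    have "inj_on r R"
    proof (rule inj_onI, rule ccontr)
      fix l l' assume l: "l \<in> R" "l' \<in> R" "r l = r l'" "l \<noteq> l'"
      have "dist l l' \<le> dist l (r l) + dist l' (r l')" using l(3) by (metis dist_triangle2)
      also have "\<dots> < 2 * \<delta>" using r[OF l(1)] r[OF l(2)] by (simp add: dist_norm)
      finally show False using \<delta>(2)[OF l(1,2,4)] by simp
    qed
    then have "card (r ` R) = CARD('n)" using R(1) by (simp add: card_image)
    moreover have "\<forall>l\<in>r ` R. det (\<chi> i j. B s $ i $ j + l * C s $ i $ j) = 0" using r p(1) by auto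
    ultimately show ?case using elim(1) by blast
  qed
qed

lemma sum_axis:
  "(\<Sum>j\<in>UNIV. g j * axis i 1 $ j) = (g i :: complex)" "(\<Sum>j\<in>UNIV. g j * axis j 1 $ i) = (g i :: complex)"
proof -
  have "g j * axis i 1 $ j = (if j = i then g i else 0)" "g j * axis j 1 $ i = (if j = i then g i else 0)" for j
    by (auto simp: axis_def)
  then show "(\<Sum>j\<in>UNIV. g j * axis i 1 $ j) = g i" "(\<Sum>j\<in>UNIV. g j * axis j 1 $ i) = g i"
    by simp_all
qed

lemma eigenvectors_independent:
  fixes N :: "complex^'n^'n"
  assumes "finite R" "\<And>l. l \<in> R \<Longrightarrow> N *v t l = l *s t l \<and> t l \<noteq> 0"
    "(\<Sum>l\<in>R. a l *s t l) = 0" "l \<in> R"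
  shows "a l = 0"
  using assms
proof (induction R arbitrary: a l rule: finite_induct)
  case (insert m R)
  have "N *v (\<Sum>l\<in>insert m R. a l *s t l) = (\<Sum>l\<in>insert m R. a l *s (N *v t l))"
    unfolding vec.linear_sum[OF matrix_vector_mul_linear_gen] vector_scalar_commute ..
  then have 1: "(\<Sum>l\<in>insert m R. (a l * l) *s t l) = 0"
    using insert.prems(1,2) by (simp add: vector_smult_assoc)
  have "(\<Sum>l\<in>R. (a l * (l - m)) *s t l) = (\<Sum>l\<in>insert m R. (a l * l) *s t l) - m *s (\<Sum>l\<in>insert m R. a l *s t l)"
    using insert.hyps
    by (simp add: vec.scale_sum_right vector_smult_assoc sum_subtractf[symmetric] vec.scale_right_diff_distrib
        vec.scale_left_diff_distrib vec.scale_right_distrib algebra_simps)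
  then have 2: "(\<Sum>l\<in>R. (a l * (l - m)) *s t l) = 0" using 1 insert.prems(2) by simp
  have R: "a l = 0" if "l \<in> R" for l
  proof -
    have "a l * (l - m) = 0" by (rule insert.IH[OF _ 2 that]) (use insert.prems in blast)
    moreover have "l \<noteq> m" using that insert.hyps by blast
    ultimately show ?thesis by simp
  qed
  then have "a m *s t m = 0" using insert.prems(2) insert.hyps by simp
  then have "a m = 0" using insert.prems(1)[of m] by (auto simp: vec_eq_iff)
  with R insert.prems(3) show ?case by blast
qed simp

text \<open>Eigenvectors for \<open>n\<close> distinct eigenvalues span the whole space.\<close>

lemma linear_form_zero_on_eigenvectors:
  fixes N :: "complex^'n^'n"
  assumes R: "card R = CARD('n)" and N: "\<And>l. l \<in> R \<Longrightarrow> N *v t l = l *s t l \<and> t l \<noteq> 0"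
    and g: "\<And>l. l \<in> R \<Longrightarrow> (\<Sum>i\<in>UNIV. g $ i * t l $ i) = 0"
  shows "g = 0"
proof -
  have fR: "finite R" using R by (metis card.infinite zero_less_card_finite less_irrefl)
  have "\<exists>a. \<forall>i. axis j 1 $ i = (\<Sum>l\<in>R. a l * t l $ i)" for j
  proof (rule spanning_by_count[where J = "UNIV :: 'n set" and C = "\<lambda>j i. axis j 1 $ i"])
    show "finite R" by fact
    show "CARD('n) \<le> card R" using R by simp
    fix a :: "complex \<Rightarrow> complex" assume "\<And>i. (\<Sum>l\<in>R. a l * t l $ i) = 0"
    then have "(\<Sum>l\<in>R. a l *s t l) = 0" by (simp add: vec_eq_iff)
    then show "\<forall>l\<in>R. a l = 0" using eigenvectors_independent[OF fR N] by blast
  next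
    fix l assume "l \<in> R"
    show "\<exists>m. \<forall>i. t l $ i = (\<Sum>j\<in>UNIV. m j * axis j 1 $ i)"
      by (rule exI[of _ "\<lambda>j. t l $ j"]) (simp add: sum_axis)
  next
    show "\<exists>m. \<forall>i. axis j 1 $ i = (\<Sum>j'\<in>UNIV. m j' * axis j' 1 $ i :: complex)"
      by (rule exI[of _ "\<lambda>j'. axis j 1 $ j'"]) (simp add: sum_axis)
  qed simp
  then obtain a where a: "\<And>j i. axis j 1 $ i = (\<Sum>l\<in>R. a j l * t l $ i)" by metis
  have "g $ j = 0" for j
  proof -
    have "g $ j = (\<Sum>i\<in>UNIV. g $ i * axis j 1 $ i)"
      by (simp add: sum_axis)
    also have "\<dots> = (\<Sum>i\<in>UNIV. \<Sum>l\<in>R. a j l * (g $ i * t l $ i))"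
      unfolding a by (simp add: sum_distrib_left mult_ac)
    also have "\<dots> = (\<Sum>l\<in>R. a j l * (\<Sum>i\<in>UNIV. g $ i * t l $ i))"
      by (subst sum.swap) (simp add: sum_distrib_left)
    also have "\<dots> = 0" using g by simp
    finally show ?thesis .
  qed
  then show ?thesis by (simp add: vec_eq_iff)
qed

section \<open>Differential operators as sums over words\<close>

lemma partial_deriv_add:
  assumes "cdiff_on U g" "cdiff_on U h" "x \<in> U"
  shows "partial_deriv j (\<lambda>x. g x + h x) x = partial_deriv j g x + partial_deriv j h x"
  using DERIV_add[OF cdiff_on_has_partial_deriv[OF assms(1,3), of j] cdiff_on_has_partial_deriv[OF assms(2,3), of j]]
  unfolding partial_deriv_def[of j "\<lambda>x. g x + h x"] by (rule DERIV_imp_deriv)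

lemma partial_deriv_mult:
  assumes "cdiff_on U g" "cdiff_on U h" "x \<in> U"
  shows "partial_deriv j (\<lambda>x. g x * h x) x = partial_deriv j g x * h x + g x * partial_deriv j h x"
  using DERIV_mult[OF cdiff_on_has_partial_deriv[OF assms(1,3), of j] cdiff_on_has_partial_deriv[OF assms(2,3), of j]]
  unfolding partial_deriv_def[of j "\<lambda>x. g x * h x"]
  by (intro DERIV_imp_deriv) (simp add: algebra_simps)

lemma partial_deriv_const [simp]: "partial_deriv j (\<lambda>x. c) x = 0"
  by (simp add: partial_deriv_def)

lemma partial_deriv_cmult:
  assumes "cdiff_on U g" "x \<in> U"
  shows "partial_deriv j (\<lambda>x. c * g x) x = c * partial_deriv j g x"
  using partial_deriv_mult[OF cdiff_on_const assms, of j c] by simp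

lemma partial_deriv_sum:
  assumes "\<And>i. i \<in> S \<Longrightarrow> cdiff_on U (g i)" "x \<in> U"
  shows "partial_deriv j (\<lambda>x. \<Sum>i\<in>S. g i x) x = (\<Sum>i\<in>S. partial_deriv j (g i) x)"
  using assms(1)
proof (induction S rule: infinite_finite_induct)
  case (insert i S)
  then show ?case
    using partial_deriv_add[OF insert.prems cdiff_on_sum[of S U g] assms(2), of i j] by simp
qed auto

lemma partial_deriv_exp_linear:
  "partial_deriv j (\<lambda>x. exp (\<Sum>i\<in>UNIV. c i * x $ i)) x = c j * exp (\<Sum>i\<in>UNIV. c i * x $ i)"
proof -
  have "c i * (if i = j then s else 0) = (if i = j then c j * s else 0)" for i s
    by simp
  then have "(\<Sum>i\<in>UNIV. c i * (x + axis j s) $ i) = (\<Sum>i\<in>UNIV. c i * x $ i) + c j * s" for s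
    by (simp add: axis_def ring_distribs sum.distrib)
  moreover have "((\<lambda>s. exp ((\<Sum>i\<in>UNIV. c i * x $ i) + c j * s)) has_field_derivative
          c j * exp (\<Sum>i\<in>UNIV. c i * x $ i)) (at 0)"
    by (auto intro!: derivative_eq_intros)
  ultimately show ?thesis unfolding partial_deriv_def by (simp only: DERIV_imp_deriv)
qed

text \<open>Iterated partial derivatives along a word of directions. With words, products of operators are
  handled by concatenation and the Leibniz rule alone; on differentiable functions the result
  depends on the content of the word only (\<open>word_deriv_count\<close>).\<close>

primrec word_deriv :: "'n::finite list \<Rightarrow> (complex^'n \<Rightarrow> complex) \<Rightarrow> (complex^'n \<Rightarrow> complex)" where
  "word_deriv [] g = g"
| "word_deriv (j # w) g = partial_deriv j (word_deriv w g)"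

lemma cdiff_on_word_deriv: "cdiff_on U g \<Longrightarrow> open U \<Longrightarrow> cdiff_on U (word_deriv w g)"
  by (induction w) (auto intro: cdiff_on_partial)

lemma word_deriv_cong:
  assumes "open U" "\<And>y. y \<in> U \<Longrightarrow> g y = h y"
  shows "x \<in> U \<Longrightarrow> word_deriv w g x = word_deriv w h x"
proof (induction w arbitrary: x)
  case Nil then show ?case using assms by simp
next
  case (Cons j w)
  show ?case by (simp, rule partial_deriv_cong[OF assms(1) Cons.prems]) (rule Cons.IH)
qed

lemma word_deriv_move:
  assumes "cdiff_on U g" "open U"
  shows "x \<in> U \<Longrightarrow> word_deriv (v @ j # w) g x = word_deriv (j # v @ w) g x"
proof (induction v arbitrary: x)
  case (Cons i v)
  have "word_deriv ((i # v) @ j # w) g x = partial_deriv i (word_deriv (j # v @ w) g) x"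
    by (simp, rule partial_deriv_cong[OF assms(2) Cons.prems]) (use Cons.IH in simp)
  also have "\<dots> = partial_deriv j (partial_deriv i (word_deriv (v @ w) g)) x"
    by (simp, rule partial_deriv_commute[OF cdiff_on_word_deriv[OF assms] assms(2) Cons.prems])
  finally show ?case by simp
qed simp

lemma word_deriv_perm:
  assumes "cdiff_on U g" "open U"
  shows "mset v = mset w \<Longrightarrow> x \<in> U \<Longrightarrow> word_deriv v g x = word_deriv w g x"
proof (induction v arbitrary: w x)
  case (Cons j v)
  then have "j \<in> set w" by (metis list.set_intros(1) set_mset_mset)
  then obtain w1 w2 where w: "w = w1 @ j # w2" by (meson split_list)
  have "word_deriv (j # v) g x = partial_deriv j (word_deriv (w1 @ w2) g) x"
    by (simp, rule partial_deriv_cong[OF assms(2) Cons.prems(2)])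
       (use Cons.IH[of "w1 @ w2"] Cons.prems(1) w in simp)
  also have "\<dots> = word_deriv w g x" using word_deriv_move[OF assms Cons.prems(2), of w1 j w2] w by simp
  finally show ?case .
qed simp

lemma word_deriv_count:
  assumes "cdiff_on U g" "open U" "x \<in> U" "count_list v = count_list w"
  shows "word_deriv v g x = word_deriv w g x"
  using word_deriv_perm[OF assms(1,2) _ assms(3)] assms(4)
  by (metis count_mset multiset_eq_iff)

lemma ex_word: "\<exists>w. count_list w = (\<alpha> :: 'n::finite \<Rightarrow> nat)"
proof -
  have "finite {j. \<alpha> j > 0}" by simp
  then have "count (Abs_multiset \<alpha>) = \<alpha>" by simp
  moreover obtain w where "mset w = Abs_multiset \<alpha>" using ex_mset by blast
  ultimately show ?thesis by (metis count_mset ext)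
qed

text \<open>Some word with prescribed content, turning a multi-index into an operator.\<close>

definition word_of :: "('n::finite \<Rightarrow> nat) \<Rightarrow> 'n list" where
  "word_of \<alpha> = (SOME w. count_list w = \<alpha>)"

lemma count_word_of [simp]: "count_list (word_of \<alpha>) = \<alpha>"
  unfolding word_of_def by (rule someI_ex[OF ex_word])

lemma monomial_count_list: "monomial \<kappa> (count_list w) = prod_list (map \<kappa> w)"
proof (induction w)
  case (Cons i w)
  have "(\<Prod>j\<in>UNIV. \<kappa> j ^ count_list (i # w) j) = (\<Prod>j\<in>UNIV. (if j = i then \<kappa> i else 1) * \<kappa> j ^ count_list w j)"
    by (intro prod.cong) auto
  with Cons show ?case by (simp add: monomial_def prod.distrib)
qed (simp add: monomial_def)

lemma word_deriv_exp_linear: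
  "word_deriv w (\<lambda>x. b * exp (\<Sum>i\<in>UNIV. c i * x $ i)) = (\<lambda>x. b * monomial c (count_list w) * exp (\<Sum>i\<in>UNIV. c i * x $ i))"
proof (induction w)
  case (Cons j w)
  show ?case
    unfolding word_deriv.simps Cons monomial_count_list
    by (rule ext, subst partial_deriv_cmult[of UNIV])
       (auto intro!: cdiff_on_exp cdiff_on_linear simp: partial_deriv_exp_linear mult_ac)
qed (simp add: monomial_def)

lemma word_deriv_add:
  assumes "cdiff_on U g" "cdiff_on U h" "open U"
  shows "x \<in> U \<Longrightarrow> word_deriv w (\<lambda>x. g x + h x) x = word_deriv w g x + word_deriv w h x"
proof (induction w arbitrary: x)
  case (Cons j w)
  have "word_deriv (j # w) (\<lambda>x. g x + h x) x = partial_deriv j (\<lambda>x. word_deriv w g x + word_deriv w h x) x"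
    by (simp, rule partial_deriv_cong[OF assms(3) Cons.prems]) (rule Cons.IH)
  then show ?case
    using partial_deriv_add[OF cdiff_on_word_deriv cdiff_on_word_deriv Cons.prems] assms by simp
qed simp

text \<open>A differential operator as a list of terms: a coefficient function and a word of partial
  derivatives.\<close>

type_synonym 'n opform = "((complex^'n \<Rightarrow> complex) \<times> 'n list) list"

definition opform_sum :: "'n opform \<Rightarrow> (complex^'n \<Rightarrow> complex) \<Rightarrow> complex^'n \<Rightarrow> complex" where
  "opform_sum xs g x = (\<Sum>(a, w)\<leftarrow>xs. a x * word_deriv w g x)"

definition coeffs_cdiff :: "(complex^'n) set \<Rightarrow> 'n opform \<Rightarrow> bool" where
  "coeffs_cdiff U xs \<longleftrightarrow> (\<forall>(a, w)\<in>set xs. cdiff_on U a)"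

lemma opform_sum_simps [simp]:
  "opform_sum [] g x = 0" "opform_sum (p # xs) g x = fst p x * word_deriv (snd p) g x + opform_sum xs g x"
  "opform_sum (xs @ ys) g x = opform_sum xs g x + opform_sum ys g x"
  by (auto simp: opform_sum_def case_prod_unfold)

lemma coeffs_cdiff_simps [simp]:
  "coeffs_cdiff U []" "coeffs_cdiff U (p # xs) \<longleftrightarrow> cdiff_on U (fst p) \<and> coeffs_cdiff U xs"
  "coeffs_cdiff U (xs @ ys) \<longleftrightarrow> coeffs_cdiff U xs \<and> coeffs_cdiff U ys"
  by (auto simp: coeffs_cdiff_def)

lemma coeffs_cdiff_subset: "coeffs_cdiff U xs \<Longrightarrow> V \<subseteq> U \<Longrightarrow> coeffs_cdiff V xs"
  by (auto simp: coeffs_cdiff_def intro: cdiff_on_subset)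

lemma opform_sum_cong:
  assumes "open U" "\<And>y. y \<in> U \<Longrightarrow> g y = h y" "x \<in> U"
  shows "opform_sum xs g x = opform_sum xs h x"
  by (induction xs) (auto simp: word_deriv_cong[OF assms(1,2,3)])

lemma cdiff_on_opform_sum:
  assumes "coeffs_cdiff U xs" "cdiff_on U g" "open U"
  shows "cdiff_on U (opform_sum xs g)"
  using assms(1)
proof (induction xs)
  case (Cons p xs)
  then have "cdiff_on U (\<lambda>x. fst p x * word_deriv (snd p) g x + opform_sum xs g x)"
    by (intro cdiff_on_add cdiff_on_mult cdiff_on_word_deriv assms) auto
  then show ?case by (simp only: opform_sum_simps(2)[abs_def])
qed (simp add: opform_sum_simps(1)[abs_def])

text \<open>The Leibniz rule, applied to each term.\<close>

primrec opform_partial :: "'n::finite \<Rightarrow> 'n opform \<Rightarrow> 'n opform" where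
  "opform_partial j [] = []"
| "opform_partial j (p # xs) = (partial_deriv j (fst p), snd p) # (fst p, j # snd p) # opform_partial j xs"

lemma coeffs_cdiff_opform_partial: "coeffs_cdiff U xs \<Longrightarrow> open U \<Longrightarrow> coeffs_cdiff U (opform_partial j xs)"
  by (induction xs) (auto intro: cdiff_on_partial)

lemma partial_deriv_opform_sum:
  assumes "coeffs_cdiff U xs" "cdiff_on U g" "open U" "x \<in> U"
  shows "partial_deriv j (opform_sum xs g) x = opform_sum (opform_partial j xs) g x"
  using assms(1)
proof (induction xs)
  case (Cons p xs)
  have 1: "partial_deriv j (opform_sum (p # xs) g) x =
      partial_deriv j (\<lambda>x. fst p x * word_deriv (snd p) g x) x + partial_deriv j (opform_sum xs g) x"
    unfolding opform_sum_simps(2)[abs_def] using Cons.prems assms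
    by (intro partial_deriv_add[of U] cdiff_on_mult cdiff_on_word_deriv cdiff_on_opform_sum) auto
  have 2: "partial_deriv j (\<lambda>x. fst p x * word_deriv (snd p) g x) x =
      partial_deriv j (fst p) x * word_deriv (snd p) g x + fst p x * partial_deriv j (word_deriv (snd p) g) x"
    using Cons.prems assms by (intro partial_deriv_mult[of U] cdiff_on_word_deriv) auto
  have 3: "partial_deriv j (opform_sum xs g) x = opform_sum (opform_partial j xs) g x"
    using Cons by simp
  have 4: "opform_sum (opform_partial j (p # xs)) g x = partial_deriv j (fst p) x * word_deriv (snd p) g x
      + (fst p x * partial_deriv j (word_deriv (snd p) g) x + opform_sum (opform_partial j xs) g x)"
    by simp
  show ?case by (simp only: 1 2 3 4 add.assoc)
qed (simp add: opform_sum_simps(1)[abs_def])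

lemma word_deriv_opform_sum:
  assumes "coeffs_cdiff U ys" "open U"
  obtains zs where "coeffs_cdiff U zs"
    "\<And>V g x. open V \<Longrightarrow> V \<subseteq> U \<Longrightarrow> cdiff_on V g \<Longrightarrow> x \<in> V \<Longrightarrow> word_deriv w (opform_sum ys g) x = opform_sum zs g x"
proof (induction w arbitrary: thesis)
  case Nil then show ?case using assms by simp
next
  case (Cons j w)
  obtain zs where zs: "coeffs_cdiff U zs"
    "\<And>V g x. open V \<Longrightarrow> V \<subseteq> U \<Longrightarrow> cdiff_on V g \<Longrightarrow> x \<in> V \<Longrightarrow> word_deriv w (opform_sum ys g) x = opform_sum zs g x"
    using Cons.IH by blast
  show ?case
  proof (rule Cons.prems)
    show "coeffs_cdiff U (opform_partial j zs)" by (rule coeffs_cdiff_opform_partial[OF zs(1) assms(2)])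
    fix V g x assume V: "open V" "V \<subseteq> U" "cdiff_on V g" "x \<in> V"
    have "word_deriv (j # w) (opform_sum ys g) x = partial_deriv j (opform_sum zs g) x"
      by (simp, rule partial_deriv_cong[OF V(1,4)]) (rule zs(2)[OF V(1-3)])
    also have "\<dots> = opform_sum (opform_partial j zs) g x"
      by (rule partial_deriv_opform_sum[OF coeffs_cdiff_subset[OF zs(1) V(2)] V(3,1,4)])
    finally show "word_deriv (j # w) (opform_sum ys g) x = opform_sum (opform_partial j zs) g x" .
  qed
qed

lemma opform_sum_comp:
  assumes "coeffs_cdiff U xs" "coeffs_cdiff U ys" "open U"
  obtains zs where "coeffs_cdiff U zs"
    "\<And>V g x. open V \<Longrightarrow> V \<subseteq> U \<Longrightarrow> cdiff_on V g \<Longrightarrow> x \<in> V \<Longrightarrow> opform_sum xs (opform_sum ys g) x = opform_sum zs g x"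
  using assms(1)
proof (induction xs arbitrary: thesis)
  case Nil then show ?case using Nil(1)[of "[]"] by simp
next
  case (Cons p xs)
  obtain zs where zs: "coeffs_cdiff U zs"
    "\<And>V g x. open V \<Longrightarrow> V \<subseteq> U \<Longrightarrow> cdiff_on V g \<Longrightarrow> x \<in> V \<Longrightarrow> opform_sum xs (opform_sum ys g) x = opform_sum zs g x"
    using Cons by auto
  obtain us where us: "coeffs_cdiff U us"
    "\<And>V g x. open V \<Longrightarrow> V \<subseteq> U \<Longrightarrow> cdiff_on V g \<Longrightarrow> x \<in> V \<Longrightarrow> word_deriv (snd p) (opform_sum ys g) x = opform_sum us g x"
    using word_deriv_opform_sum[OF assms(2,3)] by blast
  define vs where "vs = map (\<lambda>q. (\<lambda>x. fst p x * fst q x, snd q)) us"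
  have 1: "coeffs_cdiff U vs"
    using us(1) Cons.prems(2) unfolding vs_def by (induction us) (auto intro: cdiff_on_mult)
  have 2: "opform_sum vs g x = fst p x * opform_sum us g x" for g x
    unfolding vs_def by (induction us) (auto simp: algebra_simps)
  show ?case
    by (rule Cons.prems(1)[of "vs @ zs"]) (use 1 2 zs us in auto)
qed

text \<open>One domain \<open>U\<close> serves for all functions \<open>g\<close>. This uniformity is what
  allows an operator to act on a family of functions indexed by the points \<open>P\<close>.\<close>

lemma diff_ops_word_form:
  assumes "L \<in> diff_ops x0"
  obtains U xs where "open U" "x0 \<in> U" "coeffs_cdiff U xs"
    "\<And>V g x. open V \<Longrightarrow> V \<subseteq> U \<Longrightarrow> cdiff_on V g \<Longrightarrow> x \<in> V \<Longrightarrow> L g x = opform_sum xs g x"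
  using assms
proof (induction arbitrary: thesis rule: diff_ops.induct)
  case (mult a)
  then obtain U where "open U" "x0 \<in> U" "cdiff_on U a" unfolding analytic_germs_iff by blast
  then show ?case using mult.prems[of U "[(a, [])]"] by simp
next
  case (partial j)
  show ?case by (rule partial[of UNIV "[(\<lambda>x. 1, [j])]"]) auto
next
  case (add L L')
  obtain U xs where 1: "open U" "x0 \<in> U" "coeffs_cdiff U xs"
    "\<And>V g x. open V \<Longrightarrow> V \<subseteq> U \<Longrightarrow> cdiff_on V g \<Longrightarrow> x \<in> V \<Longrightarrow> L g x = opform_sum xs g x"
    using add.IH(1) by blast
  obtain U' xs' where 2: "open U'" "x0 \<in> U'" "coeffs_cdiff U' xs'"
    "\<And>V g x. open V \<Longrightarrow> V \<subseteq> U' \<Longrightarrow> cdiff_on V g \<Longrightarrow> x \<in> V \<Longrightarrow> L' g x = opform_sum xs' g x"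
    using add.IH(2) by blast
  show ?case
    by (rule add.prems[of "U \<inter> U'" "xs @ xs'"]) (use 1 2 coeffs_cdiff_subset[OF 1(3)] coeffs_cdiff_subset[OF 2(3)] in auto)
next
  case (comp L L')
  obtain U xs where 1: "open U" "x0 \<in> U" "coeffs_cdiff U xs"
    "\<And>V g x. open V \<Longrightarrow> V \<subseteq> U \<Longrightarrow> cdiff_on V g \<Longrightarrow> x \<in> V \<Longrightarrow> L g x = opform_sum xs g x"
    using comp.IH(1) by blast
  obtain U' xs' where 2: "open U'" "x0 \<in> U'" "coeffs_cdiff U' xs'"
    "\<And>V g x. open V \<Longrightarrow> V \<subseteq> U' \<Longrightarrow> cdiff_on V g \<Longrightarrow> x \<in> V \<Longrightarrow> L' g x = opform_sum xs' g x"
    using comp.IH(2) by blast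
  let ?W = "U \<inter> U'"
  have W: "open ?W" "coeffs_cdiff ?W xs" "coeffs_cdiff ?W xs'"
    using 1 2 coeffs_cdiff_subset[OF 1(3)] coeffs_cdiff_subset[OF 2(3)] by auto
  obtain zs where zs: "coeffs_cdiff ?W zs"
    "\<And>V g x. open V \<Longrightarrow> V \<subseteq> ?W \<Longrightarrow> cdiff_on V g \<Longrightarrow> x \<in> V \<Longrightarrow> opform_sum xs (opform_sum xs' g) x = opform_sum zs g x"
    using opform_sum_comp[OF W(2,3,1)] by blast
  show ?case
  proof (rule comp.prems[OF W(1) _ zs(1)])
    show "x0 \<in> ?W" using 1 2 by simp
    fix V g x assume V: "open V" "V \<subseteq> ?W" "cdiff_on V g" "x \<in> V"
    have eq: "\<And>y. y \<in> V \<Longrightarrow> opform_sum xs' g y = L' g y" using 2(4)[OF V(1) _ V(3)] V(2) by simp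
    have "cdiff_on V (opform_sum xs' g)"
      using cdiff_on_opform_sum[OF _ V(3,1)] coeffs_cdiff_subset[OF W(3) V(2)] by blast
    then have "cdiff_on V (L' g)" by (rule cdiff_on_cong[OF V(1), of "opform_sum xs' g" "L' g", rotated]) (rule eq)
    then have "L (L' g) x = opform_sum xs (L' g) x" using 1(4)[OF V(1)] V(2,4) by simp
    also have "\<dots> = opform_sum xs (opform_sum xs' g) x" by (rule opform_sum_cong[OF V(1) eq[symmetric] V(4)])
    also have "\<dots> = opform_sum zs g x" by (rule zs(2)[OF V])
    finally show "L (L' g) x = opform_sum zs g x" .
  qed
qed

text \<open>The coefficient of \<open>\<partial>^\<alpha>\<close> after the words with equal content have
  been collected.\<close>

definition total_coeff :: "'n opform \<Rightarrow> ('n \<Rightarrow> nat) \<Rightarrow> complex^'n \<Rightarrow> complex" where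
  "total_coeff xs \<alpha> x = (\<Sum>(a, w)\<leftarrow>xs. if count_list w = \<alpha> then a x else 0)"

lemma opform_sum_grouped:
  assumes "finite S" "\<And>a w. (a, w) \<in> set xs \<Longrightarrow> count_list w \<in> S"
    "\<And>w. w \<in> snd ` set xs \<Longrightarrow> word_deriv w g x = G (count_list w)"
  shows "opform_sum xs g x = (\<Sum>\<alpha>\<in>S. total_coeff xs \<alpha> x * G \<alpha>)"
  using assms(2,3)
proof (induction xs)
  case (Cons p xs)
  obtain a w where p: "p = (a, w)" by (cases p)
  have S: "count_list w \<in> S" using Cons.prems(1)[of a w] p by simp
  have "(\<Sum>\<alpha>\<in>S. total_coeff (p # xs) \<alpha> x * G \<alpha>) =
      (\<Sum>\<alpha>\<in>S. (if count_list w = \<alpha> then a x * G \<alpha> else 0) + total_coeff xs \<alpha> x * G \<alpha>)"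
    by (intro sum.cong) (auto simp: total_coeff_def p algebra_simps)
  also have "\<dots> = a x * G (count_list w) + (\<Sum>\<alpha>\<in>S. total_coeff xs \<alpha> x * G \<alpha>)"
    using S assms(1) by (simp add: sum.distrib)
  also have "\<dots> = a x * word_deriv w g x + opform_sum xs g x"
  proof -
    have "opform_sum xs g x = (\<Sum>\<alpha>\<in>S. total_coeff xs \<alpha> x * G \<alpha>)"
      by (rule Cons.IH) (use Cons.prems in auto)
    moreover have "word_deriv w g x = G (count_list w)" by (rule Cons.prems(2)) (simp add: p)
    ultimately show ?thesis by simp
  qed
  finally show ?case by (simp add: p)
qed (simp add: total_coeff_def)

text \<open>This direction of the normal form theorem rests on commuting derivatives. Its hypothesis will be
  verified by letting operators act on exponentials.\<close>

lemma zero_op_if_total_coeff_zero: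
  assumes L: "\<And>V g x. open V \<Longrightarrow> V \<subseteq> U \<Longrightarrow> cdiff_on V g \<Longrightarrow> x \<in> V \<Longrightarrow> L g x = opform_sum xs g x"
    and U: "open U" "x0 \<in> U"
    and z: "\<And>x \<alpha>. x \<in> U \<Longrightarrow> \<alpha> \<in> (\<lambda>(a, w). count_list w) ` set xs \<Longrightarrow> total_coeff xs \<alpha> x = 0"
  shows "zero_op x0 L"
  unfolding zero_op_def
proof
  fix g assume "g \<in> analytic_germs x0"
  then obtain V where V: "open V" "x0 \<in> V" "cdiff_on V g" unfolding analytic_germs_iff by blast
  have W: "open (U \<inter> V)" "cdiff_on (U \<inter> V) g" using U V cdiff_on_subset[OF V(3)] by auto
  have "L g x = 0" if x: "x \<in> U \<inter> V" for x
  proof -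
    have "L g x = opform_sum xs g x" using L[OF W(1) _ W(2) x] by simp
    also have "\<dots> = (\<Sum>\<alpha>\<in>(\<lambda>(a, w). count_list w) ` set xs. total_coeff xs \<alpha> x * word_deriv (word_of \<alpha>) g x)"
      by (rule opform_sum_grouped) (auto intro: rev_image_eqI word_deriv_count[OF W(2,1) x])
    also have "\<dots> = 0" using z x by (intro sum.neutral) auto
    finally show ?thesis .
  qed
  then show "\<forall>\<^sub>F x in nhds x0. L g x = 0"
    unfolding eventually_nhds using W(1) U V by blast
qed

lemma word_deriv_in_diff_ops: "word_deriv w \<in> diff_ops x0"
proof (induction w)
  case Nil
  have "(\<lambda>x. 1) \<in> analytic_germs x0" unfolding analytic_germs_iff by (auto intro!: exI[of _ UNIV])
  from diff_ops.mult[OF this] show ?case by (simp add: word_deriv.simps(1)[abs_def] ext)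
next
  case (Cons j w)
  from diff_ops.comp[OF diff_ops.partial Cons, of j] show ?case
    by (simp add: word_deriv.simps(2)[abs_def])
qed

lemma const_germ [simp]: "(\<lambda>x. c) \<in> analytic_germs x0"
  unfolding analytic_germs_iff by (auto intro!: exI[of _ UNIV])

lemma sum_in_diff_ops:
  assumes "finite S" "\<And>\<alpha>. \<alpha> \<in> S \<Longrightarrow> a \<alpha> \<in> analytic_germs x0"
  shows "(\<lambda>g x. \<Sum>\<alpha>\<in>S. a \<alpha> x * word_deriv (w \<alpha>) g x) \<in> diff_ops x0"
  using assms
proof (induction S rule: finite_induct)
  case empty
  then show ?case using diff_ops.mult[OF const_germ[of 0 x0]] by simp
next
  case (insert \<alpha> S)
  have "(\<lambda>g x. a \<alpha> x * word_deriv (w \<alpha>) g x) \<in> diff_ops x0"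
    using diff_ops.comp[OF diff_ops.mult word_deriv_in_diff_ops] insert.prems by blast
  from diff_ops.add[OF this insert.IH] insert show ?case by simp
qed

section \<open>Bihomogeneous forms and the gluing data\<close>

lemma form11_eq: "form11 a b z1 z2 t = z1 * (\<Sum>i\<in>UNIV. a $ i * t $ i) + z2 * (\<Sum>i\<in>UNIV. b $ i * t $ i)"
  unfolding form11_def sum.distrib sum_distrib_left by (simp add: mult_ac)

lemma form11_combination:
  "form11 a b (x * z1 + y * z1') (x * z2 + y * z2') t = x * form11 a b z1 z2 t + y * form11 a b z1' z2' t"
  by (simp add: form11_eq algebra_simps)

lemma form11_expand: "form11 a b z1 z2 t = (\<Sum>i\<in>UNIV. form11 a b z1 z2 (axis i 1) * t $ i)"
  by (simp add: form11_eq sum_axis sum_distrib_left sum.distrib ring_distribs mult_ac)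

lemma form11_scale: "form11 a b z1 z2 (r *s t) = r * form11 a b z1 z2 t"
  by (simp add: form11_eq sum_distrib_left algebra_simps)

lemma form11_add: "form11 a b z1 z2 (t + t') = form11 a b z1 z2 t + form11 a b z1 z2 t'"
  by (simp add: form11_eq sum.distrib algebra_simps)

lemma cp1_point_scale:
  assumes "r \<noteq> 0"
  shows "cp1_point (r * z1) (r * z2) = cp1_point z1 z2"
proof -
  have "(\<exists>d. p = (d * (r * z1), d * (r * z2)) \<and> d \<noteq> 0) \<longleftrightarrow> (\<exists>e. p = (e * z1, e * z2) \<and> e \<noteq> 0)" for p
  proof
    assume "\<exists>d. p = (d * (r * z1), d * (r * z2)) \<and> d \<noteq> 0"
    then obtain d where "p = (d * (r * z1), d * (r * z2))" "d \<noteq> 0" by blast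
    then show "\<exists>e. p = (e * z1, e * z2) \<and> e \<noteq> 0"
      using assms by (intro exI[of _ "d * r"]) simp
  next
    assume "\<exists>e. p = (e * z1, e * z2) \<and> e \<noteq> 0"
    then obtain e where "p = (e * z1, e * z2)" "e \<noteq> 0" by blast
    then show "\<exists>d. p = (d * (r * z1), d * (r * z2)) \<and> d \<noteq> 0"
      using assms by (intro exI[of _ "e / r"]) simp
  qed
  then show ?thesis unfolding cp1_point_def by blast
qed

lemma cp1_point_cross:
  assumes "cp1_point z1 z2 = cp1_point y1 y2"
  obtains r where "r \<noteq> 0" "z1 = r * y1" "z2 = r * y2"
proof -
  have "(z1, z2) \<in> cp1_point z1 z2" unfolding cp1_point_def by (auto intro!: exI[of _ 1])
  then have "(z1, z2) \<in> cp1_point y1 y2" using assms by simp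
  then show thesis using that unfolding cp1_point_def by auto
qed

lemma det_eq_0_iff_kernel:
  fixes M :: "complex^'n^'n"
  shows "det M = 0 \<longleftrightarrow> (\<exists>t. t \<noteq> 0 \<and> M *v t = 0)"
  using matrix_left_invertible_ker[of M] invertible_det_nz[of M] invertible_left_inverse[of M] by blast

text \<open>Cramer's rule in the plane.\<close>

lemma plane_coordinates:
  fixes y1 y2 q1 q2 z1 z2 :: complex
  assumes "y1 * q2 - y2 * q1 \<noteq> 0"
  shows "\<exists>u v. z1 = u * y1 + v * q1 \<and> z2 = u * y2 + v * q2"
proof -
  define D u v where "D = y1 * q2 - y2 * q1"
    and "u = (z1 * q2 - z2 * q1) / D" and "v = (y1 * z2 - y2 * z1) / D"
  have "u * y1 + v * q1 = (z1 * D) / D" "u * y2 + v * q2 = (z2 * D) / D"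
    unfolding u_def v_def times_divide_eq_left add_divide_distrib[symmetric]
    by (simp_all add: D_def algebra_simps)
  then show ?thesis using assms unfolding D_def by (intro exI[of _ u] exI[of _ v]) simp
qed

text \<open>The data of the theorem that do not involve \<open>x0\<close> and \<open>\<Lambda>\<close>.\<close>

locale glued_pencil =
  fixes a1 b1 a2 b2 A :: complex
    and T :: "complex^'n^'n"
    and lam :: "'n \<Rightarrow> complex"
    and w :: "'n \<Rightarrow> complex^'n"
    and \<alpha> \<beta> :: "complex^'n"
    and \<alpha>' \<beta>' :: "complex^'n^'n"
    and c :: "'n \<Rightarrow> complex"
    and f :: "complex \<Rightarrow> complex \<Rightarrow> complex^'n \<Rightarrow> complex"
    and F :: "'n \<Rightarrow> complex \<Rightarrow> complex \<Rightarrow> complex^'n \<Rightarrow> complex"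
  assumes p1: "(a1, b1) \<noteq> (0, 0)"
    and p2: "(a2, b2) \<noteq> (0, 0)"
    and p1_p2: "cp1_point a1 b1 \<noteq> cp1_point a2 b2"
    and nondegenerate: "invertible T"
    and eigenvalues_distinct: "inj lam"
    and eigenvectors: "\<And>j. w j \<noteq> 0 \<and> T *v w j = lam j *s w j"
    and A: "A \<noteq> 0"
    and f: "f = form11 \<alpha> \<beta>"
    and f_glue: "\<And>t. f a1 b1 t - A * f a2 b2 (T *v t) = 0"
    and f_eigenvectors: "\<And>j. f a1 b1 (w j) \<noteq> 0"
    and F: "\<And>i. F i = form11 (\<alpha>'$i) (\<beta>'$i)"
    and F_glue: "\<And>i t. F i a1 b1 t - A * F i a2 b2 (T *v t) - c i * f a1 b1 t = 0"
    and independent: "\<And>d0 d. (\<forall>z1 z2 t. d0 * f z1 z2 t + (\<Sum>i\<in>UNIV. d i * F i z1 z2 t) = 0)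
                        \<Longrightarrow> d0 = 0 \<and> (\<forall>i. d i = 0)"
    and general_position: "\<And>k. card (cp1_roots (omit_det \<alpha> \<beta> \<alpha>' \<beta>' k)) = CARD('n)"
begin

lemma cross_nonzero: "a1 * b2 - b1 * a2 \<noteq> 0"
proof
  assume eq: "a1 * b2 - b1 * a2 = 0"
  obtain r where "r \<noteq> 0" "a2 = r * a1" "b2 = r * b1"
  proof (cases "a1 = 0")
    case True
    then have "b1 \<noteq> 0" "a2 = 0" using p1 eq by auto
    then show thesis using True p2 by (intro that[of "b2 / b1"]) auto
  next
    case False
    then have "b2 = b1 * a2 / a1" using eq by (simp add: field_simps)
    then show thesis using False p2 by (intro that[of "a2 / a1"]) auto
  qed
  then have "cp1_point a1 b1 = cp1_point a2 b2" using cp1_point_scale by metis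
  then show False using p1_p2 by simp
qed

text \<open>The coordinates of \<open>z\<close> in the basis \<open>p1 = (a1, b1)\<close>, \<open>p2 = (a2,
  b2)\<close>. A form of bidegree \<open>(1, 1)\<close> is determined by its restrictions to
  \<open>p1\<close> and \<open>p2\<close>.\<close>

definition s1 :: "complex \<Rightarrow> complex \<Rightarrow> complex" where
  "s1 z1 z2 = (z1 * b2 - z2 * a2) / (a1 * b2 - b1 * a2)"

definition s2 :: "complex \<Rightarrow> complex \<Rightarrow> complex" where
  "s2 z1 z2 = (a1 * z2 - b1 * z1) / (a1 * b2 - b1 * a2)"

lemma s_simps [simp]: "s1 a1 b1 = 1" "s2 a1 b1 = 0" "s1 a2 b2 = 0" "s2 a2 b2 = 1"
  using cross_nonzero by (simp_all add: s1_def s2_def mult.commute)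

lemma z_expand:
  "z1 = s1 z1 z2 * a1 + s2 z1 z2 * a2" "z2 = s1 z1 z2 * b1 + s2 z1 z2 * b2"
proof -
  have "s1 z1 z2 * a1 + s2 z1 z2 * a2 = (z1 * (a1 * b2 - b1 * a2)) / (a1 * b2 - b1 * a2)"
    unfolding s1_def s2_def times_divide_eq_left add_divide_distrib[symmetric] by (simp add: algebra_simps)
  then show "z1 = s1 z1 z2 * a1 + s2 z1 z2 * a2" using cross_nonzero by simp
  have "s1 z1 z2 * b1 + s2 z1 z2 * b2 = (z2 * (a1 * b2 - b1 * a2)) / (a1 * b2 - b1 * a2)"
    unfolding s1_def s2_def times_divide_eq_left add_divide_distrib[symmetric] by (simp add: algebra_simps)
  then show "z2 = s1 z1 z2 * b1 + s2 z1 z2 * b2" using cross_nonzero by simp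
qed

lemma form11_split:
  "form11 a b z1 z2 t = s1 z1 z2 * form11 a b a1 b1 t + s2 z1 z2 * form11 a b a2 b2 t"
  using form11_combination[of a b "s1 z1 z2" a1 "s2 z1 z2" a2 b1 b2 t] unfolding z_expand[symmetric] .

lemma f_split: "f z1 z2 t = s1 z1 z2 * f a1 b1 t + s2 z1 z2 * f a2 b2 t"
  unfolding f by (rule form11_split)

lemma F_split: "F i z1 z2 t = s1 z1 z2 * F i a1 b1 t + s2 z1 z2 * F i a2 b2 t"
  unfolding F by (rule form11_split)

lemma f_expand: "f z1 z2 t = (\<Sum>m\<in>UNIV. f z1 z2 (axis m 1) * t $ m)"
  unfolding f by (rule form11_expand)

lemma F_expand: "F i z1 z2 t = (\<Sum>m\<in>UNIV. F i z1 z2 (axis m 1) * t $ m)"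
  unfolding F by (rule form11_expand)

lemma T_surj: obtains t' where "t = T *v t'"
  using nondegenerate unfolding invertible_def
  by (metis matrix_vector_mul_assoc matrix_vector_mul_lid)

lemma T_eq_0_iff: "T *v t = 0 \<longleftrightarrow> t = 0"
  using nondegenerate unfolding invertible_def
  by (metis matrix_vector_mul_assoc matrix_vector_mul_lid matrix_vector_mult_0_right)

lemma f_p2: "A * f a2 b2 (T *v t) = f a1 b1 t" using f_glue[of t] by simp

definition form_comb :: "complex \<Rightarrow> ('n \<Rightarrow> complex) \<Rightarrow> complex \<Rightarrow> complex \<Rightarrow> complex^'n \<Rightarrow> complex" where
  "form_comb d0 d z1 z2 t = d0 * f z1 z2 t + (\<Sum>i\<in>UNIV. d i * F i z1 z2 t)"

lemma form_comb_split: "form_comb d0 d z1 z2 t = s1 z1 z2 * form_comb d0 d a1 b1 t + s2 z1 z2 * form_comb d0 d a2 b2 t"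
  unfolding form_comb_def f_split[of z1 z2 t] F_split[of _ z1 z2 t]
  by (simp add: algebra_simps sum.distrib sum_distrib_left)

text \<open>The combination \<open>d0 f + \<Sum> d_i F_i\<close> is encoded by its restriction to
  \<open>p1\<close> and by the jump \<open>\<Sum> d_i c_i\<close>; these two data give its
  restriction to \<open>p2\<close>.\<close>

lemma form_comb_p2: "A * form_comb d0 d a2 b2 (T *v t) = form_comb d0 d a1 b1 t - (\<Sum>i\<in>UNIV. d i * c i) * f a1 b1 t"
proof -
  have "A * F i a2 b2 (T *v t) = F i a1 b1 t - c i * f a1 b1 t" for i
    using F_glue[of i t] by (simp add: algebra_simps)
  then have "A * (d i * F i a2 b2 (T *v t)) = d i * F i a1 b1 t - d i * c i * f a1 b1 t" for i
    by (metis mult.assoc mult.left_commute right_diff_distrib)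
  moreover have "A * (d0 * f a2 b2 (T *v t)) = d0 * f a1 b1 t" using f_p2[of t] by (simp add: algebra_simps)
  ultimately show ?thesis
    unfolding form_comb_def by (simp add: ring_distribs sum_distrib_left sum_subtractf sum_distrib_right)
qed

lemma form_comb_zero:
  assumes "\<And>t. form_comb d0 d a1 b1 t = 0" "(\<Sum>i\<in>UNIV. d i * c i) = 0"
  shows "d0 = 0" "d i = 0"
proof -
  have "form_comb d0 d a2 b2 t = 0" for t
    using form_comb_p2[of d0 d] assms A by (metis T_surj diff_self mult_eq_0_iff)
  then have "form_comb d0 d z1 z2 t = 0" for z1 z2 t
    using form_comb_split[of d0 d z1 z2 t] assms by simp
  then show "d0 = 0" "d i = 0" using independent[of d0 d] unfolding form_comb_def by blast+
qed

lemma form_comb_expand: "form_comb d0 d z1 z2 t = (\<Sum>m\<in>UNIV. form_comb d0 d z1 z2 (axis m 1) * t $ m)"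
proof -
  have "form_comb d0 d z1 z2 t = d0 * (\<Sum>m\<in>UNIV. f z1 z2 (axis m 1) * t $ m)
      + (\<Sum>i\<in>UNIV. d i * (\<Sum>m\<in>UNIV. F i z1 z2 (axis m 1) * t $ m))"
    unfolding form_comb_def f_expand[symmetric] F_expand[symmetric] ..
  also have "\<dots> = (\<Sum>m\<in>UNIV. d0 * f z1 z2 (axis m 1) * t $ m)
      + (\<Sum>m\<in>UNIV. \<Sum>i\<in>UNIV. d i * F i z1 z2 (axis m 1) * t $ m)"
  proof -
    have "(\<Sum>i\<in>UNIV. d i * (\<Sum>m\<in>UNIV. F i z1 z2 (axis m 1) * t $ m))
      = (\<Sum>i\<in>UNIV. \<Sum>m\<in>UNIV. d i * F i z1 z2 (axis m 1) * t $ m)"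
      by (simp add: sum_distrib_left mult.assoc)
    also have "\<dots> = (\<Sum>m\<in>UNIV. \<Sum>i\<in>UNIV. d i * F i z1 z2 (axis m 1) * t $ m)"
      by (rule sum.swap)
    finally show ?thesis by (simp add: sum_distrib_left mult.assoc)
  qed
  finally show ?thesis
    unfolding form_comb_def by (simp add: sum.distrib sum_distrib_right ring_distribs)
qed

text \<open>Restriction to \<open>p1\<close> and jump range over a space of dimension \<open>n + 1\<close>,
  and \<open>f, F_1, \<dots>, F_n\<close> are \<open>n + 1\<close> independent forms, so every
  pair occurs. Index and coordinate \<open>None\<close> stand for \<open>f\<close> and for the
  jump.\<close>

lemma form_comb_surj:
  obtains d0 d where "\<And>t. form_comb d0 d a1 b1 t = (\<Sum>m\<in>UNIV. v $ m * t $ m)" "(\<Sum>i\<in>UNIV. d i * c i) = \<gamma>"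
proof -
  define B where "B i p = (case p of
      None \<Rightarrow> (case i of None \<Rightarrow> 0 | Some j \<Rightarrow> c j)
    | Some m \<Rightarrow> (case i of None \<Rightarrow> f a1 b1 (axis m 1) | Some j \<Rightarrow> F j a1 b1 (axis m 1)))" for i p :: "'n option"
  define H where "H p = (case p of None \<Rightarrow> \<gamma> | Some m \<Rightarrow> v $ m)" for p
  have so: "(\<Sum>x\<in>UNIV. g x) = g None + (\<Sum>i\<in>UNIV. g (Some i))" for g :: "'n option \<Rightarrow> complex"
    by (simp add: UNIV_option_conv sum.reindex)
  have form_comb_B: "(\<Sum>i\<in>UNIV. a i * B i (Some m)) = form_comb (a None) (\<lambda>i. a (Some i)) a1 b1 (axis m 1)" for a m
    unfolding so by (simp add: B_def form_comb_def)
  have c_B: "(\<Sum>i\<in>UNIV. a i * B i None) = (\<Sum>i\<in>UNIV. a (Some i) * c i)" for a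
    unfolding so by (simp add: B_def)
  have delta: "g p = (\<Sum>j\<in>UNIV. g j * (if j = p then 1 else 0))" for g :: "'n option \<Rightarrow> complex" and p
    by (simp add: if_distrib[of "\<lambda>a. g b * a" for b] cong: if_cong)
  have "\<exists>a. \<forall>p. H p = (\<Sum>i\<in>UNIV. a i * B i p)"
  proof (rule spanning_by_count[where J = "UNIV :: 'n option set" and C = "\<lambda>j p. if j = p then 1 else 0"])
    fix a assume *: "\<And>p. (\<Sum>i\<in>UNIV. a i * B i p) = 0"
    have "form_comb (a None) (\<lambda>i. a (Some i)) a1 b1 t = 0" for t
      by (subst form_comb_expand) (simp add: *[unfolded form_comb_B, of "Some _", simplified] form_comb_B[symmetric] *)
    moreover have "(\<Sum>i\<in>UNIV. a (Some i) * c i) = 0" using *[of None] unfolding c_B .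
    ultimately show "\<forall>i\<in>UNIV. a i = 0" using form_comb_zero[of "a None" "\<lambda>i. a (Some i)"]
      by (metis option.exhaust)
  qed (use delta in \<open>auto intro!: exI\<close>)
  then obtain a where a: "\<And>p. H p = (\<Sum>i\<in>UNIV. a i * B i p)" by blast
  show thesis
  proof (rule that[of "a None" "\<lambda>i. a (Some i)"])
    show "form_comb (a None) (\<lambda>i. a (Some i)) a1 b1 t = (\<Sum>m\<in>UNIV. v $ m * t $ m)" for t
      by (subst form_comb_expand) (simp add: form_comb_B[symmetric] a[symmetric] H_def)
    show "(\<Sum>i\<in>UNIV. a (Some i) * c i) = \<gamma>"
      using a[of None] unfolding c_B by (simp add: H_def)
  qed
qed

lemma linear_form_axis: "(\<And>t. (\<Sum>m\<in>UNIV. v $ m * t $ m) = 0) \<Longrightarrow> v = (0 :: complex^'n)"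
proof -
  assume "\<And>t. (\<Sum>m\<in>UNIV. v $ m * t $ m) = 0"
  from this[of "axis i 1" for i] show "v = 0" by (simp add: sum_axis vec_eq_iff)
qed

lemma w_independent:
  assumes "(\<Sum>j\<in>UNIV. a j *s w j) = 0"
  shows "a j = 0"
proof -
  have "(\<Sum>l\<in>range lam. a (inv lam l) *s w (inv lam l)) = 0"
    using assms eigenvalues_distinct by (simp add: sum.reindex)
  then have "a (inv lam (lam j)) = 0"
    by (rule eigenvectors_independent[of "range lam" T "\<lambda>l. w (inv lam l)", rotated 2])
       (use eigenvectors eigenvalues_distinct in auto)
  then show ?thesis using eigenvalues_distinct by simp
qed

text \<open>The eigenvalues are distinct, so an eigenvector is a multiple of one of the \<open>w j\<close>.\<close>

lemma f_eigenvector_nonzero: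
  assumes "T *v t = \<mu> *s t" "t \<noteq> 0"
  shows "f a1 b1 t \<noteq> 0"
proof -
  have "\<exists>a. \<forall>i. t $ i = (\<Sum>j\<in>UNIV. a j * w j $ i)"
  proof (rule spanning_by_count[where J = "UNIV :: 'n set" and C = "\<lambda>j i. axis j 1 $ i"])
    fix a assume "\<And>i. (\<Sum>j\<in>UNIV. a j * w j $ i) = 0"
    then have z: "(\<Sum>j\<in>UNIV. a j *s w j) = 0" by (simp add: vec_eq_iff)
    show "\<forall>j\<in>UNIV. a j = 0" using w_independent[OF z] by blast
  next
    fix j
    show "\<exists>m. \<forall>i. w j $ i = (\<Sum>l\<in>UNIV. m l * axis l 1 $ i)"
      by (rule exI[of _ "\<lambda>l. w j $ l"]) (simp add: sum_axis)
  next
    show "\<exists>m. \<forall>i. t $ i = (\<Sum>l\<in>UNIV. m l * axis l 1 $ i)"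
      by (rule exI[of _ "\<lambda>l. t $ l"]) (simp add: sum_axis)
  qed auto
  then obtain a where "\<And>i. t $ i = (\<Sum>j\<in>UNIV. a j * w j $ i)" by blast
  then have t: "t = (\<Sum>j\<in>UNIV. a j *s w j)" by (simp add: vec_eq_iff)
  have "T *v t = (\<Sum>j\<in>UNIV. (a j * lam j) *s w j)"
    unfolding t vec.linear_sum[OF matrix_vector_mul_linear_gen] vector_scalar_commute
    using eigenvectors by (simp add: vector_smult_assoc)
  moreover have "\<mu> *s t = (\<Sum>j\<in>UNIV. (a j * \<mu>) *s w j)"
    unfolding t vec.scale_sum_right by (simp add: vector_smult_assoc mult.commute)
  ultimately have z: "(\<Sum>j\<in>UNIV. (a j * (lam j - \<mu>)) *s w j) = 0"
    using assms(1) by (simp add: right_diff_distrib vec.scale_left_diff_distrib sum_subtractf)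
  have e: "a j * (lam j - \<mu>) = 0" for j by (rule w_independent[OF z])
  obtain j where j: "a j \<noteq> 0"
  proof (rule ccontr)
    assume "\<not> thesis"
    then have "\<And>j. a j = 0" using that by blast
    then show False using t assms(2) by simp
  qed
  have "a i = 0" if "i \<noteq> j" for i
  proof -
    have "lam i \<noteq> \<mu>" using e[of j] j that eigenvalues_distinct by (auto dest: injD)
    then show ?thesis using e[of i] by simp
  qed
  then have "t = (\<Sum>i\<in>UNIV. if i = j then a j *s w j else 0)" unfolding t by (intro sum.cong) auto
  then have "t = a j *s w j" by simp
  then show ?thesis using f_eigenvectors[of j] j unfolding f by (simp add: form11_scale)
qed

text \<open>At a common zero every pair (restriction to \<open>p1\<close>, jump) gives an equation. The jump
  alone gives \<open>s2 f(p1, t') = 0\<close> and the restrictions give \<open>s1 A t + s2 t' =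
  0\<close>, where \<open>t = T t'\<close>. So \<open>t'\<close> would be an eigenvector of
  \<open>T\<close> on which \<open>f(p1, -)\<close> vanishes.\<close>

lemma base_point_free:
  assumes z: "(z1, z2) \<noteq> (0, 0)" and t: "t \<noteq> 0"
    and f0: "f z1 z2 t = 0" and F0: "\<And>j. F j z1 z2 t = 0"
  shows False
proof -
  obtain t' where t': "t = T *v t'" by (rule T_surj)
  have comb0: "form_comb d0 d z1 z2 t = 0" for d0 d using f0 F0 by (simp add: form_comb_def)
  have rel: "s1 z1 z2 * A * (\<Sum>m\<in>UNIV. v $ m * t $ m) + s2 z1 z2 * (\<Sum>m\<in>UNIV. v $ m * t' $ m)
      - \<gamma> * (s2 z1 z2 * f a1 b1 t') = 0" for v \<gamma>
  proof -
    obtain d0 d where d: "\<And>t. form_comb d0 d a1 b1 t = (\<Sum>m\<in>UNIV. v $ m * t $ m)" "(\<Sum>i\<in>UNIV. d i * c i) = \<gamma>"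
      using form_comb_surj by metis
    have "0 = A * form_comb d0 d z1 z2 t" using comb0 by simp
    also have "\<dots> = s1 z1 z2 * A * form_comb d0 d a1 b1 t + s2 z1 z2 * (A * form_comb d0 d a2 b2 t)"
      by (subst form_comb_split) (simp add: algebra_simps)
    finally show ?thesis unfolding t' form_comb_p2 d by (simp add: algebra_simps)
  qed
  have 1: "s2 z1 z2 * f a1 b1 t' = 0" using rel[of 0 1] by simp
  have "(s1 z1 z2 * A) *s t + s2 z1 z2 *s t' = 0"
  proof (rule linear_form_axis)
    fix v
    have "(\<Sum>m\<in>UNIV. ((s1 z1 z2 * A) *s t + s2 z1 z2 *s t') $ m * v $ m)
       = s1 z1 z2 * A * (\<Sum>m\<in>UNIV. v $ m * t $ m) + s2 z1 z2 * (\<Sum>m\<in>UNIV. v $ m * t' $ m)"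
      by (simp add: sum_distrib_left sum.distrib algebra_simps)
    then show "(\<Sum>m\<in>UNIV. ((s1 z1 z2 * A) *s t + s2 z1 z2 *s t') $ m * v $ m) = 0" using rel[of v 0] by simp
  qed
  then have 2: "(s1 z1 z2 * A) *s (T *v t') = (- s2 z1 z2) *s t'"
    unfolding t' by (simp add: vec_eq_iff eq_neg_iff_add_eq_0)
  have t'0: "t' \<noteq> 0" using t t' T_eq_0_iff by blast
  show False
  proof (cases "s1 z1 z2 = 0")
    case True
    then have "s2 z1 z2 = 0" using 2 t'0 by (auto simp: vec_eq_iff)
    then show False using z z_expand(1)[of z1 z2] z_expand(2)[of z2 z1] True by simp
  next
    case False
    have "T *v t' = (- s2 z1 z2 / (s1 z1 z2 * A)) *s t'"
      using 2 False A by (simp add: vec_eq_iff field_simps)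
    then have "f a1 b1 t' \<noteq> 0" using f_eigenvector_nonzero t'0 by blast
    then have "s2 z1 z2 = 0" using 1 by simp
    then show False using 2 False A t'0 T_eq_0_iff by (auto simp: vec_eq_iff)
  qed
qed

text \<open>The glued forms of bidegree \<open>(1, 1)\<close>: their restriction to \<open>p2\<close> is the
  \<open>i\<close>-th coordinate, and the gluing condition then prescribes the restriction to
  \<open>p1\<close>.\<close>

definition \<phi> :: "complex \<Rightarrow> 'n \<Rightarrow> complex \<Rightarrow> complex \<Rightarrow> complex^'n \<Rightarrow> complex" where
  "\<phi> \<rho> i z1 z2 t = \<rho> * A * s1 z1 z2 * (T *v t) $ i + s2 z1 z2 * t $ i"

text \<open>Let a form that is glued with factor \<open>\<rho> \<noteq> 1\<close> also lie in the span of
  \<open>f\<close> and the \<open>F_j\<close>, with coefficient vector \<open>\<delta>\<close>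
  orthogonal to \<open>\<xi>\<close>. Its two restrictions are proportional to those of
  \<open>f\<close>, so up to a multiple of \<open>f\<close> it is a multiple of the combination
  \<open>d\<close> with restriction 0 and jump 1. Since \<open>d\<close> is not orthogonal to
  \<open>\<xi>\<close>, that multiple is zero.\<close>

lemma glued_combination_zero:
  assumes \<rho>: "\<rho> \<noteq> 1"
    and h: "\<And>z1 z2 t. (\<Sum>i\<in>UNIV. y i * \<phi> \<rho> i z1 z2 t) = form_comb \<delta>0 \<delta> z1 z2 t"
    and \<delta>: "(\<Sum>j\<in>UNIV. \<xi> j * \<delta> j) = 0"
    and d: "\<And>t. form_comb d0 d a1 b1 t = 0" "(\<Sum>i\<in>UNIV. d i * c i) = 1"
    and \<xi>: "(\<Sum>j\<in>UNIV. \<xi> j * d j) \<noteq> 0"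
  shows "y i = 0"
proof -
  define Y where "Y t = (\<Sum>i\<in>UNIV. y i * t $ i)" for t :: "complex^'n"
  define c' where "c' = (\<Sum>i\<in>UNIV. \<delta> i * c i)"
  have h1: "form_comb \<delta>0 \<delta> a1 b1 t = \<rho> * A * Y (T *v t)" and h2: "form_comb \<delta>0 \<delta> a2 b2 t = Y t" for t
    unfolding h[symmetric] by (simp_all add: \<phi>_def Y_def sum_distrib_left mult_ac)
  have e: "(\<rho> - 1) * (A * Y (T *v t)) = c' * f a1 b1 t" for t
    using form_comb_p2[of \<delta>0 \<delta> t] unfolding h1 h2 c'_def[symmetric] by (simp add: algebra_simps)
  then have e': "A * Y (T *v t) = c' / (\<rho> - 1) * f a1 b1 t" for t
    using \<rho> by (simp add: field_simps)
  have lin: "form_comb (\<delta>0 - \<rho> * (c' / (\<rho> - 1)) - c' * d0) (\<lambda>j. \<delta> j - c' * d j) a1 b1 t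
      = form_comb \<delta>0 \<delta> a1 b1 t - \<rho> * (c' / (\<rho> - 1) * f a1 b1 t) - c' * form_comb d0 d a1 b1 t" for t
    unfolding form_comb_def by (simp add: left_diff_distrib sum_subtractf ring_distribs sum_distrib_left mult_ac)
  have "form_comb (\<delta>0 - \<rho> * (c' / (\<rho> - 1)) - c' * d0) (\<lambda>j. \<delta> j - c' * d j) a1 b1 t = 0" for t
    unfolding lin d(1) h1 e'[symmetric] by simp
  moreover have "(\<Sum>j\<in>UNIV. (\<delta> j - c' * d j) * c j) = 0"
  proof -
    have "(\<Sum>j\<in>UNIV. (\<delta> j - c' * d j) * c j) = c' - c' * (\<Sum>j\<in>UNIV. d j * c j)"
      unfolding c'_def by (simp add: left_diff_distrib sum_subtractf sum_distrib_left mult.assoc)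
    then show ?thesis using d(2) by simp
  qed
  ultimately have "\<delta> j - c' * d j = 0" for j by (rule form_comb_zero(2))
  then have "(\<Sum>j\<in>UNIV. \<xi> j * \<delta> j) = c' * (\<Sum>j\<in>UNIV. \<xi> j * d j)"
    by (simp add: sum_distrib_left mult_ac)
  then have "c' = 0" using \<delta> \<xi> by simp
  then have "Y (T *v t) = 0" for t using e'[of t] A by simp
  then have "Y t = 0" for t using T_surj by metis
  then have "Y (axis i 1) = 0" by blast
  then show ?thesis by (simp add: Y_def sum_axis)
qed

section \<open>The pencil cut out by a direction\<close>

text \<open>The rows are the coefficient vectors of \<open>f\<close> and of \<open>\<xi>_k F_j - \<xi>_j
  F_k\<close>. A kernel vector \<open>t\<close> at \<open>z\<close> is a point of the divisor
  \<open>f = 0\<close> where \<open>(F_1, \<dots>, F_n)\<close> is proportional to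
  \<open>\<xi>\<close>; for the \<open>k\<close>-th coordinate vector \<open>\<xi>\<close> this is
  the matrix of the general position hypothesis.\<close>

definition pencil :: "'n \<Rightarrow> ('n \<Rightarrow> complex) \<Rightarrow> complex \<Rightarrow> complex \<Rightarrow> complex^'n^'n" where
  "pencil k \<xi> z1 z2 = (\<chi> j m. if j = k then \<alpha>$m * z1 + \<beta>$m * z2
     else \<xi> k * (\<alpha>'$j$m * z1 + \<beta>'$j$m * z2) - \<xi> j * (\<alpha>'$k$m * z1 + \<beta>'$k$m * z2))"

lemma pencil_mult: "(pencil k \<xi> z1 z2 *v t) $ j = (if j = k then f z1 z2 t else \<xi> k * F j z1 z2 t - \<xi> j * F k z1 z2 t)"
  by (simp add: pencil_def matrix_vector_mult_def f F form11_def sum_distrib_left sum_subtractf[symmetric] algebra_simps)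

lemma pencil_combination:
  "(pencil k \<xi> (x * z1 + y * z1') (x * z2 + y * z2') *v t) = x *s (pencil k \<xi> z1 z2 *v t) + y *s (pencil k \<xi> z1' z2' *v t)"
  by (simp add: vec_eq_iff pencil_mult f F form11_combination algebra_simps)

lemma pencil_matrix_sum:
  "(\<chi> i j. pencil k \<xi> y1 y2 $ i $ j + l * pencil k \<xi> q1 q2 $ i $ j) = pencil k \<xi> (y1 + l * q1) (y2 + l * q2)"
  by (simp add: pencil_def vec_eq_iff algebra_simps)

lemma \<phi>_combination:
  "\<phi> \<rho> i (x * z1 + y * z1') (x * z2 + y * z2') t = x * \<phi> \<rho> i z1 z2 t + y * \<phi> \<rho> i z1' z2' t"
proof -
  have "s1 (x * z1 + y * z1') (x * z2 + y * z2') = x * s1 z1 z2 + y * s1 z1' z2'"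
    "s2 (x * z1 + y * z1') (x * z2 + y * z2') = x * s2 z1 z2 + y * s2 z1' z2'"
    unfolding s1_def s2_def times_divide_eq_right add_divide_distrib[symmetric] by (simp_all add: algebra_simps)
  then show ?thesis by (simp add: \<phi>_def algebra_simps)
qed

lemma \<phi>_expand: "\<phi> \<rho> i z1 z2 t = (\<Sum>m\<in>UNIV. \<phi> \<rho> i z1 z2 (axis m 1) * t $ m)"
proof -
  have "(T *v t) $ i = (\<Sum>m\<in>UNIV. (T *v axis m 1) $ i * t $ m)"
    by (simp add: matrix_vector_mult_def sum_axis)
  moreover have "t $ i = (\<Sum>m\<in>UNIV. axis m 1 $ i * t $ m)"
    using sum_axis(2)[of "\<lambda>m. t $ m" i] by (simp add: mult.commute)
  ultimately show ?thesis
    unfolding \<phi>_def by (simp add: ring_distribs sum.distrib sum_distrib_left mult_ac)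
qed

text \<open>If the pencil has \<open>n\<close> distinct roots, their kernel vectors are eigenvectors of one
  matrix and form a basis. Therefore a bilinear form that vanishes at the \<open>n\<close> pairs
  (root, kernel vector) lies in the row space of the pencil, and
  \<open>glued_combination_zero\<close> applies.\<close>

lemma pencil_combination_zero:
  assumes \<rho>: "\<rho> \<noteq> 1"
    and d: "\<And>t. form_comb d0 d a1 b1 t = 0" "(\<Sum>i\<in>UNIV. d i * c i) = 1"
    and \<xi>: "(\<Sum>j\<in>UNIV. \<xi> j * d j) \<noteq> 0"
    and q: "y1 * q2 - y2 * q1 \<noteq> 0"
    and detq: "det (pencil k \<xi> q1 q2) \<noteq> 0"
    and R: "card R = CARD('n)" "\<And>l. l \<in> R \<Longrightarrow> det (pencil k \<xi> (y1 + l * q1) (y2 + l * q2)) = 0"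
    and van: "\<And>z1 z2 t. (z1, z2) \<noteq> (0, 0) \<Longrightarrow> t \<noteq> 0 \<Longrightarrow> f z1 z2 t = 0 \<Longrightarrow>
       (\<And>j. \<xi> k * F j z1 z2 t = \<xi> j * F k z1 z2 t) \<Longrightarrow> (\<Sum>i\<in>UNIV. y i * \<phi> \<rho> i z1 z2 t) = 0"
  shows "y i = 0"
proof -
  define h where "h z1 z2 t = (\<Sum>i\<in>UNIV. y i * \<phi> \<rho> i z1 z2 t)" for z1 z2 t
  have h_comb: "h (x * z1 + x' * z1') (x * z2 + x' * z2') t = x * h z1 z2 t + x' * h z1' z2' t" for x z1 x' z1' z2 z2' t
    unfolding h_def \<phi>_combination by (simp add: sum.distrib sum_distrib_left algebra_simps)
  have h_expand: "h z1 z2 t = (\<Sum>m\<in>UNIV. h z1 z2 (axis m 1) * t $ m)" for z1 z2 t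
  proof -
    have "h z1 z2 t = (\<Sum>i\<in>UNIV. \<Sum>m\<in>UNIV. y i * \<phi> \<rho> i z1 z2 (axis m 1) * t $ m)"
      unfolding h_def by (subst \<phi>_expand) (simp add: sum_distrib_left mult.assoc)
    also have "\<dots> = (\<Sum>m\<in>UNIV. h z1 z2 (axis m 1) * t $ m)"
      unfolding h_def by (subst sum.swap) (simp add: sum_distrib_right)
    finally show ?thesis .
  qed
  define C where "C = pencil k \<xi> q1 q2"
  have "invertible C" using detq unfolding C_def invertible_det_nz .
  then obtain C' where C': "C ** C' = mat 1" "C' ** C = mat 1" unfolding invertible_def by blast
  have "\<forall>l\<in>R. \<exists>t. t \<noteq> 0 \<and> pencil k \<xi> (y1 + l * q1) (y2 + l * q2) *v t = 0"
    using R(2) det_eq_0_iff_kernel by blast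
  then obtain t where t: "\<And>l. l \<in> R \<Longrightarrow> t l \<noteq> 0"
    "\<And>l. l \<in> R \<Longrightarrow> pencil k \<xi> (y1 + l * q1) (y2 + l * q2) *v t l = 0" by metis
  have Bt: "pencil k \<xi> y1 y2 *v t l = (- l) *s (C *v t l)" if "l \<in> R" for l
  proof -
    have "pencil k \<xi> y1 y2 *v t l + l *s (C *v t l) = 0"
      using pencil_combination[of k \<xi> 1 y1 l q1 y2 q2 "t l"] t(2)[OF that] unfolding C_def by simp
    then show ?thesis by (simp add: vec_eq_iff eq_neg_iff_add_eq_0)
  qed
  \<comment> \<open>The signs make the roots \<open>l\<close>, not \<open>- l\<close>, the eigenvalues of \<open>N\<close>.\<close>
  define N where "N = C' ** pencil k \<xi> (- y1) (- y2)"
  have N: "N *v t l = l *s t l" if "l \<in> R" for l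
  proof -
    have "pencil k \<xi> (- y1) (- y2) *v t l = l *s (C *v t l)"
      using pencil_combination[of k \<xi> "-1" y1 0 0 y2 0 "t l"] Bt[OF that] by (simp add: vec_eq_iff)
    then have "N *v t l = C' *v (l *s (C *v t l))"
      unfolding N_def by (simp add: matrix_vector_mul_assoc[symmetric])
    also have "\<dots> = l *s t l"
      using C' by (simp add: vector_scalar_commute matrix_vector_mul_assoc)
    finally show ?thesis .
  qed
  \<comment> \<open>The row vector that represents \<open>h\<close> at \<open>q\<close>; agreement on the kernel vectors extends this to all \<open>z\<close>.\<close>
  define \<eta> where "\<eta> j = h q1 q2 (C' *v axis j 1)" for j
  have hq: "h q1 q2 x = (\<Sum>j\<in>UNIV. \<eta> j * (C *v x) $ j)" for x
  proof -
    have "(\<Sum>j\<in>UNIV. \<eta> j * v $ j) = h q1 q2 (C' *v v)" for v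
    proof -
      have "(\<Sum>j\<in>UNIV. \<eta> j * v $ j) = (\<Sum>j\<in>UNIV. \<Sum>m\<in>UNIV. h q1 q2 (axis m 1) * (C' $ m $ j * v $ j))"
        unfolding \<eta>_def by (subst h_expand)
          (simp add: matrix_vector_mult_def sum_axis sum_distrib_right mult.assoc)
      also have "\<dots> = (\<Sum>m\<in>UNIV. h q1 q2 (axis m 1) * (C' *v v) $ m)"
        by (subst sum.swap) (simp add: matrix_vector_mult_def sum_distrib_left)
      finally show ?thesis using h_expand[of q1 q2 "C' *v v"] by simp
    qed
    from this[of "C *v x"] show ?thesis using C' by (simp add: matrix_vector_mul_assoc)
  qed
  define g where "g = (\<chi> m. h y1 y2 (axis m 1) - (\<Sum>j\<in>UNIV. \<eta> j * pencil k \<xi> y1 y2 $ j $ m))"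
  have g: "(\<Sum>m\<in>UNIV. g $ m * x $ m) = h y1 y2 x - (\<Sum>j\<in>UNIV. \<eta> j * (pencil k \<xi> y1 y2 *v x) $ j)" for x
  proof -
    have "(\<Sum>m\<in>UNIV. \<Sum>j\<in>UNIV. \<eta> j * (pencil k \<xi> y1 y2 $ j $ m * x $ m)) = (\<Sum>j\<in>UNIV. \<eta> j * (pencil k \<xi> y1 y2 *v x) $ j)"
      by (subst sum.swap) (simp add: matrix_vector_mult_def sum_distrib_left)
    then show ?thesis
      unfolding g_def using h_expand[of y1 y2 x]
      by (simp add: left_diff_distrib sum_subtractf sum_distrib_right mult.assoc)
  qed
  have "g = 0"
  proof (rule linear_form_zero_on_eigenvectors[OF R(1), of N t])
    show "N *v t l = l *s t l \<and> t l \<noteq> 0" if "l \<in> R" for l using N t that by blast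
    fix l assume l: "l \<in> R"
    have z: "(y1 + l * q1, y2 + l * q2) \<noteq> (0, 0)"
    proof
      assume "(y1 + l * q1, y2 + l * q2) = (0, 0)"
      then have "y1 = - l * q1" "y2 = - l * q2" by (simp_all add: eq_neg_iff_add_eq_0)
      then show False using q by simp
    qed
    have "f (y1 + l * q1) (y2 + l * q2) (t l) = 0"
      using arg_cong[OF t(2)[OF l], of "\<lambda>v. v $ k"] by (simp add: pencil_mult)
    moreover have "\<xi> k * F j (y1 + l * q1) (y2 + l * q2) (t l) = \<xi> j * F k (y1 + l * q1) (y2 + l * q2) (t l)" for j
      using arg_cong[OF t(2)[OF l], of "\<lambda>v. v $ j"] by (cases "j = k") (auto simp: pencil_mult)
    ultimately have "h (y1 + l * q1) (y2 + l * q2) (t l) = 0"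
      unfolding h_def by (intro van[OF z t(1)[OF l]])
    then have "h y1 y2 (t l) = - l * h q1 q2 (t l)"
      using h_comb[of 1 y1 l q1 y2 q2 "t l"] by (simp add: eq_neg_iff_add_eq_0)
    also have "\<dots> = (\<Sum>j\<in>UNIV. \<eta> j * (pencil k \<xi> y1 y2 *v t l) $ j)"
      unfolding hq Bt[OF l] by (simp add: sum_distrib_left sum_negf mult_ac)
    finally show "(\<Sum>m\<in>UNIV. g $ m * t l $ m) = 0" unfolding g by simp
  qed
  then have hy: "h y1 y2 x = (\<Sum>j\<in>UNIV. \<eta> j * (pencil k \<xi> y1 y2 *v x) $ j)" for x
    using g[of x] by simp
  have hM: "h z1 z2 x = (\<Sum>j\<in>UNIV. \<eta> j * (pencil k \<xi> z1 z2 *v x) $ j)" for z1 z2 x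
  proof -
    obtain u v where uv: "z1 = u * y1 + v * q1" "z2 = u * y2 + v * q2"
      using plane_coordinates[OF q, of z1 z2] by (elim exE conjE) (rule that)
    show ?thesis
      unfolding uv h_comb pencil_combination hy hq C_def
      by (simp add: sum.distrib sum_distrib_left ring_distribs mult_ac)
  qed
  \<comment> \<open>A combination of the rows, rewritten in terms of \<open>f\<close> and the \<open>F_j\<close>.\<close>
  define \<delta> where "\<delta> j = (if j = k then - (\<Sum>i\<in>UNIV - {k}. \<eta> i * \<xi> i) else \<eta> j * \<xi> k)" for j
  have rem: "(\<Sum>j\<in>UNIV. G j) = G k + (\<Sum>j\<in>UNIV - {k}. G j)" for G :: "'n \<Rightarrow> complex"
    by (simp add: sum.remove)
  have hcomb: "(\<Sum>i\<in>UNIV. y i * \<phi> \<rho> i z1 z2 x) = form_comb (\<eta> k) \<delta> z1 z2 x" for z1 z2 x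
  proof -
    have "h z1 z2 x = \<eta> k * f z1 z2 x + (\<Sum>j\<in>UNIV - {k}. \<eta> j * (\<xi> k * F j z1 z2 x - \<xi> j * F k z1 z2 x))"
      unfolding hM by (subst rem) (simp add: pencil_mult)
    also have "\<dots> = form_comb (\<eta> k) \<delta> z1 z2 x"
      unfolding form_comb_def by (subst rem[of "\<lambda>i. \<delta> i * F i z1 z2 x"])
        (simp add: \<delta>_def right_diff_distrib sum_subtractf sum_distrib_left sum_distrib_right mult_ac)
    finally show ?thesis unfolding h_def .
  qed
  have \<delta>0: "(\<Sum>j\<in>UNIV. \<xi> j * \<delta> j) = 0"
    by (subst rem) (simp add: \<delta>_def sum_distrib_left mult_ac)
  show ?thesis by (rule glued_combination_zero[OF \<rho> hcomb \<delta>0 d \<xi>])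
qed

lemma pencil_axis: "det (pencil k (\<lambda>j. axis k 1 $ j) z1 z2) = omit_det \<alpha> \<beta> \<alpha>' \<beta>' k z1 z2"
  unfolding omit_det_def pencil_def
  by (intro arg_cong[of _ _ det]) (auto simp: vec_eq_iff axis_def)

text \<open>The general position hypothesis in an affine chart of \<open>CP^1\<close>: the point
  \<open>q\<close> at infinity is chosen outside the roots, and \<open>l\<close> stands for the
  point \<open>y + l q\<close>.\<close>

lemma distinct_roots:
  obtains y1 y2 q1 q2 R where "y1 * q2 - y2 * q1 \<noteq> 0" "omit_det \<alpha> \<beta> \<alpha>' \<beta>' k q1 q2 \<noteq> 0"
    "card R = CARD('n)" "\<And>l. l \<in> R \<Longrightarrow> omit_det \<alpha> \<beta> \<alpha>' \<beta>' k (y1 + l * q1) (y2 + l * q2) = 0"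
proof -
  let ?G = "omit_det \<alpha> \<beta> \<alpha>' \<beta>' k" and ?pencil = "pencil k (\<lambda>j. axis k 1 $ j)"
  have scale: "?G (r * z1) (r * z2) = 0 \<longleftrightarrow> ?G z1 z2 = 0" if "r \<noteq> 0" for r z1 z2
  proof -
    have "?pencil (r * z1) (r * z2) *v t = r *s (?pencil z1 z2 *v t)" for t
      using pencil_combination[of k "\<lambda>j. axis k 1 $ j" r z1 0 0 z2 0 t] by simp
    then show ?thesis
      unfolding pencil_axis[symmetric] det_eq_0_iff_kernel using that by (simp add: vec_eq_iff)
  qed
  have fin: "finite (cp1_roots ?G)"
    by (rule card_ge_0_finite, unfold general_position, rule zero_less_card_finite)
  obtain q1 q2 where q: "?G q1 q2 \<noteq> 0" "(q1, q2) \<noteq> (0, 0)"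
  proof (rule ccontr)
    note found = that
    assume "\<not> thesis"
    then have zero: "?G z1 z2 = 0" if nz: "(z1, z2) \<noteq> (0, 0)" for z1 z2
      using found[OF _ nz] by blast
    have "cp1_point 1 l \<in> cp1_roots ?G" for l
      using zero[of 1 l] unfolding cp1_roots_def by (intro CollectI exI[of _ 1] exI[of _ l]) simp
    then have "range (\<lambda>l. cp1_point 1 l) \<subseteq> cp1_roots ?G" by blast
    moreover have "inj (\<lambda>l. cp1_point 1 l)"
    proof (rule injI)
      fix l l' :: complex assume "cp1_point 1 l = cp1_point 1 l'"
      then obtain r where "1 = r * 1" "l = r * l'" by (rule cp1_point_cross)
      then show "l = l'" by simp
    qed
    ultimately have "finite (UNIV :: complex set)" using fin by (meson finite_imageD finite_subset)
    then show False using infinite_UNIV_char_0 by blast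
  qed
  obtain y1 y2 where y: "y1 * q2 - y2 * q1 \<noteq> 0"
  proof (cases "q2 = 0")
    case True
    then show thesis using q(2) by (intro that[of 0 1]) auto
  next
    case False
    then show thesis by (intro that[of 1 0]) auto
  qed
  define R where "R = {l. ?G (y1 + l * q1) (y2 + l * q2) = 0}"
  have ne: "(y1 + l * q1, y2 + l * q2) \<noteq> (0, 0)" for l
  proof
    assume "(y1 + l * q1, y2 + l * q2) = (0, 0)"
    then have "y1 = - l * q1" "y2 = - l * q2" by (simp_all add: eq_neg_iff_add_eq_0)
    then show False using y by simp
  qed
  have "bij_betw (\<lambda>l. cp1_point (y1 + l * q1) (y2 + l * q2)) R (cp1_roots ?G)"
  proof (rule bij_betw_imageI)
    show "inj_on (\<lambda>l. cp1_point (y1 + l * q1) (y2 + l * q2)) R"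
    proof (rule inj_onI)
      fix l l' assume "cp1_point (y1 + l * q1) (y2 + l * q2) = cp1_point (y1 + l' * q1) (y2 + l' * q2)"
      then obtain r where r: "y1 + l * q1 = r * (y1 + l' * q1)" "y2 + l * q2 = r * (y2 + l' * q2)"
        by (rule cp1_point_cross)
      have "(y1 + l * q1) * q2 - (y2 + l * q2) * q1 = y1 * q2 - y2 * q1"
        "(y1 + l' * q1) * q2 - (y2 + l' * q2) * q1 = y1 * q2 - y2 * q1" by (simp_all add: algebra_simps)
      then have "y1 * q2 - y2 * q1 = r * (y1 * q2 - y2 * q1)"
        unfolding r by (metis mult.assoc right_diff_distrib)
      then have "r = 1" using y by simp
      then have "(l - l') * q1 = 0" "(l - l') * q2 = 0" using r by (simp_all add: left_diff_distrib)
      then show "l = l'" using q(2) by auto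
    qed
    show "(\<lambda>l. cp1_point (y1 + l * q1) (y2 + l * q2)) ` R = cp1_roots ?G"
    proof
      show "(\<lambda>l. cp1_point (y1 + l * q1) (y2 + l * q2)) ` R \<subseteq> cp1_roots ?G"
        using ne unfolding cp1_roots_def R_def by blast
      show "cp1_roots ?G \<subseteq> (\<lambda>l. cp1_point (y1 + l * q1) (y2 + l * q2)) ` R"
      proof
        fix P assume "P \<in> cp1_roots ?G"
        then obtain z1 z2 where z: "P = cp1_point z1 z2" "(z1, z2) \<noteq> (0, 0)" "?G z1 z2 = 0"
          unfolding cp1_roots_def by blast
        obtain u v where uv: "z1 = u * y1 + v * q1" "z2 = u * y2 + v * q2"
          using plane_coordinates[OF y, of z1 z2] by (elim exE conjE) (rule that)
        have u: "u \<noteq> 0"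
        proof
          assume u0: "u = 0"
          then have "v \<noteq> 0" using uv z(2) by auto
          then show False using scale[of v q1 q2] z(3) q(1) uv u0 by simp
        qed
        have "z1 = u * (y1 + (v / u) * q1)" "z2 = u * (y2 + (v / u) * q2)"
          using u uv by (simp_all add: field_simps)
        then have "P = cp1_point (y1 + (v / u) * q1) (y2 + (v / u) * q2)" "v / u \<in> R"
          using z u cp1_point_scale[OF u] scale[OF u] unfolding R_def by auto
        then show "P \<in> (\<lambda>l. cp1_point (y1 + l * q1) (y2 + l * q2)) ` R" by blast
      qed
    qed
  qed
  then have "card R = CARD('n)" using general_position[of k] by (metis bij_betw_same_card)
  then show thesis using that[OF y q(1)] unfolding R_def by blast
qed

end

context glued_pencil
begin

section \<open>Independence of the derivatives of the generators\<close>

text \<open>The complement of the divisor \<open>f = 0\<close> is dense: on the line through \<open>(z,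
  t)\<close> in the direction of \<open>(p1, w j)\<close> the form \<open>f\<close> is a
  polynomial with nonzero leading coefficient.\<close>

lemma f_dense:
  assumes cont: "continuous_on UNIV (\<lambda>(z1, z2, t). G z1 z2 t :: complex)"
    and zero: "\<And>z1 z2 t. f z1 z2 t \<noteq> 0 \<Longrightarrow> G z1 z2 t = 0"
  shows "G z1 z2 t = 0"
proof -
  fix j :: 'n
  let ?P = "\<lambda>s. (z1 + s * a1, z2 + s * b1, t + s *s w j)"
  define p where "p = [:f z1 z2 t, f z1 z2 (w j) + f a1 b1 t, f a1 b1 (w j):]"
  have p: "f (z1 + s * a1) (z2 + s * b1) (t + s *s w j) = poly p s" for s
  proof -
    have "f (z1 + s * a1) (z2 + s * b1) x = f z1 z2 x + s * f a1 b1 x" for x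
      using form11_combination[of \<alpha> \<beta> 1 z1 s a1 z2 b1 x] by (simp add: f)
    moreover have "f y1 y2 (t + s *s w j) = f y1 y2 t + s * f y1 y2 (w j)" for y1 y2
      unfolding f form11_add form11_scale ..
    ultimately show ?thesis by (simp add: p_def algebra_simps)
  qed
  have "p \<noteq> 0" using f_eigenvectors[of j] by (simp add: p_def)
  then have "finite {s. poly p s = 0}" by (rule poly_roots_finite)
  then have "\<not> 0 islimpt {s. poly p s = 0}" by (rule islimpt_finite)
  then have "\<forall>\<^sub>F s in at 0. s \<notin> {s. poly p s = 0}" by (simp only: islimpt_iff_eventually not_not)
  then have ev: "\<forall>\<^sub>F s in at 0. (case ?P s of (z1, z2, t) \<Rightarrow> G z1 z2 t) = 0"
  proof eventually_elim
    case (elim s)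
    then have "poly p s \<noteq> 0" by (rule contrapos_nn) (rule CollectI)
    then have "f (z1 + s * a1) (z2 + s * b1) (t + s *s w j) \<noteq> 0" by (simp only: p not_False_eq_True)
    from zero[OF this] show ?case by (simp only: prod.case)
  qed
  have "((\<lambda>s. ?P s) \<longlongrightarrow> ?P 0) (at 0)"
  proof (intro tendsto_Pair)
    show "((\<lambda>s. z1 + s * a1) \<longlongrightarrow> z1 + 0 * a1) (at 0)" "((\<lambda>s. z2 + s * b1) \<longlongrightarrow> z2 + 0 * b1) (at 0)"
      by (intro tendsto_add tendsto_mult tendsto_const tendsto_ident_at)+
    show "((\<lambda>s. t + s *s w j) \<longlongrightarrow> t + 0 *s w j) (at 0)"
      by (rule vec_tendstoI, unfold vector_add_component vector_smult_component)
         (intro tendsto_add tendsto_mult tendsto_const tendsto_ident_at)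
  qed
  moreover have "isCont (\<lambda>(z1, z2, t). G z1 z2 t) (?P 0)"
    using cont by (simp add: continuous_on_eq_continuous_at)
  ultimately have lim: "((\<lambda>s. case ?P s of (z1, z2, t) \<Rightarrow> G z1 z2 t) \<longlongrightarrow> (case ?P 0 of (z1, z2, t) \<Rightarrow> G z1 z2 t)) (at 0)"
    by (rule isCont_tendsto_compose[rotated])
  have "((\<lambda>s. 0) \<longlongrightarrow> (case ?P 0 of (z1, z2, t) \<Rightarrow> G z1 z2 t)) (at (0::complex))"
    by (rule Lim_transform_eventually[OF lim ev])
  then show ?thesis by (simp add: tendsto_const_iff)
qed

text \<open>The heart of independence. For \<open>\<xi>\<close> near a coordinate vector the values
  \<open>P_i(\<xi>)\<close> are the coefficients of a combination of the \<open>\<phi> i\<close>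
  that vanishes at the \<open>n\<close> points of the pencil, so they are zero.\<close>

lemma top_coefficients_zero:
  assumes \<rho>: "\<rho> \<noteq> 1"
    and van: "\<And>z1 z2 t. f z1 z2 t = 0 \<Longrightarrow>
      (\<Sum>i\<in>UNIV. \<Sum>\<gamma> | mdeg \<gamma> = m. a i \<gamma> * (monomial (\<lambda>j. F j z1 z2 t) \<gamma> * \<phi> \<rho> i z1 z2 t)) = 0"
    and \<gamma>: "mdeg \<gamma> = m"
  shows "a i \<gamma> = 0"
proof -
  let ?S = "{\<gamma> :: 'n \<Rightarrow> nat. mdeg \<gamma> = m}"
  \<comment> \<open>The combination with restriction 0 and jump 1; a coordinate \<open>k\<close> with \<open>d k \<noteq> 0\<close> selects the pencil.\<close>
  obtain d0 d where d: "\<And>t. form_comb d0 d a1 b1 t = (\<Sum>m\<in>UNIV. (0 :: complex^'n) $ m * t $ m)"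
    "(\<Sum>i\<in>UNIV. d i * c i) = 1" using form_comb_surj by metis
  have d1: "form_comb d0 d a1 b1 t = 0" for t using d(1) by simp
  obtain k where k: "d k \<noteq> 0"
  proof (rule ccontr)
    assume "\<not> thesis"
    then have "\<And>k. d k = 0" using that by blast
    then show False using d(2) by simp
  qed
  obtain y1 y2 q1 q2 R where q: "y1 * q2 - y2 * q1 \<noteq> 0" "omit_det \<alpha> \<beta> \<alpha>' \<beta>' k q1 q2 \<noteq> 0"
    "card R = CARD('n)" "\<And>l. l \<in> R \<Longrightarrow> omit_det \<alpha> \<beta> \<alpha>' \<beta>' k (y1 + l * q1) (y2 + l * q2) = 0"
    using distinct_roots by metis
  show ?thesis
  proof (rule polynomial_zero_if_zero_near[where x = "\<lambda>j. axis k 1 $ j" and S = ?S])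
    show "finite ?S" by (rule finite_multidegree_eq)
    show "\<gamma> \<in> ?S" using \<gamma> by simp
    fix \<eta> :: "'n \<Rightarrow> complex"
    define \<xi> where "\<xi> s j = axis k 1 $ j + s * \<eta> j" for s j
    have lim: "((\<lambda>s. \<xi> s j) \<longlongrightarrow> axis k 1 $ j) (at 0)" for j
      unfolding \<xi>_def by (auto intro!: tendsto_eq_intros)
    have ev1: "\<forall>\<^sub>F s in at 0. \<xi> s k \<noteq> 0"
      by (rule tendsto_imp_eventually_ne[OF lim]) (simp add: axis_def)
    have "((\<lambda>s. \<Sum>j\<in>UNIV. \<xi> s j * d j) \<longlongrightarrow> (\<Sum>j\<in>UNIV. axis k 1 $ j * d j)) (at 0)"
      by (intro tendsto_intros lim)
    moreover have "(\<Sum>j\<in>UNIV. axis k 1 $ j * d j) \<noteq> 0"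
      using k sum_axis(1)[of d k] by (simp add: mult.commute)
    ultimately have ev2: "\<forall>\<^sub>F s in at 0. (\<Sum>j\<in>UNIV. \<xi> s j * d j) \<noteq> 0"
      by (rule tendsto_imp_eventually_ne)
    have limM: "((\<lambda>s. pencil k (\<xi> s) z1 z2 $ i $ j) \<longlongrightarrow> pencil k (\<lambda>j. axis k 1 $ j) z1 z2 $ i $ j) (at 0)" for z1 z2 i j
    proof (cases "i = k")
      case False
      have "((\<lambda>s. \<xi> s k * (\<alpha>' $ i $ j * z1 + \<beta>' $ i $ j * z2) - \<xi> s i * (\<alpha>' $ k $ j * z1 + \<beta>' $ k $ j * z2))
        \<longlongrightarrow> axis k 1 $ k * (\<alpha>' $ i $ j * z1 + \<beta>' $ i $ j * z2) - axis k 1 $ i * (\<alpha>' $ k $ j * z1 + \<beta>' $ k $ j * z2)) (at 0)"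
        by (intro tendsto_diff tendsto_mult lim tendsto_const)
      then show ?thesis unfolding pencil_def by (simp only: vec_lambda_beta False if_False)
    qed (simp add: pencil_def)
    have ev3: "\<forall>\<^sub>F s in at 0. det (pencil k (\<xi> s) q1 q2) \<noteq> 0 \<and> (\<exists>R'. card R' = CARD('n) \<and>
        (\<forall>l\<in>R'. det (\<chi> i j. pencil k (\<xi> s) y1 y2 $ i $ j + l * pencil k (\<xi> s) q1 q2 $ i $ j) = 0))"
      by (rule pencil_roots_persist[OF limM limM _ q(3)])
         (use q(2,4) in \<open>auto simp: pencil_matrix_sum pencil_axis\<close>)
    from ev1 ev2 ev3 show "\<forall>\<^sub>F s in at 0. (\<Sum>\<gamma>\<in>?S. a i \<gamma> * monomial (\<lambda>j. axis k 1 $ j + s * \<eta> j) \<gamma>) = 0"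
    proof eventually_elim
      case (elim s)
      obtain R' where R': "card R' = CARD('n)"
        "\<And>l. l \<in> R' \<Longrightarrow> det (pencil k (\<xi> s) (y1 + l * q1) (y2 + l * q2)) = 0"
        using elim(3) by (auto simp: pencil_matrix_sum)
      define y where "y i = (\<Sum>\<gamma>\<in>?S. a i \<gamma> * monomial (\<xi> s) \<gamma>)" for i
      have "y i = 0"
      proof (rule pencil_combination_zero[OF \<rho> d1 d(2) elim(2) q(1) _ R'])
        show "det (pencil k (\<xi> s) q1 q2) \<noteq> 0" using elim(3) by blast
        fix z1 z2 t assume z: "(z1, z2) \<noteq> (0, 0)" and t: "t \<noteq> 0" and f0: "f z1 z2 t = 0"
          and par: "\<And>j. \<xi> s k * F j z1 z2 t = \<xi> s j * F k z1 z2 t"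
        \<comment> \<open>At the point, \<open>F_j = r \<xi>_j\<close>, so a homogeneous polynomial in the \<open>F_j\<close> is \<open>r ^ m\<close> times its value at \<open>\<xi>\<close>.\<close>
        define r where "r = F k z1 z2 t / \<xi> s k"
        have Fr: "F j z1 z2 t = r * \<xi> s j" for j
          using par[of j] elim(1) by (simp add: r_def field_simps)
        have r: "r \<noteq> 0" using base_point_free[OF z t f0] Fr by auto
        have mon: "monomial (\<lambda>j. F j z1 z2 t) \<gamma> = r ^ m * monomial (\<xi> s) \<gamma>" if "\<gamma> \<in> ?S" for \<gamma>
          unfolding Fr monomial_scale using that by simp
        have "0 = (\<Sum>i\<in>UNIV. \<Sum>\<gamma>\<in>?S. a i \<gamma> * (monomial (\<lambda>j. F j z1 z2 t) \<gamma> * \<phi> \<rho> i z1 z2 t))"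
          using van[OF f0] by simp
        also have "\<dots> = (\<Sum>i\<in>UNIV. \<Sum>\<gamma>\<in>?S. r ^ m * (a i \<gamma> * monomial (\<xi> s) \<gamma> * \<phi> \<rho> i z1 z2 t))"
          by (intro sum.cong refl) (simp add: mon)
        also have "\<dots> = r ^ m * (\<Sum>i\<in>UNIV. y i * \<phi> \<rho> i z1 z2 t)"
          unfolding y_def by (simp add: sum_distrib_left sum_distrib_right)
        finally show "(\<Sum>i\<in>UNIV. y i * \<phi> \<rho> i z1 z2 t) = 0" using r by simp
      qed
      then show ?case by (simp add: y_def \<xi>_def[abs_def])
    qed
  qed
qed

text \<open>The numerator, over the denominator \<open>f^(m+1)\<close>, of the derivative
  \<open>\<partial>^\<gamma>\<close> of the \<open>i\<close>-th generator. The two summands come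
  from its two exponentials, whose exponents differ by \<open>c\<close>.\<close>

definition basis_numerator ::
  "complex \<Rightarrow> nat \<Rightarrow> 'n \<Rightarrow> ('n \<Rightarrow> nat) \<Rightarrow> complex \<Rightarrow> complex \<Rightarrow> complex^'n \<Rightarrow> complex" where
  "basis_numerator \<rho> m i \<gamma> z1 z2 t = f z1 z2 t ^ (m - mdeg \<gamma>) *
     (\<rho> * A * s1 z1 z2 * (T *v t) $ i * monomial (\<lambda>j. F j z1 z2 t - c j * f z1 z2 t) \<gamma>
      + s2 z1 z2 * t $ i * monomial (\<lambda>j. F j z1 z2 t) \<gamma>)"

lemma continuous_on_form11: "continuous_on S (\<lambda>p. form11 a b (fst p) (fst (snd p)) (snd (snd p)))"
  unfolding form11_def by (intro continuous_intros)

lemma continuous_on_basis_numerator: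
  "continuous_on UNIV (\<lambda>p. basis_numerator \<rho> m i \<gamma> (fst p) (fst (snd p)) (snd (snd p)))"
proof -
  have f': "continuous_on UNIV (\<lambda>p. f (fst p) (fst (snd p)) (snd (snd p)))"
    and F': "continuous_on UNIV (\<lambda>p. F j (fst p) (fst (snd p)) (snd (snd p)))" for j
    unfolding f F by (rule continuous_on_form11)+
  show ?thesis
    unfolding basis_numerator_def monomial_def s1_def s2_def matrix_vector_mult_def vec_lambda_beta
    by (intro continuous_intros f' F') (use cross_nonzero in auto)
qed

text \<open>On \<open>f = 0\<close> only the derivatives of order exactly \<open>m\<close> contribute, and
  there \<open>F_j - c_j f\<close> and \<open>F_j\<close> coincide.\<close>

lemma basis_numerators_top:
  fixes a :: "'n \<Rightarrow> ('n \<Rightarrow> nat) \<Rightarrow> complex"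
  assumes \<rho>: "\<rho> \<noteq> 1"
    and rel: "\<And>z1 z2 t. f z1 z2 t \<noteq> 0 \<Longrightarrow>
      (\<Sum>i\<in>UNIV. \<Sum>\<gamma> | mdeg \<gamma> \<le> m. a i \<gamma> * basis_numerator \<rho> m i \<gamma> z1 z2 t) = 0"
    and \<gamma>: "mdeg \<gamma> = m"
  shows "a i \<gamma> = 0"
proof (rule top_coefficients_zero[OF \<rho> _ \<gamma>])
  let ?le = "{\<gamma> :: 'n \<Rightarrow> nat. mdeg \<gamma> \<le> m}"
    and ?eq = "{\<gamma> :: 'n \<Rightarrow> nat. mdeg \<gamma> = m}"
  have "continuous_on UNIV (\<lambda>(z1, z2, t). \<Sum>i\<in>UNIV. \<Sum>\<gamma>\<in>?le. a i \<gamma> * basis_numerator \<rho> m i \<gamma> z1 z2 t)"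
    unfolding case_prod_unfold by (intro continuous_intros continuous_on_basis_numerator)
  then have all: "(\<Sum>i\<in>UNIV. \<Sum>\<gamma>\<in>?le. a i \<gamma> * basis_numerator \<rho> m i \<gamma> z1 z2 t) = 0" for z1 z2 t
    using rel by (rule f_dense)
  fix z1 z2 t assume f0: "f z1 z2 t = 0"
  have "(\<Sum>\<gamma>\<in>?eq. a i \<gamma> * (monomial (\<lambda>j. F j z1 z2 t) \<gamma> * \<phi> \<rho> i z1 z2 t))
      = (\<Sum>\<gamma>\<in>?le. a i \<gamma> * basis_numerator \<rho> m i \<gamma> z1 z2 t)" for i
    by (rule sum.mono_neutral_cong_left[OF finite_multidegree_le])
       (auto simp: basis_numerator_def f0 \<phi>_def algebra_simps power_0_left)
  then show "(\<Sum>i\<in>UNIV. \<Sum>\<gamma>\<in>?eq. a i \<gamma> * (monomial (\<lambda>j. F j z1 z2 t) \<gamma> * \<phi> \<rho> i z1 z2 t)) = 0"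
    using all[of z1 z2 t] by simp
qed

text \<open>Once the top order is gone, a factor \<open>f\<close> can be cancelled and the order drops by
  one.\<close>

lemma basis_numerators_independent:
  fixes a :: "'n \<Rightarrow> ('n \<Rightarrow> nat) \<Rightarrow> complex"
  assumes \<rho>: "\<rho> \<noteq> 1"
    and rel: "\<And>z1 z2 t. f z1 z2 t \<noteq> 0 \<Longrightarrow>
      (\<Sum>i\<in>UNIV. \<Sum>\<gamma> | mdeg \<gamma> \<le> m. a i \<gamma> * basis_numerator \<rho> m i \<gamma> z1 z2 t) = 0"
    and \<gamma>: "mdeg \<gamma> \<le> m"
  shows "a i \<gamma> = 0"
  using rel \<gamma>
proof (induction m arbitrary: \<gamma> i)
  case 0
  show ?case by (rule basis_numerators_top[OF \<rho> 0(1)]) (use 0(2) in simp_all)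
next
  case (Suc m)
  have top: "a i \<gamma> = 0" if "mdeg \<gamma> = Suc m" for i \<gamma>
    by (rule basis_numerators_top[OF \<rho> Suc.prems(1) that])
  show ?case
  proof (cases "mdeg \<gamma> = Suc m")
    case True
    then show ?thesis by (rule top)
  next
    case False
    show ?thesis
    proof (rule Suc.IH)
      show "mdeg \<gamma> \<le> m" using Suc.prems(2) False by simp
      fix z1 z2 t assume f0: "f z1 z2 t \<noteq> 0"
      have "f z1 z2 t * (\<Sum>\<gamma> | mdeg \<gamma> \<le> m. a i \<gamma> * basis_numerator \<rho> m i \<gamma> z1 z2 t)
          = (\<Sum>\<gamma> | mdeg \<gamma> \<le> Suc m. a i \<gamma> * basis_numerator \<rho> (Suc m) i \<gamma> z1 z2 t)" for i
        unfolding sum_distrib_left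
        by (rule sum.mono_neutral_cong_left[OF finite_multidegree_le])
           (auto simp: basis_numerator_def Suc_diff_le top le_Suc_eq)
      then have "f z1 z2 t * (\<Sum>i\<in>UNIV. \<Sum>\<gamma> | mdeg \<gamma> \<le> m. a i \<gamma> * basis_numerator \<rho> m i \<gamma> z1 z2 t) = 0"
        using Suc.prems(1)[OF f0] by (simp add: sum_distrib_left)
      then show "(\<Sum>i\<in>UNIV. \<Sum>\<gamma> | mdeg \<gamma> \<le> m. a i \<gamma> * basis_numerator \<rho> m i \<gamma> z1 z2 t) = 0"
        using f0 by simp
    qed
  qed
qed

end

section \<open>Germs and numerators with analytic coefficients\<close>

lemma germs_common_domain:
  assumes "finite G" "G \<subseteq> analytic_germs x0"
  shows "\<exists>U. open U \<and> x0 \<in> U \<and> (\<forall>g\<in>G. cdiff_on U g)"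
proof -
  have "\<forall>g\<in>G. \<exists>U. open U \<and> x0 \<in> U \<and> cdiff_on U g"
  proof
    fix g assume "g \<in> G"
    then have "g \<in> analytic_germs x0" by (rule subsetD[OF assms(2)])
    then show "\<exists>U. open U \<and> x0 \<in> U \<and> cdiff_on U g" by (simp only: analytic_germs_iff)
  qed
  then obtain U where U: "\<forall>g\<in>G. open (U g) \<and> x0 \<in> U g \<and> cdiff_on (U g) g" by (rule bchoice[THEN exE])
  show ?thesis
  proof (intro exI[of _ "\<Inter>g\<in>G. U g"] conjI ballI)
    show "open (\<Inter>g\<in>G. U g)" by (rule open_INT[OF assms(1)]) (simp add: U)
    show "x0 \<in> (\<Inter>g\<in>G. U g)" by (rule INT_I) (simp only: U)
    fix g assume g: "g \<in> G"
    have "cdiff_on (U g) g" using U g by (simp only:)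
    then show "cdiff_on (\<Inter>g\<in>G. U g) g" by (rule cdiff_on_subset) (rule INT_lower[OF g])
  qed
qed

lemma germ_combine:
  assumes "g \<in> analytic_germs x0" "h \<in> analytic_germs x0"
    "\<And>U. cdiff_on U g \<Longrightarrow> cdiff_on U h \<Longrightarrow> cdiff_on U k"
  shows "k \<in> analytic_germs x0"
proof -
  have "finite {g, h}" "{g, h} \<subseteq> analytic_germs x0" using assms by simp_all
  then have "\<exists>U. open U \<and> x0 \<in> U \<and> (\<forall>g'\<in>{g, h}. cdiff_on U g')" by (rule germs_common_domain)
  then obtain U where U: "open U \<and> x0 \<in> U \<and> (\<forall>g'\<in>{g, h}. cdiff_on U g')" by (rule exE)
  have "cdiff_on U k" by (rule assms(3)) (use U in simp_all)
  then show ?thesis unfolding analytic_germs_iff using U by (intro exI[of _ U]) simp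
qed

lemma germ_add:
  assumes "g \<in> analytic_germs x0" "h \<in> analytic_germs x0"
  shows "(\<lambda>x. g x + h x) \<in> analytic_germs x0"
  by (rule germ_combine[OF assms cdiff_on_add])

lemma germ_mult:
  assumes "g \<in> analytic_germs x0" "h \<in> analytic_germs x0"
  shows "(\<lambda>x. g x * h x) \<in> analytic_germs x0"
  by (rule germ_combine[OF assms cdiff_on_mult])

lemma germ_diff:
  assumes "g \<in> analytic_germs x0" "h \<in> analytic_germs x0"
  shows "(\<lambda>x. g x - h x) \<in> analytic_germs x0"
  using germ_add[OF assms(1) germ_mult[OF const_germ[of "-1"] assms(2)]] by simp

lemma germ_sum:
  "(\<And>i. i \<in> S \<Longrightarrow> g i \<in> analytic_germs x0) \<Longrightarrow> (\<lambda>x. \<Sum>i\<in>S. g i x) \<in> analytic_germs x0"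
  by (induction S rule: infinite_finite_induct) (auto intro: germ_add)

lemma germ_domain:
  assumes "g \<in> analytic_germs x0"
  obtains U where "open U" "x0 \<in> U" "cdiff_on U g"
proof -
  obtain U where "open U \<and> x0 \<in> U \<and> cdiff_on U g"
    using assms unfolding analytic_germs_iff by (rule exE)
  then show thesis by (intro that[of U]) simp_all
qed

lemma germ_inverse:
  assumes "g \<in> analytic_germs x0" "g x0 \<noteq> 0"
  shows "(\<lambda>x. inverse (g x)) \<in> analytic_germs x0"
proof -
  obtain U where U: "open U" "x0 \<in> U" "cdiff_on U g" using germ_domain[OF assms(1)] .
  have "open (U \<inter> g -` (- {0}))"
    by (rule continuous_open_preimage[OF cdiff_on_continuous[OF U(3)] U(1)]) (simp add: open_Compl)
  moreover have "cdiff_on (U \<inter> g -` (- {0})) (\<lambda>x. inverse (g x))"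
    by (rule cdiff_on_inverse[OF cdiff_on_subset[OF U(3)]]) auto
  ultimately show ?thesis unfolding analytic_germs_iff
    using U(2) assms(2) by (intro exI[of _ "U \<inter> g -` (- {0})"]) simp
qed

lemma germ_continuous:
  assumes "g \<in> analytic_germs x0"
  shows "isCont g x0"
proof -
  obtain U where U: "open U" "x0 \<in> U" "cdiff_on U g" using germ_domain[OF assms] .
  then show ?thesis using cdiff_on_continuous[OF U(3)] by (simp add: continuous_on_eq_continuous_at)
qed

definition germ_forms :: "complex^'n \<Rightarrow> nat \<Rightarrow> 'n xfun set" where
  "germ_forms x0 k = {H. \<exists>h. (\<forall>j \<gamma>. h j \<gamma> \<in> analytic_germs x0) \<and> H = numerator k h}"

lemma germ_formsE:
  assumes "H \<in> germ_forms x0 k"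
  obtains h where "\<And>j \<gamma>. h j \<gamma> \<in> analytic_germs x0" "H = numerator k h"
  using assms unfolding germ_forms_def by blast

lemma germ_formsI: "(\<And>j \<gamma>. h j \<gamma> \<in> analytic_germs x0) \<Longrightarrow> numerator k h \<in> germ_forms x0 k"
  unfolding germ_forms_def by blast

lemma numerator_monomial:
  "numerator k h x z1 z2 t = (\<Sum>j\<le>k. \<Sum>\<gamma> | mdeg \<gamma> = k. h j \<gamma> x * z1^j * z2^(k - j) * monomial (\<lambda>i. t $ i) \<gamma>)"
  unfolding numerator_def monomial_def ..

lemma germ_forms_add:
  assumes "H \<in> germ_forms x0 k" "H' \<in> germ_forms x0 k"
  shows "(\<lambda>x z1 z2 t. H x z1 z2 t + H' x z1 z2 t) \<in> germ_forms x0 k"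
proof -
  obtain h where h: "\<And>j \<gamma>. h j \<gamma> \<in> analytic_germs x0" "H = numerator k h" using germ_formsE[OF assms(1)] by metis
  obtain h' where h': "\<And>j \<gamma>. h' j \<gamma> \<in> analytic_germs x0" "H' = numerator k h'" using germ_formsE[OF assms(2)] by metis
  have "(\<lambda>x z1 z2 t. H x z1 z2 t + H' x z1 z2 t) = numerator k (\<lambda>j \<gamma> x. h j \<gamma> x + h' j \<gamma> x)"
    by (simp add: h(2) h'(2) fun_eq_iff numerator_def sum.distrib ring_distribs)
  then show ?thesis by (simp only:) (rule germ_formsI, rule germ_add[OF h(1) h'(1)])
qed

lemma germ_forms_zero: "(\<lambda>x z1 z2 t. 0) \<in> germ_forms x0 k"
proof -
  have "(\<lambda>x z1 z2 t. 0) = numerator k (\<lambda>j \<gamma> x. 0)" by (simp add: fun_eq_iff numerator_def)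
  then show ?thesis by (rule ssubst[where P = "\<lambda>H. H \<in> germ_forms x0 k"]) (rule germ_formsI, rule const_germ)
qed

lemma germ_forms_sum:
  "(\<And>i. i \<in> S \<Longrightarrow> H i \<in> germ_forms x0 k) \<Longrightarrow> (\<lambda>x z1 z2 t. \<Sum>i\<in>S. H i x z1 z2 t) \<in> germ_forms x0 k"
  by (induction S rule: infinite_finite_induct) (auto intro: germ_forms_add simp: germ_forms_zero)

lemma germ_forms_germ_mult:
  assumes "a \<in> analytic_germs x0" "H \<in> germ_forms x0 k"
  shows "(\<lambda>x z1 z2 t. a x * H x z1 z2 t) \<in> germ_forms x0 k"
proof -
  obtain h where h: "\<And>j \<gamma>. h j \<gamma> \<in> analytic_germs x0" "H = numerator k h" using germ_formsE[OF assms(2)] by metis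
  have "(\<lambda>x z1 z2 t. a x * H x z1 z2 t) = numerator k (\<lambda>j \<gamma> x. a x * h j \<gamma> x)"
    by (simp add: h(2) fun_eq_iff numerator_def sum_distrib_left mult_ac)
  then show ?thesis by (simp only:) (rule germ_formsI, rule germ_mult[OF assms(1) h(1)])
qed

lemma germ_forms_monomial:
  fixes x0 :: "complex^'n" and \<gamma> :: "'n \<Rightarrow> nat"
  assumes "a \<in> analytic_germs x0" "j \<le> k" "mdeg \<gamma> = k"
  shows "(\<lambda>x z1 z2 t. a x * z1^j * z2^(k - j) * monomial (\<lambda>i. t $ i) \<gamma>) \<in> germ_forms x0 k"
proof -
  let ?h = "\<lambda>j' \<gamma>' x. if j' = j then (if \<gamma>' = \<gamma> then a x else 0) else 0"
  have fS: "finite {\<gamma>' :: 'n \<Rightarrow> nat. mdeg \<gamma>' = k}" by (rule finite_multidegree_eq)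
  have "numerator k ?h x z1 z2 t = a x * z1^j * z2^(k - j) * monomial (\<lambda>i. t $ i) \<gamma>" for x z1 z2 and t :: "complex^'n"
  proof -
    have "numerator k ?h x z1 z2 t = (\<Sum>j'\<le>k. \<Sum>\<gamma>' | mdeg \<gamma>' = k.
       (if \<gamma>' = \<gamma> then (if j' = j then a x * z1^j * z2^(k - j) * monomial (\<lambda>i. t $ i) \<gamma> else 0) else 0))"
      unfolding numerator_monomial by (intro sum.cong) auto
    also have "\<dots> = (\<Sum>j'\<le>k. if j' = j then a x * z1^j * z2^(k - j) * monomial (\<lambda>i. t $ i) \<gamma> else 0)"
      using assms(3) fS by (intro sum.cong) (simp_all add: sum.delta)
    also have "\<dots> = a x * z1^j * z2^(k - j) * monomial (\<lambda>i. t $ i) \<gamma>" using assms(2) by simp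
    finally show ?thesis .
  qed
  then have eq: "(\<lambda>x z1 z2 t. a x * z1^j * z2^(k - j) * monomial (\<lambda>i. t $ i) \<gamma>) = numerator k ?h"
    by (intro ext) simp
  have "?h j' \<gamma>' \<in> analytic_germs x0" for j' \<gamma>'
    using assms(1) by (cases "j' = j"; cases "\<gamma>' = \<gamma>") simp_all
  then have "numerator k ?h \<in> germ_forms x0 k" by (rule germ_formsI)
  then show ?thesis unfolding eq .
qed

lemma germ_forms_germ: "a \<in> analytic_germs x0 \<Longrightarrow> (\<lambda>x z1 z2 t. a x) \<in> germ_forms x0 0"
  using germ_forms_monomial[of a x0 0 0 "\<lambda>_. 0"] by (simp add: monomial_def)

lemma monomial_upd: "monomial \<kappa> (\<gamma>(m := Suc (\<gamma> m))) = \<kappa> m * monomial \<kappa> \<gamma>"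
proof -
  have "(\<Prod>j\<in>UNIV. \<kappa> j ^ (\<gamma>(m := Suc (\<gamma> m))) j) = (\<Prod>j\<in>UNIV. (if j = m then \<kappa> m else 1) * \<kappa> j ^ \<gamma> j)"
    by (intro prod.cong) auto
  then show ?thesis by (simp add: monomial_def prod.distrib)
qed

lemma degree_upd: "(\<Sum>j\<in>UNIV. (\<gamma>(m := Suc (\<gamma> m))) j) = Suc (\<Sum>j\<in>(UNIV::'n::finite set). \<gamma> j)"
  by (simp add: sum.remove[of UNIV m])

lemma germ_forms_times_zt:
  fixes x0 :: "complex^'n"
  assumes "H \<in> germ_forms x0 k"
  shows "(\<lambda>x z1 z2 t. z1 * t $ m * H x z1 z2 t) \<in> germ_forms x0 (Suc k)"
    and "(\<lambda>x z1 z2 t. z2 * t $ m * H x z1 z2 t) \<in> germ_forms x0 (Suc k)"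
proof -
  obtain h where h: "\<And>j \<gamma>. h j \<gamma> \<in> analytic_germs x0" "H = numerator k h" using germ_formsE[OF assms] by metis
  let ?S = "{\<gamma> :: 'n \<Rightarrow> nat. mdeg \<gamma> = k}"
  have 1: "z1 * t $ m * H x z1 z2 t = (\<Sum>j\<le>k. \<Sum>\<gamma>\<in>?S.
      h j \<gamma> x * z1 ^ Suc j * z2 ^ (Suc k - Suc j) * monomial (\<lambda>i. t $ i) (\<gamma>(m := Suc (\<gamma> m))))" for x z1 z2 t
    unfolding h(2) numerator_monomial monomial_upd by (simp add: sum_distrib_left mult_ac)
  have 2: "z2 * t $ m * H x z1 z2 t = (\<Sum>j\<le>k. \<Sum>\<gamma>\<in>?S.
      h j \<gamma> x * z1 ^ j * z2 ^ (Suc k - j) * monomial (\<lambda>i. t $ i) (\<gamma>(m := Suc (\<gamma> m))))" for x z1 z2 t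
    unfolding h(2) numerator_monomial monomial_upd sum_distrib_left
    by (intro sum.cong refl) (auto simp: Suc_diff_le mult_ac)
  show "(\<lambda>x z1 z2 t. z1 * t $ m * H x z1 z2 t) \<in> germ_forms x0 (Suc k)"
    unfolding 1 by (intro germ_forms_sum germ_forms_monomial h(1)) (auto simp: degree_upd simp del: fun_upd_apply)
  show "(\<lambda>x z1 z2 t. z2 * t $ m * H x z1 z2 t) \<in> germ_forms x0 (Suc k)"
    unfolding 2 by (intro germ_forms_sum germ_forms_monomial h(1)) (auto simp: degree_upd simp del: fun_upd_apply)
qed

lemma germ_forms_times_form11:
  assumes "H \<in> germ_forms x0 k"
  shows "(\<lambda>x z1 z2 t. form11 a b z1 z2 t * H x z1 z2 t) \<in> germ_forms x0 (Suc k)"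
proof -
  have "form11 a b z1 z2 t * H x z1 z2 t
      = (\<Sum>m\<in>UNIV. a $ m * (z1 * t $ m * H x z1 z2 t) + b $ m * (z2 * t $ m * H x z1 z2 t))" for x z1 z2 t
    unfolding form11_def by (simp add: sum_distrib_left sum_distrib_right algebra_simps)
  then show ?thesis
    by (simp only:) (intro germ_forms_sum germ_forms_add germ_forms_germ_mult[OF const_germ] germ_forms_times_zt assms)
qed

lemma germ_forms_times_power:
  assumes "H \<in> germ_forms x0 k"
  shows "(\<lambda>x z1 z2 t. form11 a b z1 z2 t ^ p * H x z1 z2 t) \<in> germ_forms x0 (k + p)"
proof (induction p)
  case (Suc p)
  from germ_forms_times_form11[OF Suc, of a b] show ?case by (simp add: mult.assoc)
qed (use assms in simp)

lemma germ_forms_times_monomial: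
  assumes "H \<in> germ_forms x0 k"
  shows "(\<lambda>x z1 z2 t. monomial (\<lambda>j. form11 (a j) (b j) z1 z2 t) \<gamma> * H x z1 z2 t) \<in> germ_forms x0 (k + mdeg \<gamma>)"
proof -
  have "(\<lambda>x z1 z2 t. (\<Prod>j\<in>S. form11 (a j) (b j) z1 z2 t ^ \<gamma> j) * H x z1 z2 t) \<in> germ_forms x0 (k + (\<Sum>j\<in>S. \<gamma> j))"
    if "finite S" for S
    using that
  proof (induction S rule: finite_induct)
    case (insert j S)
    from germ_forms_times_power[OF insert.IH, of "a j" "b j" "\<gamma> j"] insert.hyps show ?case
      by (simp add: mult.assoc add_ac)
  qed (use assms in simp)
  then show ?thesis unfolding monomial_def by simp
qed

lemma homogeneous_step:
  fixes e :: "nat \<Rightarrow> complex"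
  shows "\<exists>e'. \<forall>s s'. (a * s + a' * s') * (\<Sum>l\<le>N. e l * s ^ l * s' ^ (N - l)) = (\<Sum>l\<le>Suc N. e' l * s ^ l * s' ^ (Suc N - l))"
proof (intro exI allI)
  fix s s' :: complex
  let ?e' = "\<lambda>l. (if l = 0 then 0 else a * e (l - 1)) + (if l \<le> N then a' * e l else 0)"
  have "(\<Sum>l\<le>Suc N. ?e' l * s ^ l * s' ^ (Suc N - l)) =
     (\<Sum>l\<le>Suc N. (if l = 0 then 0 else a * e (l - 1)) * s ^ l * s' ^ (Suc N - l))
     + (\<Sum>l\<le>Suc N. (if l \<le> N then a' * e l else 0) * s ^ l * s' ^ (Suc N - l))"
    by (simp add: ring_distribs sum.distrib del: sum.atMost_Suc)
  also have "(\<Sum>l\<le>Suc N. (if l = 0 then 0 else a * e (l - 1)) * s ^ l * s' ^ (Suc N - l))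
     = a * s * (\<Sum>l\<le>N. e l * s ^ l * s' ^ (N - l))"
    by (subst sum.atMost_Suc_shift) (simp add: sum_distrib_left mult_ac)
  also have "(\<Sum>l\<le>Suc N. (if l \<le> N then a' * e l else 0) * s ^ l * s' ^ (Suc N - l))
     = a' * s' * (\<Sum>l\<le>N. e l * s ^ l * s' ^ (N - l))"
    unfolding sum_distrib_left sum.atMost_Suc
    by (simp, intro sum.cong refl) (auto simp: Suc_diff_le)
  finally show "(a * s + a' * s') * (\<Sum>l\<le>N. e l * s ^ l * s' ^ (N - l)) = (\<Sum>l\<le>Suc N. ?e' l * s ^ l * s' ^ (Suc N - l))"
    by (simp only: ring_distribs)
qed

text \<open>Binary forms remain binary forms after a linear change of coordinates; it is used to expand
  numerators in \<open>s1, s2\<close>.\<close>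

lemma homogeneous_substitution:
  fixes a a' b b' :: complex
  shows "\<exists>e. \<forall>s s'. (a * s + a' * s') ^ j * (b * s + b' * s') ^ k = (\<Sum>l\<le>j + k. e l * s ^ l * s' ^ (j + k - l))"
proof (induction j)
  case 0
  show ?case
  proof (induction k)
    case 0 show ?case by (rule exI[of _ "\<lambda>_. 1"]) simp
  next
    case (Suc k)
    then obtain e where e: "\<And>s s'. (b * s + b' * s') ^ k = (\<Sum>l\<le>k. e l * s ^ l * s' ^ (k - l))" by auto
    from homogeneous_step[of b b' e k] show ?case unfolding power_0 power_Suc e mult_1 add_0 .
  qed
next
  case (Suc j)
  then obtain e where e: "\<And>s s'. (a * s + a' * s') ^ j * (b * s + b' * s') ^ k = (\<Sum>l\<le>j + k. e l * s ^ l * s' ^ (j + k - l))" by auto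
  from homogeneous_step[of a a' e "j + k"] show ?case unfolding power_Suc add_Suc mult.assoc e .
qed

context glued_pencil
begin

section \<open>Expansion of glued numerators\<close>

lemma numerator_in_s_coordinates:
  fixes h :: "nat \<Rightarrow> ('n \<Rightarrow> nat) \<Rightarrow> complex^'n \<Rightarrow> complex"
  shows "\<exists>g. \<forall>z1 z2 t. numerator k h x z1 z2 t =
    (\<Sum>l\<le>k. \<Sum>\<gamma> | mdeg \<gamma> = k. g l \<gamma> * (s1 z1 z2 ^ l * s2 z1 z2 ^ (k - l) * monomial (\<lambda>i. t $ i) \<gamma>))"
proof -
  let ?S = "{\<gamma> :: 'n \<Rightarrow> nat. mdeg \<gamma> = k}"
  have "\<forall>j\<in>{..k}. \<exists>e. \<forall>z1 z2. z1 ^ j * z2 ^ (k - j) = (\<Sum>l\<le>k. e l * s1 z1 z2 ^ l * s2 z1 z2 ^ (k - l))"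
  proof
    fix j assume "j \<in> {..k}"
    then have j: "j \<le> k" by simp
    obtain e where e: "\<And>s s'. (a1 * s + a2 * s') ^ j * (b1 * s + b2 * s') ^ (k - j)
        = (\<Sum>l\<le>j + (k - j). e l * s ^ l * s' ^ (j + (k - j) - l))"
      using homogeneous_substitution[of a1 a2 j b1 b2 "k - j"] by blast
    have z: "a1 * s1 z1 z2 + a2 * s2 z1 z2 = z1" "b1 * s1 z1 z2 + b2 * s2 z1 z2 = z2" for z1 z2
      using z_expand(1)[of z1 z2] z_expand(2)[of z2 z1] by (simp_all add: mult.commute)
    have "z1 ^ j * z2 ^ (k - j) = (\<Sum>l\<le>k. e l * s1 z1 z2 ^ l * s2 z1 z2 ^ (k - l))" for z1 z2
      using e[of "s1 z1 z2" "s2 z1 z2"] j unfolding z by simp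
    then show "\<exists>e. \<forall>z1 z2. z1 ^ j * z2 ^ (k - j) = (\<Sum>l\<le>k. e l * s1 z1 z2 ^ l * s2 z1 z2 ^ (k - l))"
      by (intro exI[of _ e] allI)
  qed
  from bchoice[OF this] obtain e where
    e: "\<forall>j\<in>{..k}. \<forall>z1 z2. z1 ^ j * z2 ^ (k - j) = (\<Sum>l\<le>k. e j l * s1 z1 z2 ^ l * s2 z1 z2 ^ (k - l))"
    by (rule exE)
  show ?thesis
  proof (intro exI[of _ "\<lambda>l \<gamma>. \<Sum>j\<le>k. h j \<gamma> x * e j l"] allI)
    fix z1 z2 t
    have "numerator k h x z1 z2 t = (\<Sum>j\<le>k. \<Sum>\<gamma>\<in>?S. h j \<gamma> x * (z1^j * z2^(k - j)) * monomial (\<lambda>i. t $ i) \<gamma>)"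
      unfolding numerator_monomial by (simp add: mult.assoc)
    also have "\<dots> = (\<Sum>j\<le>k. \<Sum>\<gamma>\<in>?S. \<Sum>l\<le>k. h j \<gamma> x * e j l * (s1 z1 z2 ^ l * s2 z1 z2 ^ (k - l) * monomial (\<lambda>i. t $ i) \<gamma>))"
    proof (intro sum.cong refl)
      fix j \<gamma> assume "j \<in> {..k}"
      then have ej: "z1 ^ j * z2 ^ (k - j) = (\<Sum>l\<le>k. e j l * s1 z1 z2 ^ l * s2 z1 z2 ^ (k - l))"
        by (rule e[rule_format])
      show "h j \<gamma> x * (z1^j * z2^(k - j)) * monomial (\<lambda>i. t $ i) \<gamma> =
          (\<Sum>l\<le>k. h j \<gamma> x * e j l * (s1 z1 z2 ^ l * s2 z1 z2 ^ (k - l) * monomial (\<lambda>i. t $ i) \<gamma>))"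
        unfolding ej by (simp add: sum_distrib_left sum_distrib_right mult_ac)
    qed
    also have "\<dots> = (\<Sum>j\<le>k. \<Sum>l\<le>k. \<Sum>\<gamma>\<in>?S. h j \<gamma> x * e j l * (s1 z1 z2 ^ l * s2 z1 z2 ^ (k - l) * monomial (\<lambda>i. t $ i) \<gamma>))"
      by (intro sum.cong refl sum.swap)
    also have "\<dots> = (\<Sum>l\<le>k. \<Sum>j\<le>k. \<Sum>\<gamma>\<in>?S. h j \<gamma> x * e j l * (s1 z1 z2 ^ l * s2 z1 z2 ^ (k - l) * monomial (\<lambda>i. t $ i) \<gamma>))"
      by (rule sum.swap)
    also have "\<dots> = (\<Sum>l\<le>k. \<Sum>\<gamma>\<in>?S. \<Sum>j\<le>k. h j \<gamma> x * e j l * (s1 z1 z2 ^ l * s2 z1 z2 ^ (k - l) * monomial (\<lambda>i. t $ i) \<gamma>))"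
      by (intro sum.cong refl sum.swap)
    finally show "numerator k h x z1 z2 t = (\<Sum>l\<le>k. \<Sum>\<gamma>\<in>?S. (\<Sum>j\<le>k. h j \<gamma> x * e j l) *
        (s1 z1 z2 ^ l * s2 z1 z2 ^ (k - l) * monomial (\<lambda>i. t $ i) \<gamma>))"
      by (simp add: sum_distrib_right)
  qed
qed

text \<open>A glued form of bidegree \<open>(k, k)\<close> is free in its coefficients at \<open>s1^l
  s2^(k-l)\<close> for \<open>l < k\<close>. The coefficient at \<open>s1^k\<close>, the
  restriction to \<open>p1\<close>, is tied to the one at \<open>s2^k\<close>, the restriction to
  \<open>p2\<close>; this is the second summand for \<open>l = 0\<close>.\<close>

definition spanning_form :: "complex \<Rightarrow> nat \<Rightarrow> nat \<times> ('n \<Rightarrow> nat) \<Rightarrow> complex \<times> complex \<times> (complex^'n) \<Rightarrow> complex" where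
  "spanning_form r k = (\<lambda>(l, \<gamma>) (z1, z2, t). s1 z1 z2 ^ l * s2 z1 z2 ^ (k - l) * monomial (\<lambda>i. t $ i) \<gamma>
     + (if l = 0 then r * s1 z1 z2 ^ k * monomial (\<lambda>i. (T *v t) $ i) \<gamma> else 0))"

lemma glued_numerator_in_span:
  assumes k: "k \<ge> 1"
    and H: "\<And>z1 z2 t. H z1 z2 t = numerator k h x z1 z2 t"
    and glue: "\<And>t. H a1 b1 t = r * H a2 b2 (T *v t)"
  shows "\<exists>m. \<forall>p. (case p of (z1, z2, t) \<Rightarrow> H z1 z2 t) = (\<Sum>j\<in>{..<k} \<times> {\<gamma>. mdeg \<gamma> = k}. m j * spanning_form r k j p)"
proof -
  let ?S = "{\<gamma> :: 'n \<Rightarrow> nat. mdeg \<gamma> = k}"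
  obtain g where g: "\<forall>z1 z2 t. numerator k h x z1 z2 t =
    (\<Sum>l\<le>k. \<Sum>\<gamma>\<in>?S. g l \<gamma> * (s1 z1 z2 ^ l * s2 z1 z2 ^ (k - l) * monomial (\<lambda>i. t $ i) \<gamma>))"
    using numerator_in_s_coordinates[of k h x] by (rule exE)
  define Hl where "Hl l t = (\<Sum>\<gamma>\<in>?S. g l \<gamma> * monomial (\<lambda>i. t $ i) \<gamma>)" for l and t :: "complex^'n"
  have gl: "H z1 z2 t = (\<Sum>l\<le>k. s1 z1 z2 ^ l * s2 z1 z2 ^ (k - l) * Hl l t)" for z1 z2 t
    unfolding H g[rule_format] Hl_def by (simp add: sum_distrib_left mult_ac)
  have "H a1 b1 t = (\<Sum>l\<le>k. if l = k then Hl k t else 0)" for t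
    unfolding gl by (rule sum.cong[OF refl]) simp
  then have H1: "H a1 b1 t = Hl k t" for t by simp
  have "H a2 b2 t = (\<Sum>l\<le>k. if l = 0 then Hl 0 t else 0)" for t
    unfolding gl by (rule sum.cong[OF refl]) simp
  then have H2: "H a2 b2 t = Hl 0 t" for t by simp
  have "H z1 z2 t = (\<Sum>j\<in>{..<k} \<times> ?S. (case j of (l, \<gamma>) \<Rightarrow> g l \<gamma>) * spanning_form r k j (z1, z2, t))" for z1 z2 t
  proof -
    have "(\<Sum>j\<in>{..<k} \<times> ?S. (case j of (l, \<gamma>) \<Rightarrow> g l \<gamma>) * spanning_form r k j (z1, z2, t))
       = (\<Sum>l<k. \<Sum>\<gamma>\<in>?S. g l \<gamma> * spanning_form r k (l, \<gamma>) (z1, z2, t))"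
      by (simp add: sum.cartesian_product case_prod_unfold)
    also have "\<dots> = (\<Sum>l<k. s1 z1 z2 ^ l * s2 z1 z2 ^ (k - l) * Hl l t
        + (if l = 0 then r * s1 z1 z2 ^ k * Hl 0 (T *v t) else 0))"
      unfolding spanning_form_def Hl_def
      by (intro sum.cong refl) (auto simp: ring_distribs sum.distrib sum_distrib_left mult_ac)
    also have "\<dots> = (\<Sum>l<k. s1 z1 z2 ^ l * s2 z1 z2 ^ (k - l) * Hl l t) + r * s1 z1 z2 ^ k * Hl 0 (T *v t)"
      using k by (simp add: sum.distrib)
    also have "r * s1 z1 z2 ^ k * Hl 0 (T *v t) = s1 z1 z2 ^ k * Hl k t"
      using glue[of t] unfolding H1 H2 by simp
    also have "(\<Sum>l<k. s1 z1 z2 ^ l * s2 z1 z2 ^ (k - l) * Hl l t) + s1 z1 z2 ^ k * Hl k t = H z1 z2 t"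
      unfolding gl by (simp flip: lessThan_Suc_atMost)
    finally show ?thesis by simp
  qed
  then show ?thesis by (intro exI[of _ "\<lambda>(l, \<gamma>). g l \<gamma>"]) auto
qed

lemma basis_numerator_glue:
  assumes "mdeg \<gamma> \<le> m"
  shows "basis_numerator \<rho> m i \<gamma> a1 b1 t = \<rho> * A ^ Suc m * basis_numerator \<rho> m i \<gamma> a2 b2 (T *v t)"
proof -
  have 1: "F j a1 b1 t - c j * f a1 b1 t = A * F j a2 b2 (T *v t)" for j
    using F_glue[of j t] by (simp add: algebra_simps)
  have 2: "A ^ Suc m = A * (A ^ (m - mdeg \<gamma>) * A ^ mdeg \<gamma>)"
    using assms by (simp add: power_add[symmetric])
  have 3: "basis_numerator \<rho> m i \<gamma> a1 b1 t = (A * f a2 b2 (T *v t)) ^ (m - mdeg \<gamma>) *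
      (\<rho> * A * (T *v t) $ i * (A ^ mdeg \<gamma> * monomial (\<lambda>j. F j a2 b2 (T *v t)) \<gamma>))"
    unfolding basis_numerator_def 1 monomial_scale unfolding f_p2 by simp
  have 4: "basis_numerator \<rho> m i \<gamma> a2 b2 (T *v t) = f a2 b2 (T *v t) ^ (m - mdeg \<gamma>) *
      ((T *v t) $ i * monomial (\<lambda>j. F j a2 b2 (T *v t)) \<gamma>)"
    unfolding basis_numerator_def by simp
  show ?thesis unfolding 2 3 4 power_mult_distrib by (simp only: mult_ac)
qed

lemma basis_numerator_germ_forms:
  assumes "\<rho> \<in> analytic_germs x0" "mdeg \<gamma> \<le> m"
  shows "(\<lambda>x z1 z2 t. basis_numerator (\<rho> x) m i \<gamma> z1 z2 t) \<in> germ_forms x0 (Suc m)"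
proof -
  define D where "D = a1 * b2 - b1 * a2"
  have 1: "s1 z1 z2 * (T *v t) $ i = form11 (\<chi> j. b2 / D * T $ i $ j) (\<chi> j. - a2 / D * T $ i $ j) z1 z2 t" for z1 z2 t
    unfolding form11_eq s1_def D_def[symmetric]
    by (simp add: matrix_vector_mult_def sum_distrib_left[symmetric] sum_negf sum_divide_distrib[symmetric] mult.assoc)
       (simp add: field_simps diff_divide_distrib)
  have ax: "(\<Sum>m\<in>UNIV. (x *s axis i 1) $ m * t $ m) = x * t $ i" for x and t :: "complex^'n"
  proof -
    have "(\<Sum>m\<in>UNIV. (x *s axis i 1) $ m * t $ m) = (\<Sum>m\<in>UNIV. (x * t $ m) * axis i 1 $ m)"
      by (intro sum.cong) simp_all
    then show ?thesis by (simp only: sum_axis)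
  qed
  have 2: "s2 z1 z2 * t $ i = form11 ((- b1 / D) *s axis i 1) ((a1 / D) *s axis i 1) z1 z2 t" for z1 z2 t
    unfolding form11_eq ax s2_def D_def[symmetric] by (simp add: field_simps diff_divide_distrib)
  have 3: "F j z1 z2 t - c j * f z1 z2 t = form11 (\<alpha>' $ j - c j *s \<alpha>) (\<beta>' $ j - c j *s \<beta>) z1 z2 t" for j z1 z2 t
    unfolding f F form11_def by (simp add: sum_distrib_left sum_subtractf[symmetric] algebra_simps)
  have g: "(\<lambda>x. \<rho> x * A) \<in> analytic_germs x0" by (rule germ_mult[OF assms(1) const_germ])
  let ?d = "\<Sum>j\<in>UNIV. \<gamma> j"
  have a: "(\<lambda>x z1 z2 t. monomial (\<lambda>j. form11 (\<alpha>' $ j - c j *s \<alpha>) (\<beta>' $ j - c j *s \<beta>) z1 z2 t) \<gamma> *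
      (form11 (\<chi> j. b2 / D * T $ i $ j) (\<chi> j. - a2 / D * T $ i $ j) z1 z2 t * (\<rho> x * A))) \<in> germ_forms x0 (Suc 0 + ?d)"
    by (rule germ_forms_times_monomial[OF germ_forms_times_form11[OF germ_forms_germ[OF g]]])
  have b: "(\<lambda>x z1 z2 t. monomial (\<lambda>j. form11 (\<alpha>' $ j) (\<beta>' $ j) z1 z2 t) \<gamma> *
      (form11 ((- b1 / D) *s axis i 1) ((a1 / D) *s axis i 1) z1 z2 t * 1)) \<in> germ_forms x0 (Suc 0 + ?d)"
    by (rule germ_forms_times_monomial[OF germ_forms_times_form11[OF germ_forms_germ[OF const_germ]]])
  have "Suc 0 + ?d + (m - ?d) = Suc m" using assms(2) by simp
  with germ_forms_times_power[OF germ_forms_add[OF a b], of \<alpha> \<beta> "m - ?d"]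
  show ?thesis
    unfolding basis_numerator_def 3 1[symmetric] 2[symmetric] f[symmetric] F[symmetric]
    by (simp add: mult_ac)
qed

text \<open>The \<open>spanning_form\<close>s are at most as many as the independent numerators of
  derivatives, by \<open>multidegree_count\<close>.\<close>

lemma glued_numerator_expansion:
  assumes \<rho>: "\<rho> \<noteq> 1"
    and H: "\<And>z1 z2 t. H z1 z2 t = numerator (Suc m) h x z1 z2 t"
    and glue: "\<And>t. H a1 b1 t = \<rho> * A ^ Suc m * H a2 b2 (T *v t)"
  shows "\<exists>a. \<forall>z1 z2 t. H z1 z2 t = (\<Sum>(i, \<gamma>)\<in>UNIV \<times> {\<gamma>. mdeg \<gamma> \<le> m}. a (i, \<gamma>) * basis_numerator \<rho> m i \<gamma> z1 z2 t)"
proof -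
  let ?S = "{\<gamma> :: 'n \<Rightarrow> nat. mdeg \<gamma> = Suc m}" and ?L = "{\<gamma> :: 'n \<Rightarrow> nat. mdeg \<gamma> \<le> m}"
  let ?B = "\<lambda>(i, \<gamma>) (z1, z2, t). basis_numerator \<rho> m i \<gamma> z1 z2 t"
  have "\<exists>a. \<forall>p. (case p of (z1, z2, t) \<Rightarrow> H z1 z2 t) = (\<Sum>i\<in>UNIV \<times> ?L. a i * ?B i p)"
  proof (rule spanning_by_count[where J = "{..<Suc m} \<times> ?S" and C = "spanning_form (\<rho> * A ^ Suc m) (Suc m)"])
    show "finite ((UNIV :: 'n set) \<times> ?L)" by (intro finite_cartesian_product finite_multidegree_le) simp
    show "finite ({..<Suc m} \<times> ?S)" by (intro finite_cartesian_product finite_multidegree_eq finite_lessThan)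
    show "card ({..<Suc m} \<times> ?S) \<le> card ((UNIV :: 'n set) \<times> ?L)"
      using multidegree_count[of "Suc m", where 'n = 'n] by (simp add: card_cartesian_product less_Suc_eq_le)
    fix a assume a: "\<And>p. (\<Sum>i\<in>UNIV \<times> ?L. a i * ?B i p) = 0"
    have "a (i, \<gamma>) = 0" if "\<gamma> \<in> ?L" for i \<gamma>
    proof (rule basis_numerators_independent[OF \<rho>, where a = "\<lambda>i \<gamma>. a (i, \<gamma>)" and m = m])
      fix z1 z2 t
      show "(\<Sum>i\<in>UNIV. \<Sum>\<gamma>\<in>?L. a (i, \<gamma>) * basis_numerator \<rho> m i \<gamma> z1 z2 t) = 0"
        using a[of "(z1, z2, t)"] by (simp add: sum.cartesian_product case_prod_unfold)
    qed (use that in simp)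
    then show "\<forall>i\<in>UNIV \<times> ?L. a i = 0" by auto
  next
    fix i :: "'n \<times> ('n \<Rightarrow> nat)" assume i: "i \<in> UNIV \<times> ?L"
    obtain l \<gamma> where l: "i = (l, \<gamma>)" "mdeg \<gamma> \<le> m" using i by (cases i) auto
    obtain h where h: "(\<lambda>x z1 z2 t. basis_numerator \<rho> m l \<gamma> z1 z2 t) = numerator (Suc m) h"
      using germ_formsE[OF basis_numerator_germ_forms[OF const_germ l(2)]] by metis
    have "\<exists>m'. \<forall>p. (case p of (z1, z2, t) \<Rightarrow> basis_numerator \<rho> m l \<gamma> z1 z2 t) =
        (\<Sum>j\<in>{..<Suc m} \<times> ?S. m' j * spanning_form (\<rho> * A ^ Suc m) (Suc m) j p)"
      by (rule glued_numerator_in_span[where h = h]) (simp_all add: fun_cong[OF fun_cong[OF fun_cong[OF fun_cong[OF h]]], symmetric] basis_numerator_glue[OF l(2)])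
    then show "\<exists>m'. \<forall>p. ?B i p = (\<Sum>j\<in>{..<Suc m} \<times> ?S. m' j * spanning_form (\<rho> * A ^ Suc m) (Suc m) j p)"
      unfolding l by simp
  next
    show "\<exists>m'. \<forall>p. (case p of (z1, z2, t) \<Rightarrow> H z1 z2 t) =
        (\<Sum>j\<in>{..<Suc m} \<times> ?S. m' j * spanning_form (\<rho> * A ^ Suc m) (Suc m) j p)"
      by (rule glued_numerator_in_span[OF _ H glue]) simp
  qed
  then obtain a where a: "\<And>p. (case p of (z1, z2, t) \<Rightarrow> H z1 z2 t) = (\<Sum>i\<in>UNIV \<times> ?L. a i * ?B i p)" by blast
  show ?thesis
    using a[of "(_, _, _)"] by (intro exI[of _ a]) (simp add: case_prod_unfold)
qed

end

section \<open>Analytic dependence on the parameter\<close>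

text \<open>Gaussian elimination over the ring of germs. The pivots are values at points \<open>p\<close>,
  chosen by independence at \<open>x0\<close>; a germ that is nonzero at \<open>x0\<close> is
  invertible. Pointwise solvability near \<open>x0\<close> is inherited by the eliminated system.\<close>

lemma analytic_coefficients:
  fixes B :: "'i \<Rightarrow> complex^'n \<Rightarrow> 'p \<Rightarrow> complex"
  assumes "finite I"
    and "\<And>i p. i \<in> I \<Longrightarrow> (\<lambda>x. B i x p) \<in> analytic_germs x0"
    and "\<And>p. (\<lambda>x. H x p) \<in> analytic_germs x0"
    and "\<And>a. (\<And>p. (\<Sum>i\<in>I. a i * B i x0 p) = 0) \<Longrightarrow> \<forall>i\<in>I. a i = 0"
    and "\<forall>\<^sub>F x in nhds x0. \<exists>a. \<forall>p. H x p = (\<Sum>i\<in>I. a i * B i x p)"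
  shows "\<exists>a. (\<forall>i\<in>I. a i \<in> analytic_germs x0) \<and> (\<forall>\<^sub>F x in nhds x0. \<forall>p. H x p = (\<Sum>i\<in>I. a i x * B i x p))"
  using assms
proof (induction I arbitrary: B H rule: finite_induct)
  case empty
  then show ?case by simp
next
  case (insert k I)
  note germB = insert.prems(1) and germH = insert.prems(2) and indep = insert.prems(3)
  have "\<exists>p0. B k x0 p0 \<noteq> 0"
  proof (rule ccontr)
    assume no: "\<not> (\<exists>p0. B k x0 p0 \<noteq> 0)"
    have "\<forall>i\<in>insert k I. (if i = k then 1 else 0 :: complex) = 0"
    proof (rule indep)
      fix p
      show "(\<Sum>i\<in>insert k I. (if i = k then 1 else 0) * B i x0 p) = 0"
        using no by (intro sum.neutral) simp
    qed
    then show False by simp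
  qed
  then obtain p0 where p0: "B k x0 p0 \<noteq> 0" by (rule exE)
  define q where "q x = inverse (B k x p0)" for x
  have gBk: "(\<lambda>x. B k x p) \<in> analytic_germs x0" for p using germB by simp
  have gq: "q \<in> analytic_germs x0"
    unfolding q_def[abs_def] by (rule germ_inverse[OF gBk p0])
  define B' where "B' i x p = B i x p - B i x p0 * q x * B k x p" for i x p
  define H' where "H' x p = H x p - H x p0 * q x * B k x p" for x p
  have "((\<lambda>x. B k x p0) \<longlongrightarrow> B k x0 p0) (nhds x0)"
    by (rule isCont_tendsto_compose[OF germ_continuous[OF gBk] filterlim_ident])
  then have ev0: "\<forall>\<^sub>F x in nhds x0. B k x p0 \<noteq> 0"
    using p0 by (rule tendsto_imp_eventually_ne)
  have "\<exists>a. (\<forall>i\<in>I. a i \<in> analytic_germs x0) \<and> (\<forall>\<^sub>F x in nhds x0. \<forall>p. H' x p = (\<Sum>i\<in>I. a i x * B' i x p))"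
  proof (rule insert.IH)
    fix i p assume "i \<in> I"
    then have "(\<lambda>x. B i x p) \<in> analytic_germs x0" for p using germB by simp
    then show "(\<lambda>x. B' i x p) \<in> analytic_germs x0"
      unfolding B'_def by (intro germ_diff germ_mult gq gBk)
  next
    fix p show "(\<lambda>x. H' x p) \<in> analytic_germs x0"
      unfolding H'_def by (intro germ_diff germ_mult gq gBk germH)
  next
    fix a assume a: "\<And>p. (\<Sum>i\<in>I. a i * B' i x0 p) = 0"
    define b where "b = a(k := - (\<Sum>i\<in>I. a i * B i x0 p0 * q x0))"
    have "\<forall>i\<in>insert k I. b i = 0"
    proof (rule indep)
      fix p
      have "(\<Sum>i\<in>insert k I. b i * B i x0 p) = b k * B k x0 p + (\<Sum>i\<in>I. a i * B i x0 p)"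
        using insert.hyps unfolding b_def by (auto intro!: sum.cong)
      also have "\<dots> = (\<Sum>i\<in>I. a i * B' i x0 p)"
        unfolding B'_def b_def by (simp add: right_diff_distrib sum_subtractf sum_distrib_right mult.assoc)
      finally show "(\<Sum>i\<in>insert k I. b i * B i x0 p) = 0" using a by simp
    qed
    then show "\<forall>i\<in>I. a i = 0" using insert.hyps unfolding b_def by (auto split: if_splits)
  next
    show "\<forall>\<^sub>F x in nhds x0. \<exists>a. \<forall>p. H' x p = (\<Sum>i\<in>I. a i * B' i x p)"
      using ev0 insert.prems(4)
    proof eventually_elim
      case (elim x)
      from elim(2) obtain a where "\<forall>p. H x p = (\<Sum>i\<in>insert k I. a i * B i x p)" by (rule exE)
      then have a: "H x p = a k * B k x p + (\<Sum>i\<in>I. a i * B i x p)" for p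
        using insert.hyps by simp
      have bq: "B k x p0 * q x = 1" using elim(1) by (simp add: q_def)
      have "H x p0 * q x = a k * (B k x p0 * q x) + (\<Sum>i\<in>I. a i * B i x p0 * q x)"
        unfolding a[of p0] by (simp add: ring_distribs sum_distrib_right mult.assoc)
      then have e: "H x p0 * q x = a k + (\<Sum>i\<in>I. a i * B i x p0 * q x)" unfolding bq by simp
      have "H' x p = (\<Sum>i\<in>I. a i * B' i x p)" for p
      proof -
        have "H' x p = (\<Sum>i\<in>I. a i * B i x p) - (\<Sum>i\<in>I. a i * B i x p0 * q x) * B k x p"
          unfolding H'_def e unfolding a[of p] by (simp add: ring_distribs)
        also have "\<dots> = (\<Sum>i\<in>I. a i * B' i x p)"
          unfolding B'_def by (simp add: right_diff_distrib sum_subtractf sum_distrib_right mult.assoc)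
        finally show ?thesis .
      qed
      then show ?case by (intro exI[of _ a] allI)
    qed
  qed
  then obtain a where a: "(\<forall>i\<in>I. a i \<in> analytic_germs x0) \<and> (\<forall>\<^sub>F x in nhds x0. \<forall>p. H' x p = (\<Sum>i\<in>I. a i x * B' i x p))"
    by (rule exE)
  have ga: "a i \<in> analytic_germs x0" if "i \<in> I" for i using a that by simp
  define ak where "ak x = q x * (H x p0 - (\<Sum>i\<in>I. a i x * B i x p0))" for x
  \<comment> \<open>The pivot coefficient is determined by the equation at \<open>p0\<close>.\<close>
  define b where "b = a(k := ak)"
  have gak: "ak \<in> analytic_germs x0"
    unfolding ak_def[abs_def]
    by (intro germ_mult gq germ_diff germH germ_sum ga germB) simp_all
  show ?case
  proof (intro exI[of _ b] conjI ballI)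
    fix i assume "i \<in> insert k I"
    then show "b i \<in> analytic_germs x0" using gak ga unfolding b_def by (cases "i = k") simp_all
  next
    have "\<forall>\<^sub>F x in nhds x0. \<forall>p. H' x p = (\<Sum>i\<in>I. a i x * B' i x p)" using a by simp
    then show "\<forall>\<^sub>F x in nhds x0. \<forall>p. H x p = (\<Sum>i\<in>insert k I. b i x * B i x p)"
    proof eventually_elim
      case (elim x)
      show ?case
      proof
        fix p
        have "(\<Sum>i\<in>insert k I. b i x * B i x p) = ak x * B k x p + (\<Sum>i\<in>I. a i x * B i x p)"
          using insert.hyps unfolding b_def by (auto intro!: sum.cong)
        also have "\<dots> = (\<Sum>i\<in>I. a i x * B' i x p) + H x p0 * q x * B k x p"
          unfolding ak_def B'_def
          by (simp add: ring_distribs sum_subtractf sum_distrib_right sum_distrib_left mult_ac)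
        also have "\<dots> = H x p" unfolding elim[rule_format, symmetric] H'_def by simp
        finally show "H x p = (\<Sum>i\<in>insert k I. b i x * B i x p)" by simp
      qed
    qed
  qed
qed

lemma germ_partial:
  assumes "g \<in> analytic_germs x0"
  shows "partial_deriv i g \<in> analytic_germs x0"
proof -
  obtain U where U: "open U" "x0 \<in> U" "cdiff_on U g" using germ_domain[OF assms] .
  then show ?thesis unfolding analytic_germs_iff using cdiff_on_partial[OF U(3,1)] by (intro exI[of _ U]) simp
qed

text \<open>The coefficients are finitely many, so there is a domain of \<open>x\<close> that does not
  depend on the point \<open>P\<close>.\<close>

lemma germ_forms_domain:
  fixes x0 :: "complex^'n"
  assumes "H \<in> germ_forms x0 k"
  shows "\<exists>U H'. open U \<and> x0 \<in> U \<and> H' \<in> germ_forms x0 k \<and> (\<forall>z1 z2 t. cdiff_on U (\<lambda>x. H x z1 z2 t)) \<and>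
    (\<forall>x\<in>U. \<forall>z1 z2 t. partial_deriv i (\<lambda>y. H y z1 z2 t) x = H' x z1 z2 t)"
proof -
  obtain h where h: "\<And>j \<gamma>. h j \<gamma> \<in> analytic_germs x0" "H = numerator k h" using germ_formsE[OF assms] by metis
  let ?S = "{\<gamma> :: 'n \<Rightarrow> nat. mdeg \<gamma> = k}"
  let ?G = "(\<lambda>(j, \<gamma>). h j \<gamma>) ` ({..k} \<times> ?S)"
  have "finite ?G" by (intro finite_imageI finite_cartesian_product finite_multidegree_eq finite_atMost)
  moreover have "?G \<subseteq> analytic_germs x0" using h(1) by auto
  ultimately have "\<exists>U. open U \<and> x0 \<in> U \<and> (\<forall>g\<in>?G. cdiff_on U g)" by (rule germs_common_domain)
  then obtain U where U: "open U \<and> x0 \<in> U \<and> (\<forall>g\<in>?G. cdiff_on U g)" by (rule exE)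
  have cU: "cdiff_on U (h j \<gamma>)" if "j \<in> {..k}" "\<gamma> \<in> ?S" for j \<gamma>
  proof -
    have "h j \<gamma> \<in> ?G" using that by (intro rev_image_eqI[of "(j, \<gamma>)"]) simp_all
    then show ?thesis by (rule bspec[OF conjunct2[OF conjunct2[OF U]]])
  qed
  let ?m = "\<lambda>j \<gamma> z1 z2 t. z1^j * z2^(k - j) * monomial (\<lambda>i. t $ i) \<gamma>"
  have H: "H x z1 z2 t = (\<Sum>j\<le>k. \<Sum>\<gamma>\<in>?S. ?m j \<gamma> z1 z2 t * h j \<gamma> x)" for x z1 z2 t
    unfolding h(2) numerator_monomial by (simp add: mult_ac)
  have cterm: "cdiff_on U (\<lambda>x. ?m j \<gamma> z1 z2 t * h j \<gamma> x)" if "j \<in> {..k}" "\<gamma> \<in> ?S" for j \<gamma> z1 z2 t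
    by (rule cdiff_on_mult[OF cdiff_on_const cU[OF that]])
  have part: "partial_deriv i (\<lambda>y. H y z1 z2 t) x = numerator k (\<lambda>j \<gamma>. partial_deriv i (h j \<gamma>)) x z1 z2 t"
    if x: "x \<in> U" for x z1 z2 t
  proof -
    have "partial_deriv i (\<lambda>y. H y z1 z2 t) x = (\<Sum>j\<le>k. partial_deriv i (\<lambda>x. \<Sum>\<gamma>\<in>?S. ?m j \<gamma> z1 z2 t * h j \<gamma> x) x)"
      unfolding H by (rule partial_deriv_sum[OF cdiff_on_sum[OF cterm] x])
    also have "\<dots> = (\<Sum>j\<le>k. \<Sum>\<gamma>\<in>?S. partial_deriv i (\<lambda>x. ?m j \<gamma> z1 z2 t * h j \<gamma> x) x)"
      by (rule sum.cong[OF refl]) (rule partial_deriv_sum[OF cterm x])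
    also have "\<dots> = (\<Sum>j\<le>k. \<Sum>\<gamma>\<in>?S. ?m j \<gamma> z1 z2 t * partial_deriv i (h j \<gamma>) x)"
      by (intro sum.cong refl) (rule partial_deriv_cmult[OF cU x])
    finally show ?thesis unfolding numerator_monomial by (simp add: mult_ac)
  qed
  have "numerator k (\<lambda>j \<gamma>. partial_deriv i (h j \<gamma>)) \<in> germ_forms x0 k"
    by (rule germ_formsI) (rule germ_partial[OF h(1)])
  moreover have "\<forall>z1 z2 t. cdiff_on U (\<lambda>x. H x z1 z2 t)"
    unfolding H by (intro allI cdiff_on_sum cterm)
  ultimately show ?thesis
    using U part by (intro exI[of _ U] exI[of _ "numerator k (\<lambda>j \<gamma>. partial_deriv i (h j \<gamma>))"]) simp
qed

context glued_pencil
begin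

section \<open>The module of glued functions\<close>

definition exp_factor :: "complex^'n \<Rightarrow> complex \<Rightarrow> complex \<Rightarrow> complex^'n \<Rightarrow> complex" where
  "exp_factor x z1 z2 t = exp (\<Sum>j\<in>UNIV. F j z1 z2 t / f z1 z2 t * x $ j)"

definition glues :: "complex \<Rightarrow> complex^'n \<Rightarrow> 'n xfun \<Rightarrow> bool" where
  "glues \<Lambda> x0 \<psi> \<longleftrightarrow> (\<forall>\<^sub>F x in nhds x0. \<forall>t. f a1 b1 t \<noteq> 0 \<and> f a2 b2 (T *v t) \<noteq> 0 \<longrightarrow>
     \<psi> x a1 b1 t - \<Lambda> * \<psi> x a2 b2 (T *v t) = 0)"

definition glued_level :: "complex \<Rightarrow> complex^'n \<Rightarrow> nat \<Rightarrow> 'n xfun set" where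
  "glued_level \<Lambda> x0 k = BA_level a1 b1 a2 b2 T \<Lambda> f F x0 k"

lemma glued_level_iff: "\<psi> \<in> glued_level \<Lambda> x0 k \<longleftrightarrow>
    (\<exists>H. H \<in> germ_forms x0 k \<and> germ_eq x0 f \<psi> (\<lambda>x z1 z2 t. H x z1 z2 t / f z1 z2 t ^ k * exp_factor x z1 z2 t)) \<and> glues \<Lambda> x0 \<psi>"
  unfolding glued_level_def BA_level_def glues_def exp_factor_def germ_forms_def mem_Collect_eq by auto

lemma glued_level_form:
  "\<psi> \<in> glued_level \<Lambda> x0 k \<Longrightarrow>
    \<exists>H. H \<in> germ_forms x0 k \<and> germ_eq x0 f \<psi> (\<lambda>x z1 z2 t. H x z1 z2 t / f z1 z2 t ^ k * exp_factor x z1 z2 t)"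
  unfolding glued_level_iff by (rule conjunct1)

text \<open>Numerator and denominator are multiplied by \<open>f\<close>.\<close>

lemma glued_level_Suc:
  assumes "\<psi> \<in> glued_level \<Lambda> x0 k"
  shows "\<psi> \<in> glued_level \<Lambda> x0 (Suc k)"
proof -
  obtain H where H: "H \<in> germ_forms x0 k \<and> germ_eq x0 f \<psi> (\<lambda>x z1 z2 t. H x z1 z2 t / f z1 z2 t ^ k * exp_factor x z1 z2 t)"
    using glued_level_form[OF assms] by (rule exE)
  have "(\<lambda>x z1 z2 t. f z1 z2 t * H x z1 z2 t) \<in> germ_forms x0 (Suc k)"
    unfolding f by (rule germ_forms_times_form11) (use H in simp)
  moreover have "germ_eq x0 f \<psi> (\<lambda>x z1 z2 t. f z1 z2 t * H x z1 z2 t / f z1 z2 t ^ Suc k * exp_factor x z1 z2 t)"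
    using H unfolding germ_eq_def by (auto elim!: eventually_mono)
  ultimately show ?thesis using assms unfolding glued_level_iff by blast
qed

lemma glued_level_mono: "k \<le> l \<Longrightarrow> \<psi> \<in> glued_level \<Lambda> x0 k \<Longrightarrow> \<psi> \<in> glued_level \<Lambda> x0 l"
  by (induction l rule: dec_induct) (auto intro: glued_level_Suc)

lemma glued_level_zero: "(\<lambda>x z1 z2 t. 0) \<in> glued_level \<Lambda> x0 k"
  unfolding glued_level_iff
  by (intro conjI exI[of _ "\<lambda>x z1 z2 t. 0"] germ_forms_zero) (simp_all add: germ_eq_def glues_def)

lemma glued_level_add:
  assumes "\<psi> \<in> glued_level \<Lambda> x0 k" "\<psi>' \<in> glued_level \<Lambda> x0 k"
  shows "(\<lambda>x z1 z2 t. \<psi> x z1 z2 t + \<psi>' x z1 z2 t) \<in> glued_level \<Lambda> x0 k"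
proof -
  obtain H where H: "H \<in> germ_forms x0 k \<and> germ_eq x0 f \<psi> (\<lambda>x z1 z2 t. H x z1 z2 t / f z1 z2 t ^ k * exp_factor x z1 z2 t)"
    using glued_level_form[OF assms(1)] by (rule exE)
  obtain H' where H': "H' \<in> germ_forms x0 k \<and> germ_eq x0 f \<psi>' (\<lambda>x z1 z2 t. H' x z1 z2 t / f z1 z2 t ^ k * exp_factor x z1 z2 t)"
    using glued_level_form[OF assms(2)] by (rule exE)
  have gl: "glues \<Lambda> x0 \<psi>" "glues \<Lambda> x0 \<psi>'" using assms unfolding glued_level_iff by simp_all
  show ?thesis
    unfolding glued_level_iff
  proof (intro conjI exI[of _ "\<lambda>x z1 z2 t. H x z1 z2 t + H' x z1 z2 t"])
    show "(\<lambda>x z1 z2 t. H x z1 z2 t + H' x z1 z2 t) \<in> germ_forms x0 k"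
      using H H' by (intro germ_forms_add) simp_all
    from H H' have ev: "\<forall>\<^sub>F x in nhds x0. \<forall>z1 z2 t. f z1 z2 t \<noteq> 0 \<longrightarrow> \<psi> x z1 z2 t = H x z1 z2 t / f z1 z2 t ^ k * exp_factor x z1 z2 t"
      "\<forall>\<^sub>F x in nhds x0. \<forall>z1 z2 t. f z1 z2 t \<noteq> 0 \<longrightarrow> \<psi>' x z1 z2 t = H' x z1 z2 t / f z1 z2 t ^ k * exp_factor x z1 z2 t"
      unfolding germ_eq_def by simp_all
    show "germ_eq x0 f (\<lambda>x z1 z2 t. \<psi> x z1 z2 t + \<psi>' x z1 z2 t)
       (\<lambda>x z1 z2 t. (H x z1 z2 t + H' x z1 z2 t) / f z1 z2 t ^ k * exp_factor x z1 z2 t)"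
      unfolding germ_eq_def using ev by eventually_elim (simp add: add_divide_distrib ring_distribs)
    show "glues \<Lambda> x0 (\<lambda>x z1 z2 t. \<psi> x z1 z2 t + \<psi>' x z1 z2 t)"
      using gl unfolding glues_def by eventually_elim (simp add: ring_distribs)
  qed
qed

lemma glued_level_mult:
  assumes a: "a \<in> analytic_germs x0" and \<psi>: "\<psi> \<in> glued_level \<Lambda> x0 k"
  shows "(\<lambda>x z1 z2 t. a x * \<psi> x z1 z2 t) \<in> glued_level \<Lambda> x0 k"
proof -
  obtain H where H: "H \<in> germ_forms x0 k \<and> germ_eq x0 f \<psi> (\<lambda>x z1 z2 t. H x z1 z2 t / f z1 z2 t ^ k * exp_factor x z1 z2 t)"
    using glued_level_form[OF \<psi>] by (rule exE)
  have gl: "glues \<Lambda> x0 \<psi>" using \<psi> unfolding glued_level_iff by simp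
  show ?thesis
    unfolding glued_level_iff
  proof (intro conjI exI[of _ "\<lambda>x z1 z2 t. a x * H x z1 z2 t"])
    show "(\<lambda>x z1 z2 t. a x * H x z1 z2 t) \<in> germ_forms x0 k" using H by (intro germ_forms_germ_mult a) simp
    from H show "germ_eq x0 f (\<lambda>x z1 z2 t. a x * \<psi> x z1 z2 t) (\<lambda>x z1 z2 t. a x * H x z1 z2 t / f z1 z2 t ^ k * exp_factor x z1 z2 t)"
      unfolding germ_eq_def by (elim conjE eventually_mono) simp
    from gl show "glues \<Lambda> x0 (\<lambda>x z1 z2 t. a x * \<psi> x z1 z2 t)"
      unfolding glues_def by (elim eventually_mono) (simp add: mult.left_commute)
  qed
qed

lemma cdiff_on_exp_factor: "cdiff_on U (\<lambda>x. exp_factor x z1 z2 t)"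
  unfolding exp_factor_def by (intro cdiff_on_exp cdiff_on_linear)

text \<open>With \<open>\<psi> = h / f^k exp(\<dots>)\<close> the new numerator is \<open>f \<partial>_i h +
  F_i h\<close>. The gluing condition holds for all \<open>x\<close> in an open set, so it can be
  differentiated.\<close>

lemma glued_level_partial:
  assumes \<psi>: "\<psi> \<in> glued_level \<Lambda> x0 k"
  shows "(\<lambda>x z1 z2 t. partial_deriv i (\<lambda>y. \<psi> y z1 z2 t) x) \<in> glued_level \<Lambda> x0 (Suc k)"
proof -
  obtain H where H: "H \<in> germ_forms x0 k \<and> germ_eq x0 f \<psi> (\<lambda>x z1 z2 t. H x z1 z2 t / f z1 z2 t ^ k * exp_factor x z1 z2 t)"
    using glued_level_form[OF \<psi>] by (rule exE)
  have "\<exists>U. open U \<and> x0 \<in> U \<and> (\<forall>x\<in>U. \<forall>z1 z2 t. f z1 z2 t \<noteq> 0 \<longrightarrow> \<psi> x z1 z2 t = H x z1 z2 t / f z1 z2 t ^ k * exp_factor x z1 z2 t)"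
    using H unfolding germ_eq_def eventually_nhds by simp
  then obtain U1 where U1: "open U1 \<and> x0 \<in> U1 \<and>
      (\<forall>x\<in>U1. \<forall>z1 z2 t. f z1 z2 t \<noteq> 0 \<longrightarrow> \<psi> x z1 z2 t = H x z1 z2 t / f z1 z2 t ^ k * exp_factor x z1 z2 t)" by (rule exE)
  have "\<exists>U. open U \<and> x0 \<in> U \<and> (\<forall>x\<in>U. \<forall>t. f a1 b1 t \<noteq> 0 \<and> f a2 b2 (T *v t) \<noteq> 0 \<longrightarrow>
     \<psi> x a1 b1 t - \<Lambda> * \<psi> x a2 b2 (T *v t) = 0)"
    using \<psi> unfolding glued_level_iff glues_def eventually_nhds by simp
  then obtain U2 where U2: "open U2 \<and> x0 \<in> U2 \<and> (\<forall>x\<in>U2. \<forall>t. f a1 b1 t \<noteq> 0 \<and> f a2 b2 (T *v t) \<noteq> 0 \<longrightarrow>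
     \<psi> x a1 b1 t - \<Lambda> * \<psi> x a2 b2 (T *v t) = 0)" by (rule exE)
  have "H \<in> germ_forms x0 k" using H by simp
  from germ_forms_domain[OF this, of i] obtain U3 where "\<exists>H'. open U3 \<and> x0 \<in> U3 \<and> H' \<in> germ_forms x0 k \<and>
     (\<forall>z1 z2 t. cdiff_on U3 (\<lambda>x. H x z1 z2 t)) \<and>
     (\<forall>x\<in>U3. \<forall>z1 z2 t. partial_deriv i (\<lambda>y. H y z1 z2 t) x = H' x z1 z2 t)" by (rule exE)
  then obtain H' where U3: "open U3 \<and> x0 \<in> U3 \<and> H' \<in> germ_forms x0 k \<and>
     (\<forall>z1 z2 t. cdiff_on U3 (\<lambda>x. H x z1 z2 t)) \<and>
     (\<forall>x\<in>U3. \<forall>z1 z2 t. partial_deriv i (\<lambda>y. H y z1 z2 t) x = H' x z1 z2 t)" by (rule exE)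
  define U where "U = U1 \<inter> U2 \<inter> U3"
  have U: "open U" "x0 \<in> U" using U1 U2 U3 by (simp_all add: U_def open_Int)
  let ?g = "\<lambda>z1 z2 t y. H y z1 z2 t / f z1 z2 t ^ k * exp_factor y z1 z2 t"
  have eq: "\<psi> y z1 z2 t = ?g z1 z2 t y" if "y \<in> U" "f z1 z2 t \<noteq> 0" for y z1 z2 t
    using U1 that by (simp add: U_def)
  have cH: "cdiff_on U (\<lambda>y. H y z1 z2 t)" for z1 z2 t
    by (rule cdiff_on_subset[of U3]) (use U3 in \<open>simp_all add: U_def\<close>)
  have cHf: "cdiff_on U (\<lambda>y. H y z1 z2 t / f z1 z2 t ^ k)" for z1 z2 t
    unfolding divide_inverse by (intro cdiff_on_mult cH cdiff_on_const)
  have cg: "cdiff_on U (?g z1 z2 t)" for z1 z2 t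
    by (intro cdiff_on_mult cHf cdiff_on_exp_factor)
  have c\<psi>: "cdiff_on U (\<lambda>y. \<psi> y z1 z2 t)" if "f z1 z2 t \<noteq> 0" for z1 z2 t
    by (rule cdiff_on_cong[OF U(1) _ cg[of z1 z2 t]]) (simp add: eq that)
  have part: "partial_deriv i (\<lambda>y. \<psi> y z1 z2 t) x =
      (f z1 z2 t * H' x z1 z2 t + F i z1 z2 t * H x z1 z2 t) / f z1 z2 t ^ Suc k * exp_factor x z1 z2 t"
    if x: "x \<in> U" and nz: "f z1 z2 t \<noteq> 0" for x z1 z2 t
  proof -
    have "partial_deriv i (\<lambda>y. \<psi> y z1 z2 t) x = partial_deriv i (?g z1 z2 t) x"
      by (rule partial_deriv_cong[OF U(1) x]) (rule eq[OF _ nz])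
    also have "\<dots> = partial_deriv i (\<lambda>y. H y z1 z2 t / f z1 z2 t ^ k) x * exp_factor x z1 z2 t
        + H x z1 z2 t / f z1 z2 t ^ k * partial_deriv i (\<lambda>y. exp_factor y z1 z2 t) x"
      by (rule partial_deriv_mult[OF cHf cdiff_on_exp_factor x])
    also have "partial_deriv i (\<lambda>y. exp_factor y z1 z2 t) x = F i z1 z2 t / f z1 z2 t * exp_factor x z1 z2 t"
      unfolding exp_factor_def by (rule partial_deriv_exp_linear)
    also have "partial_deriv i (\<lambda>y. H y z1 z2 t / f z1 z2 t ^ k) x = H' x z1 z2 t / f z1 z2 t ^ k"
      using partial_deriv_cmult[OF cH[of z1 z2 t] x, of i "1 / f z1 z2 t ^ k"] U3 x by (simp add: U_def)
    finally show ?thesis using nz by (simp add: field_simps)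
  qed
  show ?thesis
    unfolding glued_level_iff
  proof (intro conjI exI[of _ "\<lambda>x z1 z2 t. f z1 z2 t * H' x z1 z2 t + F i z1 z2 t * H x z1 z2 t"])
    show "(\<lambda>x z1 z2 t. f z1 z2 t * H' x z1 z2 t + F i z1 z2 t * H x z1 z2 t) \<in> germ_forms x0 (Suc k)"
      unfolding f F by (intro germ_forms_add germ_forms_times_form11) (use H U3 in simp_all)
    show "germ_eq x0 f (\<lambda>x z1 z2 t. partial_deriv i (\<lambda>y. \<psi> y z1 z2 t) x)
       (\<lambda>x z1 z2 t. (f z1 z2 t * H' x z1 z2 t + F i z1 z2 t * H x z1 z2 t) / f z1 z2 t ^ Suc k * exp_factor x z1 z2 t)"
      unfolding germ_eq_def eventually_nhds using U part by (intro exI[of _ U]) simp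
    have "partial_deriv i (\<lambda>y. \<psi> y a1 b1 t) x = \<Lambda> * partial_deriv i (\<lambda>y. \<psi> y a2 b2 (T *v t)) x"
      if x: "x \<in> U" and nz: "f a1 b1 t \<noteq> 0" "f a2 b2 (T *v t) \<noteq> 0" for x t
    proof -
      have "partial_deriv i (\<lambda>y. \<psi> y a1 b1 t) x = partial_deriv i (\<lambda>y. \<Lambda> * \<psi> y a2 b2 (T *v t)) x"
        by (rule partial_deriv_cong[OF U(1) x]) (use U2 nz in \<open>simp add: U_def\<close>)
      also have "\<dots> = \<Lambda> * partial_deriv i (\<lambda>y. \<psi> y a2 b2 (T *v t)) x"
        by (rule partial_deriv_cmult[OF c\<psi>[OF nz(2)] x])
      finally show ?thesis .
    qed
    then show "glues \<Lambda> x0 (\<lambda>x z1 z2 t. partial_deriv i (\<lambda>y. \<psi> y z1 z2 t) x)"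
      unfolding glues_def eventually_nhds using U by (intro exI[of _ U]) simp
  qed
qed

definition glued_functions :: "complex \<Rightarrow> complex^'n \<Rightarrow> 'n xfun set" where
  "glued_functions \<Lambda> x0 = BA_module a1 b1 a2 b2 T \<Lambda> f F x0"

lemma glued_functions_iff: "\<psi> \<in> glued_functions \<Lambda> x0 \<longleftrightarrow> (\<exists>k\<ge>1. \<psi> \<in> glued_level \<Lambda> x0 k)"
  unfolding glued_functions_def BA_module_def glued_level_def by auto

lemma glued_functions_add:
  assumes "\<psi> \<in> glued_functions \<Lambda> x0" "\<psi>' \<in> glued_functions \<Lambda> x0"
  shows "(\<lambda>x z1 z2 t. \<psi> x z1 z2 t + \<psi>' x z1 z2 t) \<in> glued_functions \<Lambda> x0"
proof -
  obtain k where k: "k \<ge> 1 \<and> \<psi> \<in> glued_level \<Lambda> x0 k" using assms(1) unfolding glued_functions_iff by (rule exE)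
  obtain l where l: "l \<ge> 1 \<and> \<psi>' \<in> glued_level \<Lambda> x0 l" using assms(2) unfolding glued_functions_iff by (rule exE)
  have "\<psi> \<in> glued_level \<Lambda> x0 (max k l)" by (rule glued_level_mono[of k]) (use k in simp_all)
  moreover have "\<psi>' \<in> glued_level \<Lambda> x0 (max k l)" by (rule glued_level_mono[of l]) (use l in simp_all)
  ultimately have "(\<lambda>x z1 z2 t. \<psi> x z1 z2 t + \<psi>' x z1 z2 t) \<in> glued_level \<Lambda> x0 (max k l)" by (rule glued_level_add)
  then show ?thesis unfolding glued_functions_iff using k by (intro exI[of _ "max k l"]) (simp add: le_max_iff_disj)
qed

lemma diff_module_glued_functions: "diff_module x0 (glued_functions \<Lambda> x0)"
  unfolding diff_module_def
proof (intro conjI ballI)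
  show "(\<lambda>x z1 z2 t. 0) \<in> glued_functions \<Lambda> x0" unfolding glued_functions_iff using glued_level_zero by blast
  show "(\<lambda>x z1 z2 t. \<psi> x z1 z2 t + \<phi> x z1 z2 t) \<in> glued_functions \<Lambda> x0"
    if "\<psi> \<in> glued_functions \<Lambda> x0" "\<phi> \<in> glued_functions \<Lambda> x0" for \<psi> \<phi> by (rule glued_functions_add[OF that])
  fix L \<psi> assume "L \<in> diff_ops x0" "\<psi> \<in> glued_functions \<Lambda> x0"
  then show "act L \<psi> \<in> glued_functions \<Lambda> x0"
  proof (induction arbitrary: \<psi> rule: diff_ops.induct)
    case (mult a)
    obtain k where k: "k \<ge> 1 \<and> \<psi> \<in> glued_level \<Lambda> x0 k" using mult.prems unfolding glued_functions_iff by (rule exE)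
    then have "(\<lambda>x z1 z2 t. a x * \<psi> x z1 z2 t) \<in> glued_level \<Lambda> x0 k" by (intro glued_level_mult mult.hyps) simp
    then show ?case unfolding glued_functions_iff act_def using k by blast
  next
    case (partial j)
    obtain k where k: "k \<ge> 1 \<and> \<psi> \<in> glued_level \<Lambda> x0 k" using partial.prems unfolding glued_functions_iff by (rule exE)
    then have "(\<lambda>x z1 z2 t. partial_deriv j (\<lambda>y. \<psi> y z1 z2 t) x) \<in> glued_level \<Lambda> x0 (Suc k)"
      by (intro glued_level_partial) simp
    then show ?case unfolding glued_functions_iff act_def by (intro exI[of _ "Suc k"]) simp
  next
    case (add L L')
    have "act (\<lambda>g x. L g x + L' g x) \<psi> = (\<lambda>x z1 z2 t. act L \<psi> x z1 z2 t + act L' \<psi> x z1 z2 t)"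
      by (simp add: act_def)
    then show ?case using glued_functions_add[OF add.IH(1)[OF add.prems] add.IH(2)[OF add.prems]] by (simp only:)
  next
    case (comp L L')
    have "act (\<lambda>g. L (L' g)) \<psi> = act L (act L' \<psi>)" by (simp add: act_def)
    then show ?case using comp.IH(1)[OF comp.IH(2)[OF comp.prems]] by (simp only:)
  qed
qed

end

section \<open>The free basis\<close>

lemma sum_count_list_UNIV: "(\<Sum>j\<in>UNIV. count_list w (j :: 'n::finite)) = length w"
proof (induction w)
  case (Cons i w)
  have "(\<Sum>j\<in>UNIV. count_list (i # w) j) = (\<Sum>j\<in>UNIV. (if j = i then 1 else 0) + count_list w j)"
    by (intro sum.cong) auto
  then show ?case using Cons by (simp add: sum.distrib)
qed simp

lemma germ_forms_point_germ:
  assumes "H \<in> germ_forms x0 k"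
  shows "(\<lambda>x. H x z1 z2 t) \<in> analytic_germs x0"
proof -
  obtain h where h: "\<And>j \<gamma>. h j \<gamma> \<in> analytic_germs x0" "H = numerator k h" using germ_formsE[OF assms] by metis
  show ?thesis unfolding h(2) numerator_def by (intro germ_sum germ_mult h(1) const_germ)
qed

context glued_pencil
begin

text \<open>Numerators satisfy the gluing condition a priori only where \<open>f(p1, t) \<noteq> 0\<close>;
  by density it holds for all \<open>t\<close>.\<close>

lemma f_p1_dense:
  assumes cont: "continuous_on UNIV (G :: complex^'n \<Rightarrow> complex)"
    and zero: "\<And>t. f a1 b1 t \<noteq> 0 \<Longrightarrow> G t = 0"
  shows "G t = 0"
proof (cases "f a1 b1 t = 0")
  case True
  fix j :: 'n
  have "((\<lambda>s. t + s *s w j) \<longlongrightarrow> t + 0 *s w j) (at 0)"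
    by (rule vec_tendstoI, unfold vector_add_component vector_smult_component)
       (intro tendsto_add tendsto_mult tendsto_const tendsto_ident_at)
  moreover have "isCont G (t + 0 *s w j)" using cont by (simp add: continuous_on_eq_continuous_at)
  ultimately have lim: "((\<lambda>s. G (t + s *s w j)) \<longlongrightarrow> G (t + 0 *s w j)) (at 0)"
    by (rule isCont_tendsto_compose[rotated])
  have "\<forall>\<^sub>F s in at (0::complex). s \<noteq> 0" by (rule eventually_neq_at_within)
  then have "\<forall>\<^sub>F s in at 0. G (t + s *s w j) = 0"
  proof eventually_elim
    case (elim s)
    have "f a1 b1 (t + s *s w j) = s * f a1 b1 (w j)"
      using True unfolding f by (simp add: form11_add form11_scale)
    then have "f a1 b1 (t + s *s w j) \<noteq> 0" using elim f_eigenvectors[of j] by simp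
    then show ?case by (rule zero)
  qed
  then have "((\<lambda>s. 0) \<longlongrightarrow> G (t + 0 *s w j)) (at (0::complex))"
    by (rule Lim_transform_eventually[OF lim])
  then show ?thesis by (simp add: tendsto_const_iff)
qed (rule zero)

text \<open>The factor that the gluing condition imposes on numerators; the exponential factors of the two
  glued points account for the dependence on \<open>x\<close>.\<close>

definition rho :: "complex \<Rightarrow> complex^'n \<Rightarrow> complex" where
  "rho \<Lambda> x = \<Lambda> * exp (\<Sum>j\<in>UNIV. - c j * x $ j)"

lemma rho_germ: "rho \<Lambda> \<in> analytic_germs x0"
proof -
  have "cdiff_on UNIV (rho \<Lambda>)"
    unfolding rho_def[abs_def] by (intro cdiff_on_mult cdiff_on_const cdiff_on_exp cdiff_on_linear)
  then show ?thesis unfolding analytic_germs_iff by (intro exI[of _ UNIV]) simp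
qed

lemma rho_neq_1_iff: "rho \<Lambda> x \<noteq> 1 \<longleftrightarrow> \<Lambda> \<noteq> exp (\<Sum>j\<in>UNIV. c j * x $ j)"
  by (simp add: rho_def sum_negf exp_minus field_simps)

lemma rho_neq_1_near:
  assumes "\<Lambda> \<noteq> exp (\<Sum>j\<in>UNIV. c j * x0 $ j)"
  shows "\<forall>\<^sub>F x in nhds x0. rho \<Lambda> x \<noteq> 1"
proof -
  have "(rho \<Lambda> \<longlongrightarrow> rho \<Lambda> x0) (nhds x0)"
    by (rule isCont_tendsto_compose[OF germ_continuous[OF rho_germ] filterlim_ident])
  then show ?thesis using assms unfolding rho_neq_1_iff[symmetric] by (rule tendsto_imp_eventually_ne)
qed

lemma exp_factor_glue:
  assumes "f a1 b1 t \<noteq> 0"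
  shows "exp_factor x a1 b1 t = exp (\<Sum>j\<in>UNIV. c j * x $ j) * exp_factor x a2 b2 (T *v t)"
proof -
  have f2: "A * f a2 b2 (T *v t) = f a1 b1 t" by (rule f_p2)
  then have nz: "f a2 b2 (T *v t) \<noteq> 0" using assms by auto
  have "F j a1 b1 t / f a1 b1 t = c j + F j a2 b2 (T *v t) / f a2 b2 (T *v t)" for j
  proof -
    have "F j a1 b1 t = c j * f a1 b1 t + A * F j a2 b2 (T *v t)" using F_glue[of j t] by (simp add: algebra_simps)
    then show ?thesis using A nz by (simp add: f2[symmetric] add_divide_distrib)
  qed
  then show ?thesis unfolding exp_factor_def by (simp add: exp_add[symmetric] sum.distrib[symmetric] ring_distribs)
qed

lemma numerator_glue_iff:
  assumes "f a1 b1 t \<noteq> 0"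
  shows "h1 / f a1 b1 t ^ k * exp_factor x a1 b1 t - \<Lambda> * (h2 / f a2 b2 (T *v t) ^ k * exp_factor x a2 b2 (T *v t)) = 0
    \<longleftrightarrow> h1 = rho \<Lambda> x * A ^ k * h2"
proof -
  have f2: "A * f a2 b2 (T *v t) = f a1 b1 t" by (rule f_p2)
  then have nz: "f a2 b2 (T *v t) \<noteq> 0" using assms by auto
  define e where "e = exp (\<Sum>j\<in>UNIV. c j * x $ j)"
  define r where "r = rho \<Lambda> x"
  have e: "e \<noteq> 0" "\<Lambda> = r * e" by (simp_all add: e_def r_def rho_def sum_negf exp_minus)
  have ex: "exp_factor x a2 b2 (T *v t) \<noteq> 0" by (simp add: exp_factor_def)
  have "h1 / f a1 b1 t ^ k * exp_factor x a1 b1 t - \<Lambda> * (h2 / f a2 b2 (T *v t) ^ k * exp_factor x a2 b2 (T *v t))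
    = (h1 - r * A ^ k * h2) * (e * exp_factor x a2 b2 (T *v t) / f a1 b1 t ^ k)"
    unfolding exp_factor_glue[OF assms] e_def[symmetric] e(2) f2[symmetric] power_mult_distrib
    using A nz by (simp add: field_simps)
  then show ?thesis using e(1) ex assms unfolding r_def[symmetric] by simp
qed

text \<open>The generators, obtained from the forms \<open>\<phi> i\<close> with \<open>\<rho> = rho
  \<Lambda> x\<close>: these are the numerators for \<open>m = 0\<close> and the multi-index 0.\<close>

definition psi :: "complex \<Rightarrow> 'n \<Rightarrow> 'n xfun" where
  "psi \<Lambda> i x z1 z2 t = basis_numerator (rho \<Lambda> x) 0 i (\<lambda>_. 0) z1 z2 t / f z1 z2 t ^ 1 * exp_factor x z1 z2 t"

lemma psi_glued_level: "psi \<Lambda> i \<in> glued_level \<Lambda> x0 1"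
  unfolding glued_level_iff
proof (intro conjI exI[of _ "\<lambda>x z1 z2 t. basis_numerator (rho \<Lambda> x) 0 i (\<lambda>_. 0) z1 z2 t"])
  show "(\<lambda>x z1 z2 t. basis_numerator (rho \<Lambda> x) 0 i (\<lambda>_. 0) z1 z2 t) \<in> germ_forms x0 1"
    using basis_numerator_germ_forms[OF rho_germ, of "\<lambda>_. 0" 0] by simp
  show "germ_eq x0 f (psi \<Lambda> i) (\<lambda>x z1 z2 t. basis_numerator (rho \<Lambda> x) 0 i (\<lambda>_. 0) z1 z2 t / f z1 z2 t ^ 1 * exp_factor x z1 z2 t)"
    by (simp add: germ_eq_def psi_def)
  have "psi \<Lambda> i x a1 b1 t - \<Lambda> * psi \<Lambda> i x a2 b2 (T *v t) = 0" if "f a1 b1 t \<noteq> 0" for x t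
    unfolding psi_def numerator_glue_iff[OF that]
    using basis_numerator_glue[of "\<lambda>_. 0" 0 "rho \<Lambda> x" i t] by simp
  then show "glues \<Lambda> x0 (psi \<Lambda> i)" unfolding glues_def by simp
qed

lemma cdiff_on_psi: "cdiff_on U (\<lambda>y. psi \<Lambda> i y z1 z2 t)"
proof -
  have "cdiff_on U (\<lambda>y. (rho \<Lambda> y * (A * s1 z1 z2 * (T *v t) $ i) + s2 z1 z2 * t $ i) * inverse (f z1 z2 t) * exp_factor y z1 z2 t)"
    unfolding rho_def
    by (intro cdiff_on_mult cdiff_on_add cdiff_on_const cdiff_on_exp cdiff_on_linear cdiff_on_exp_factor)
  then show ?thesis
    unfolding psi_def basis_numerator_def by (simp add: monomial_def divide_inverse mult.assoc)
qed

text \<open>The generator is a sum of two exponentials with exponents \<open>F_j / f - c_j\<close> and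
  \<open>F_j / f\<close>, and a word of derivatives multiplies each by the corresponding monomial.\<close>

lemma word_deriv_psi:
  assumes nz: "f z1 z2 t \<noteq> 0" and len: "(\<Sum>j\<in>UNIV. count_list js j) \<le> m"
  shows "word_deriv js (\<lambda>y. psi \<Lambda> i y z1 z2 t) x =
    basis_numerator (rho \<Lambda> x) m i (count_list js) z1 z2 t / f z1 z2 t ^ Suc m * exp_factor x z1 z2 t"
proof -
  define \<kappa> where "\<kappa> j = F j z1 z2 t / f z1 z2 t" for j
  define u v where "u = \<Lambda> * A * s1 z1 z2 * (T *v t) $ i / f z1 z2 t" and "v = s2 z1 z2 * t $ i / f z1 z2 t"
  let ?e = "\<lambda>c x. exp (\<Sum>j\<in>UNIV. c j * x $ j)"
  have split: "exp (\<Sum>j\<in>UNIV. - c j * y $ j) * ?e \<kappa> y = ?e (\<lambda>j. \<kappa> j - c j) y" for y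
    by (simp add: exp_add[symmetric] sum.distrib[symmetric] ring_distribs)
  have ex: "exp_factor y z1 z2 t = ?e \<kappa> y" for y by (simp add: exp_factor_def \<kappa>_def)
  have "psi \<Lambda> i y z1 z2 t = u * ?e (\<lambda>j. \<kappa> j - c j) y + v * ?e \<kappa> y" for y
    unfolding psi_def basis_numerator_def ex split[symmetric] rho_def u_def v_def using nz
    by (simp add: monomial_def field_simps)
  then have "word_deriv js (\<lambda>y. psi \<Lambda> i y z1 z2 t) x = word_deriv js (\<lambda>y. u * ?e (\<lambda>j. \<kappa> j - c j) y + v * ?e \<kappa> y) x"
    by simp
  also have "\<dots> = word_deriv js (\<lambda>y. u * ?e (\<lambda>j. \<kappa> j - c j) y) x + word_deriv js (\<lambda>y. v * ?e \<kappa> y) x"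
    by (rule word_deriv_add[of UNIV]) (intro cdiff_on_mult cdiff_on_const cdiff_on_exp cdiff_on_linear open_UNIV UNIV_I)+
  also have "\<dots> = u * monomial (\<lambda>j. \<kappa> j - c j) (count_list js) * ?e (\<lambda>j. \<kappa> j - c j) x + v * monomial \<kappa> (count_list js) * ?e \<kappa> x"
    unfolding word_deriv_exp_linear ..
  finally have 1: "word_deriv js (\<lambda>y. psi \<Lambda> i y z1 z2 t) x =
     (u * exp (\<Sum>j\<in>UNIV. - c j * x $ j) * monomial (\<lambda>j. \<kappa> j - c j) (count_list js) + v * monomial \<kappa> (count_list js)) * ?e \<kappa> x"
    unfolding split[symmetric] by (simp add: algebra_simps)
  let ?d = "\<Sum>j\<in>UNIV. count_list js j"
  have 2: "monomial (\<lambda>j. F j z1 z2 t) (count_list js) = f z1 z2 t ^ ?d * monomial \<kappa> (count_list js)"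
    unfolding monomial_scale[symmetric] by (rule arg_cong2[of _ _ _ _ monomial]) (use nz in \<open>simp_all add: \<kappa>_def\<close>)
  have 3: "monomial (\<lambda>j. F j z1 z2 t - c j * f z1 z2 t) (count_list js) = f z1 z2 t ^ ?d * monomial (\<lambda>j. \<kappa> j - c j) (count_list js)"
    unfolding monomial_scale[symmetric]
    by (rule arg_cong2[of _ _ _ _ monomial]) (use nz in \<open>simp_all add: \<kappa>_def right_diff_distrib mult.commute\<close>)
  have 4: "f z1 z2 t ^ (m - ?d) * f z1 z2 t ^ ?d = f z1 z2 t ^ m"
    using len by (simp add: power_add[symmetric])
  have "basis_numerator (rho \<Lambda> x) m i (count_list js) z1 z2 t =
     (f z1 z2 t ^ (m - ?d) * f z1 z2 t ^ ?d) * (rho \<Lambda> x * A * s1 z1 z2 * (T *v t) $ i * monomial (\<lambda>j. \<kappa> j - c j) (count_list js)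
      + s2 z1 z2 * t $ i * monomial \<kappa> (count_list js))"
    unfolding basis_numerator_def 2 3 by (simp add: algebra_simps)
  then have "basis_numerator (rho \<Lambda> x) m i (count_list js) z1 z2 t / f z1 z2 t ^ Suc m =
     (rho \<Lambda> x * A * s1 z1 z2 * (T *v t) $ i * monomial (\<lambda>j. \<kappa> j - c j) (count_list js)
      + s2 z1 z2 * t $ i * monomial \<kappa> (count_list js)) / f z1 z2 t"
    unfolding 4 using nz by (simp add: field_simps)
  also have "\<dots> = u * exp (\<Sum>j\<in>UNIV. - c j * x $ j) * monomial (\<lambda>j. \<kappa> j - c j) (count_list js) + v * monomial \<kappa> (count_list js)"
    unfolding u_def v_def rho_def by (simp add: add_divide_distrib mult_ac)
  finally show ?thesis unfolding 1 ex by simp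
qed

lemma psi_generate:
  assumes nonres: "\<Lambda> \<noteq> exp (\<Sum>j\<in>UNIV. c j * x0 $ j)"
    and \<theta>: "\<theta> \<in> glued_functions \<Lambda> x0"
  shows "\<exists>L. (\<forall>i. L i \<in> diff_ops x0) \<and>
    germ_eq x0 f \<theta> (\<lambda>x z1 z2 t. \<Sum>i\<in>UNIV. act (L i) (psi \<Lambda> i) x z1 z2 t)"
proof -
  obtain k where k: "k \<ge> 1 \<and> \<theta> \<in> glued_level \<Lambda> x0 k" using \<theta> unfolding glued_functions_iff by (rule exE)
  then obtain m where m: "k = Suc m" by (metis Suc_le_D One_nat_def)
  have lev: "\<theta> \<in> glued_level \<Lambda> x0 (Suc m)" using k m by simp
  obtain H where H: "H \<in> germ_forms x0 (Suc m) \<and>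
      germ_eq x0 f \<theta> (\<lambda>x z1 z2 t. H x z1 z2 t / f z1 z2 t ^ Suc m * exp_factor x z1 z2 t)"
    using glued_level_form[OF lev] by (rule exE)
  have HF: "H \<in> germ_forms x0 (Suc m)" using H by simp
  obtain h where h: "H = numerator (Suc m) h" using germ_formsE[OF HF] by metis
  let ?L = "{\<gamma> :: 'n \<Rightarrow> nat. mdeg \<gamma> \<le> m}"
  let ?B = "\<lambda>(i, \<gamma>) x (z1, z2, t). basis_numerator (rho \<Lambda> x) m i \<gamma> z1 z2 t"
  let ?H = "\<lambda>x (z1, z2, t). H x z1 z2 t"
  have fL: "finite ?L" by (rule finite_multidegree_le)
  have ev\<theta>: "\<forall>\<^sub>F x in nhds x0. \<forall>z1 z2 t. f z1 z2 t \<noteq> 0 \<longrightarrow> \<theta> x z1 z2 t = H x z1 z2 t / f z1 z2 t ^ Suc m * exp_factor x z1 z2 t"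
    using H unfolding germ_eq_def by (rule conjunct2)
  have glue: "\<forall>\<^sub>F x in nhds x0. \<forall>t. f a1 b1 t \<noteq> 0 \<and> f a2 b2 (T *v t) \<noteq> 0 \<longrightarrow>
     \<theta> x a1 b1 t - \<Lambda> * \<theta> x a2 b2 (T *v t) = 0"
    using lev unfolding glued_level_iff glues_def by (rule conjunct2)
  have ex: "\<exists>a. (\<forall>i\<in>UNIV \<times> ?L. a i \<in> analytic_germs x0) \<and>
      (\<forall>\<^sub>F x in nhds x0. \<forall>p. ?H x p = (\<Sum>i\<in>UNIV \<times> ?L. a i x * ?B i x p))"
  proof (rule analytic_coefficients)
    show "finite ((UNIV :: 'n set) \<times> ?L)" by (intro finite_cartesian_product fL) simp
    show "(\<lambda>x. ?H x p) \<in> analytic_germs x0" for p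
      by (cases p) (simp add: germ_forms_point_germ[OF HF])
    fix i :: "'n \<times> ('n \<Rightarrow> nat)" and p :: "complex \<times> complex \<times> (complex^'n)"
    assume "i \<in> UNIV \<times> ?L"
    then show "(\<lambda>x. ?B i x p) \<in> analytic_germs x0"
      by (cases i; cases p) (simp add: germ_forms_point_germ[OF basis_numerator_germ_forms[OF rho_germ]])
  next
    fix a assume a: "\<And>p. (\<Sum>i\<in>UNIV \<times> ?L. a i * ?B i x0 p) = 0"
    have "a (i, \<gamma>) = 0" if "\<gamma> \<in> ?L" for i \<gamma>
    proof (rule basis_numerators_independent[where a = "\<lambda>i \<gamma>. a (i, \<gamma>)" and m = m and \<rho> = "rho \<Lambda> x0"])
      show "rho \<Lambda> x0 \<noteq> 1" using nonres unfolding rho_neq_1_iff .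
      fix z1 z2 t
      show "(\<Sum>i\<in>UNIV. \<Sum>\<gamma>\<in>?L. a (i, \<gamma>) * basis_numerator (rho \<Lambda> x0) m i \<gamma> z1 z2 t) = 0"
        using a[of "(z1, z2, t)"] by (simp add: sum.cartesian_product case_prod_unfold)
    qed (use that in simp)
    then show "\<forall>i\<in>UNIV \<times> ?L. a i = 0" by auto
  next
    show "\<forall>\<^sub>F x in nhds x0. \<exists>a. \<forall>p. ?H x p = (\<Sum>i\<in>UNIV \<times> ?L. a i * ?B i x p)"
      using ev\<theta> glue rho_neq_1_near[OF nonres]
    proof eventually_elim
      case (elim x)
      have HG: "H x a1 b1 t - rho \<Lambda> x * A ^ Suc m * H x a2 b2 (T *v t) = 0" for t
      proof (rule f_p1_dense[where t = t])
        show "continuous_on UNIV (\<lambda>t. H x a1 b1 t - rho \<Lambda> x * A ^ Suc m * H x a2 b2 (T *v t))"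
          unfolding h numerator_def matrix_vector_mult_def vec_lambda_beta by (intro continuous_intros)
        fix t assume nz: "f a1 b1 t \<noteq> 0"
        then have nz2: "f a2 b2 (T *v t) \<noteq> 0" using f_p2[of t] by auto
        have "\<theta> x a1 b1 t - \<Lambda> * \<theta> x a2 b2 (T *v t) = 0" using elim(2) nz nz2 by simp
        then have "H x a1 b1 t = rho \<Lambda> x * A ^ Suc m * H x a2 b2 (T *v t)"
          using elim(1) nz nz2 numerator_glue_iff[OF nz, of "H x a1 b1 t" "Suc m" x \<Lambda> "H x a2 b2 (T *v t)"] by simp
        then show "H x a1 b1 t - rho \<Lambda> x * A ^ Suc m * H x a2 b2 (T *v t) = 0" by simp
      qed
      have HG': "H x a1 b1 t = rho \<Lambda> x * A ^ Suc m * H x a2 b2 (T *v t)" for t using HG[of t] by simp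
      have "\<exists>a. \<forall>z1 z2 t. H x z1 z2 t = (\<Sum>(i, \<gamma>)\<in>UNIV \<times> ?L. a (i, \<gamma>) * basis_numerator (rho \<Lambda> x) m i \<gamma> z1 z2 t)"
        by (rule glued_numerator_expansion[OF elim(3), of "H x" m h x]) (simp_all only: h[symmetric] HG')
      then obtain a where a: "\<forall>z1 z2 t. H x z1 z2 t = (\<Sum>(i, \<gamma>)\<in>UNIV \<times> ?L. a (i, \<gamma>) * basis_numerator (rho \<Lambda> x) m i \<gamma> z1 z2 t)"
        by (rule exE)
      have "?H x p = (\<Sum>i\<in>UNIV \<times> ?L. a i * ?B i x p)" for p
      proof (cases p)
        case (fields z1 z2 t)
        show ?thesis using a[rule_format, of z1 z2 t] unfolding fields by (simp add: case_prod_unfold)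
      qed
      then show ?case by (intro exI[of _ a] allI)
    qed
  qed
  then obtain a where a: "(\<forall>i\<in>UNIV \<times> ?L. a i \<in> analytic_germs x0) \<and>
      (\<forall>\<^sub>F x in nhds x0. \<forall>p. ?H x p = (\<Sum>i\<in>UNIV \<times> ?L. a i x * ?B i x p))" by (rule exE)
  define L where "L i = (\<lambda>g x. \<Sum>\<gamma>\<in>?L. a (i, \<gamma>) x * word_deriv (word_of \<gamma>) g x)" for i
  show ?thesis
  proof (intro exI[of _ L] conjI allI)
    fix i
    show "L i \<in> diff_ops x0"
      unfolding L_def by (rule sum_in_diff_ops[OF fL]) (use a in simp)
  next
    have "\<forall>\<^sub>F x in nhds x0. \<forall>p. ?H x p = (\<Sum>i\<in>UNIV \<times> ?L. a i x * ?B i x p)" using a by (rule conjunct2)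
    then show "germ_eq x0 f \<theta> (\<lambda>x z1 z2 t. \<Sum>i\<in>UNIV. act (L i) (psi \<Lambda> i) x z1 z2 t)"
      unfolding germ_eq_def using ev\<theta>
    proof eventually_elim
      case (elim x)
      show ?case
      proof (intro allI impI)
        fix z1 z2 t assume nz: "f z1 z2 t \<noteq> 0"
        have "(\<Sum>i\<in>UNIV. act (L i) (psi \<Lambda> i) x z1 z2 t) =
          (\<Sum>i\<in>UNIV. \<Sum>\<gamma>\<in>?L. a (i, \<gamma>) x * (basis_numerator (rho \<Lambda> x) m i \<gamma> z1 z2 t / f z1 z2 t ^ Suc m * exp_factor x z1 z2 t))"
          unfolding act_def L_def
        proof (intro sum.cong refl)
          fix i \<gamma> assume "\<gamma> \<in> ?L"
          then show "a (i, \<gamma>) x * word_deriv (word_of \<gamma>) (\<lambda>y. psi \<Lambda> i y z1 z2 t) x =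
             a (i, \<gamma>) x * (basis_numerator (rho \<Lambda> x) m i \<gamma> z1 z2 t / f z1 z2 t ^ Suc m * exp_factor x z1 z2 t)"
            using word_deriv_psi[OF nz, of "word_of \<gamma>" m \<Lambda> i x] by simp
        qed
        also have "\<dots> = (\<Sum>i\<in>UNIV. \<Sum>\<gamma>\<in>?L. a (i, \<gamma>) x * basis_numerator (rho \<Lambda> x) m i \<gamma> z1 z2 t) / f z1 z2 t ^ Suc m * exp_factor x z1 z2 t"
          by (simp add: sum_distrib_right sum_divide_distrib mult.assoc)
        also have "(\<Sum>i\<in>UNIV. \<Sum>\<gamma>\<in>?L. a (i, \<gamma>) x * basis_numerator (rho \<Lambda> x) m i \<gamma> z1 z2 t) = H x z1 z2 t"
          using elim(1)[rule_format, of "(z1, z2, t)"] by (simp add: sum.cartesian_product case_prod_unfold)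
        finally show "\<theta> x z1 z2 t = (\<Sum>i\<in>UNIV. act (L i) (psi \<Lambda> i) x z1 z2 t)"
          using elim(2) nz by simp
      qed
    qed
  qed
qed

text \<open>The total coefficients of the operators are the coefficients of a relation between the
  numerators of derivatives, at every \<open>x\<close> near \<open>x0\<close> separately.\<close>

lemma psi_independent:
  assumes nonres: "\<Lambda> \<noteq> exp (\<Sum>j\<in>UNIV. c j * x0 $ j)"
    and L: "\<And>i. L i \<in> diff_ops x0"
    and rel: "germ_eq x0 f (\<lambda>x z1 z2 t. \<Sum>i\<in>UNIV. act (L i) (psi \<Lambda> i) x z1 z2 t) (\<lambda>x z1 z2 t. 0)"
  shows "zero_op x0 (L i)"
proof -
  let ?Q = "\<lambda>i U xs. open U \<and> x0 \<in> U \<and> coeffs_cdiff U xs \<and>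
     (\<forall>V g x. open V \<longrightarrow> V \<subseteq> U \<longrightarrow> cdiff_on V g \<longrightarrow> x \<in> V \<longrightarrow> L i g x = opform_sum xs g x)"
  have "\<forall>i. \<exists>p. ?Q i (fst p) (snd p)"
  proof
    fix i
    show "\<exists>p. ?Q i (fst p) (snd p)"
    proof (rule diff_ops_word_form[OF L[of i]])
      fix U xs assume "open U" "x0 \<in> U" "coeffs_cdiff U xs"
        "\<And>V g x. open V \<Longrightarrow> V \<subseteq> U \<Longrightarrow> cdiff_on V g \<Longrightarrow> x \<in> V \<Longrightarrow> L i g x = opform_sum xs g x"
      then show "\<exists>p. ?Q i (fst p) (snd p)" by (intro exI[of _ "(U, xs)"]) simp
    qed
  qed
  from choice[OF this] obtain P where P: "\<forall>i. ?Q i (fst (P i)) (snd (P i))" by (rule exE)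
  define U where "U i = fst (P i)" for i
  define xs where "xs i = snd (P i)" for i
  have U: "open (U i)" "x0 \<in> U i" for i using P by (simp_all add: U_def)
  have Lws: "L i g x = opform_sum (xs i) g x" if "open V" "V \<subseteq> U i" "cdiff_on V g" "x \<in> V" for V g x i
    using P that by (simp add: U_def xs_def)
  define m where "m = (\<Sum>i\<in>UNIV. \<Sum>p\<leftarrow>xs i. length (snd p))"
  have len: "(\<Sum>j\<in>UNIV. count_list w j) \<le> m" if "(a, w) \<in> set (xs i)" for a w i
  proof -
    have "length w \<le> (\<Sum>p\<leftarrow>xs i. length (snd p))"
      by (rule member_le_sum_list, use that in force, simp)
    also have "\<dots> \<le> m" unfolding m_def by (rule member_le_sum) simp_all
    finally show ?thesis by (simp add: sum_count_list_UNIV)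
  qed
  let ?L = "{\<gamma> :: 'n \<Rightarrow> nat. mdeg \<gamma> \<le> m}"
  have fL: "finite ?L" by (rule finite_multidegree_le)
  have "\<forall>\<^sub>F x in nhds x0. rho \<Lambda> x \<noteq> 1 \<and> (\<forall>z1 z2 t. f z1 z2 t \<noteq> 0 \<longrightarrow> (\<Sum>i\<in>UNIV. act (L i) (psi \<Lambda> i) x z1 z2 t) = 0)"
    using rho_neq_1_near[OF nonres] rel unfolding germ_eq_def by (rule eventually_conj)
  then obtain W where W: "open W \<and> x0 \<in> W \<and> (\<forall>x\<in>W. rho \<Lambda> x \<noteq> 1 \<and>
      (\<forall>z1 z2 t. f z1 z2 t \<noteq> 0 \<longrightarrow> (\<Sum>i\<in>UNIV. act (L i) (psi \<Lambda> i) x z1 z2 t) = 0))"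
    unfolding eventually_nhds by (rule exE)
  define V where "V = W \<inter> (\<Inter>i. U i)"
  have V: "open V" "x0 \<in> V" unfolding V_def using W U by (simp_all add: open_Int open_INT)
  have VU: "V \<subseteq> U i" for i unfolding V_def by auto
  have coeff: "total_coeff (xs i) \<gamma> x = 0" if x: "x \<in> V" and \<gamma>: "\<gamma> \<in> ?L" for i \<gamma> x
  proof (rule basis_numerators_independent[where a = "\<lambda>i \<gamma>. total_coeff (xs i) \<gamma> x" and m = m and \<rho> = "rho \<Lambda> x"])
    show "rho \<Lambda> x \<noteq> 1" using W x by (simp add: V_def)
    show "mdeg \<gamma> \<le> m" using \<gamma> by simp
    fix z1 z2 t assume nz: "f z1 z2 t \<noteq> 0"
    have sum0: "(\<Sum>i\<in>UNIV. act (L i) (psi \<Lambda> i) x z1 z2 t) = 0" using W x nz by (simp add: V_def)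
    have acts: "act (L i) (psi \<Lambda> i) x z1 z2 t =
        (\<Sum>\<gamma>\<in>?L. total_coeff (xs i) \<gamma> x * (basis_numerator (rho \<Lambda> x) m i \<gamma> z1 z2 t / f z1 z2 t ^ Suc m * exp_factor x z1 z2 t))" for i
    proof -
      have "act (L i) (psi \<Lambda> i) x z1 z2 t = opform_sum (xs i) (\<lambda>y. psi \<Lambda> i y z1 z2 t) x"
        unfolding act_def by (rule Lws[OF V(1) VU cdiff_on_psi x])
      also have "\<dots> = (\<Sum>\<gamma>\<in>?L. total_coeff (xs i) \<gamma> x * (basis_numerator (rho \<Lambda> x) m i \<gamma> z1 z2 t / f z1 z2 t ^ Suc m * exp_factor x z1 z2 t))"
      proof (rule opform_sum_grouped[OF fL])
        show "count_list w \<in> ?L" if "(a, w) \<in> set (xs i)" for a w using len[OF that] by simp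
        fix w assume "w \<in> snd ` set (xs i)"
        then have "(\<Sum>j\<in>UNIV. count_list w j) \<le> m" using len by auto
        then show "word_deriv w (\<lambda>y. psi \<Lambda> i y z1 z2 t) x =
           basis_numerator (rho \<Lambda> x) m i (count_list w) z1 z2 t / f z1 z2 t ^ Suc m * exp_factor x z1 z2 t"
          by (rule word_deriv_psi[OF nz])
      qed
      finally show ?thesis .
    qed
    have "(\<Sum>i\<in>UNIV. \<Sum>\<gamma>\<in>?L. total_coeff (xs i) \<gamma> x * (basis_numerator (rho \<Lambda> x) m i \<gamma> z1 z2 t / f z1 z2 t ^ Suc m * exp_factor x z1 z2 t)) = 0"
      using sum0 unfolding acts .
    then have "(\<Sum>i\<in>UNIV. \<Sum>\<gamma>\<in>?L. total_coeff (xs i) \<gamma> x * basis_numerator (rho \<Lambda> x) m i \<gamma> z1 z2 t) / f z1 z2 t ^ Suc m * exp_factor x z1 z2 t = 0"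
      by (simp add: sum_distrib_right sum_divide_distrib mult.assoc)
    then show "(\<Sum>i\<in>UNIV. \<Sum>\<gamma>\<in>?L. total_coeff (xs i) \<gamma> x * basis_numerator (rho \<Lambda> x) m i \<gamma> z1 z2 t) = 0"
      using nz by (simp add: exp_factor_def)
  qed
  show ?thesis
  proof (rule zero_op_if_total_coeff_zero[OF _ V])
    show "L i g x = opform_sum (xs i) g x" if "open V'" "V' \<subseteq> V" "cdiff_on V' g" "x \<in> V'" for V' g x
      by (rule Lws[OF that(1) _ that(3,4)]) (use that(2) VU in blast)
    fix x \<gamma> assume x: "x \<in> V" and "\<gamma> \<in> (\<lambda>(a, w). count_list w) ` set (xs i)"
    then have "\<gamma> \<in> ?L" using len by auto
    then show "total_coeff (xs i) \<gamma> x = 0" by (rule coeff[OF x])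
  qed
qed

lemma glued_functions_free:
  assumes nonres: "\<Lambda> \<noteq> exp (\<Sum>j\<in>UNIV. c j * x0 $ j)"
  shows "free_basis x0 f (glued_functions \<Lambda> x0) (psi \<Lambda>)"
  unfolding free_basis_def
proof (intro conjI allI ballI impI)
  show "psi \<Lambda> i \<in> glued_functions \<Lambda> x0" for i
    unfolding glued_functions_iff using psi_glued_level by (intro exI[of _ 1]) simp
  show "\<exists>L. (\<forall>i. L i \<in> diff_ops x0) \<and> germ_eq x0 f \<theta> (\<lambda>x z1 z2 t. \<Sum>i\<in>UNIV. act (L i) (psi \<Lambda> i) x z1 z2 t)"
    if "\<theta> \<in> glued_functions \<Lambda> x0" for \<theta> by (rule psi_generate[OF nonres that])
  show "zero_op x0 (L i)" if "(\<forall>i. L i \<in> diff_ops x0) \<and>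
        germ_eq x0 f (\<lambda>x z1 z2 t. \<Sum>i\<in>UNIV. act (L i) (psi \<Lambda> i) x z1 z2 t) (\<lambda>x z1 z2 t. 0)" for L i
    by (rule psi_independent[OF nonres]) (use that in simp_all)
qed

end

theorem theorem1:
  fixes a1 b1 a2 b2 A \<Lambda> :: complex
    and T :: "complex^'n^'n"
    and lam :: "'n \<Rightarrow> complex"
    and w :: "'n \<Rightarrow> complex^'n"
    and \<alpha> \<beta> :: "complex^'n"
    and \<alpha>' \<beta>' :: "complex^'n^'n"
    and c :: "'n \<Rightarrow> complex"
    and x0 :: "complex^'n"
    and f :: "complex \<Rightarrow> complex \<Rightarrow> complex^'n \<Rightarrow> complex"
    and F :: "'n \<Rightarrow> complex \<Rightarrow> complex \<Rightarrow> complex^'n \<Rightarrow> complex"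
  assumes p1: "(a1, b1) \<noteq> (0, 0)"
    and p2: "(a2, b2) \<noteq> (0, 0)"
    and p1_p2: "cp1_point a1 b1 \<noteq> cp1_point a2 b2"
    and nondegenerate: "invertible T"
    and eigenvalues_distinct: "inj lam"
    and eigenvectors: "\<And>j. w j \<noteq> 0 \<and> T *v w j = lam j *s w j"
    and A: "A \<noteq> 0"
    and f: "f = form11 \<alpha> \<beta>"
    and f_glue: "\<And>t. f a1 b1 t - A * f a2 b2 (T *v t) = 0"
    and f_eigenvectors: "\<And>j. f a1 b1 (w j) \<noteq> 0"
    and F: "\<And>i. F i = form11 (\<alpha>'$i) (\<beta>'$i)"
    and F_glue: "\<And>i t. F i a1 b1 t - A * F i a2 b2 (T *v t) - c i * f a1 b1 t = 0"
    and independent: "\<And>d0 d. (\<forall>z1 z2 t. d0 * f z1 z2 t + (\<Sum>i\<in>UNIV. d i * F i z1 z2 t) = 0)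
                        \<Longrightarrow> d0 = 0 \<and> (\<forall>i. d i = 0)"
    and general_position: "\<And>k. card (cp1_roots (omit_det \<alpha> \<beta> \<alpha>' \<beta>' k)) = CARD('n)"
    and nonresonant: "\<Lambda> \<noteq> exp (\<Sum>j\<in>UNIV. c j * x0$j)"
  shows "diff_module x0 (BA_module a1 b1 a2 b2 T \<Lambda> f F x0) \<and>
         (\<exists>\<psi> :: 'n \<Rightarrow> 'n xfun.
            (\<forall>i. \<psi> i \<in> BA_level a1 b1 a2 b2 T \<Lambda> f F x0 1) \<and>
            free_basis x0 f (BA_module a1 b1 a2 b2 T \<Lambda> f F x0) \<psi>)"
proof -
  interpret glued_pencil a1 b1 a2 b2 A T lam w \<alpha> \<beta> \<alpha>' \<beta>' c f F
    by (unfold_locales; (rule assms | erule assms))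
  show ?thesis
  proof (intro conjI exI[of _ "psi \<Lambda>"] allI)
    show "diff_module x0 (BA_module a1 b1 a2 b2 T \<Lambda> f F x0)"
      using diff_module_glued_functions unfolding glued_functions_def .
    show "psi \<Lambda> i \<in> BA_level a1 b1 a2 b2 T \<Lambda> f F x0 1" for i
      using psi_glued_level unfolding glued_level_def .
    show "free_basis x0 f (BA_module a1 b1 a2 b2 T \<Lambda> f F x0) (psi \<Lambda>)"
      using glued_functions_free[OF nonresonant] unfolding glued_functions_def .
  qed
qed

end
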